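(* Let $R$ be the hyperfinite $II_1$ factor and let $\alpha$ be a binary shift on $R$. Then $\alpha$ is cocycle conjugate to at least countably infinitely many other, mutually non-conjugate binary shifts; that is, there exists an infinite sequence $\beta_1,\beta_2,\beta_3,\dots$ of binary shifts on $R$ such that each $\beta_k$ is cocycle conjugate to $\alpha$, no $\beta_k$ is conjugate to $\alpha$, and $\beta_j$ and $\beta_k$ are not conjugate whenever $j\neq k$.
   Context: $R$ denotes the hyperfinite $II_1$ factor with its unique normalized trace. Binary shift: A bitstream is a sequence $(a)=a_0,a_1,a_2,\dots$ of elements of $GF(2)=\{0,1\}$ with $a_0=0$. Let $(a)$ be a bitstream whose mirror sequence $\dots,a_2,a_1,a_0,a_1,a_2,\dots$ (the bi-infinite sequence with entry $a_{|j|}$ at position $j\in\mathbb{Z}$) is not periodic. Let $v_0,v_1,v_2,\dots$ be self-adjoint unitary operators satisfying $$v_iv_{i+j}=(-1)^{a_j}v_{i+j}v_i\qquad\text{for all integers } i,j\ge 0.$$ The $C^*$-algebra generated by the $v_i$ is then the CAR algebra. In the GNS representation of its unique tracial state (which vanishes on every non-trivial ordered word $v_{i_1}v_{i_2}\cdots v_{i_m}$, $i_1<i_2<\dots<i_m$, $m\ge1$), the strong closure of the linear span of words in the $v_i$ is $R$. The assignment $v_i\mapsto v_{i+1}$ for all $i\geq 0$ extends to a unital $*$-endomorphism of $R$, called the binary shift with bitstream $(a)$. Thus a binary shift on $R$ is a unital $*$-endomorphism $\alpha$ of $R$ for which there exist a bitstream $(a)$ with non-periodic mirror sequence and self-adjoint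 unitaries $v_0,v_1,\dots\in R$ which satisfy the commutation relations $v_iv_{i+j}=(-1)^{a_j}v_{i+j}v_i$ for all integers $i,j\ge 0$, generate $R$ as a von Neumann algebra, and satisfy $\alpha(v_i)=v_{i+1}$ for all $i\ge0$. Conjugacy: two unital $*$-endomorphisms $\alpha,\beta$ of $R$ are conjugate if there is a $*$-automorphism $\gamma$ of $R$ such that $\alpha(v)=\gamma(\beta(\gamma^{-1}(v)))$ for all $v\in R$. Cocycle conjugacy: two unital $*$-endomorphisms $\alpha,\beta$ of $R$ are cocycle conjugate if there is a unitary $u\in R$ such that $\mathrm{Ad}(u)\circ\alpha$ and $\beta$ are conjugate, where $\mathrm{Ad}(u)$ denotes the inner automorphism of $R$ given by conjugation by the unitary $u$, e.g. $x\mapsto uxu^*$ (since $u$ ranges over all unitaries, replacing $u$ by $u^*$ does not change the notion). *)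

theory Defs
  imports "HOL-Analysis.Analysis" "HOL-Library.Z2"
begin

section \<open>Complex Hilbert spaces and their bounded operators\<close>

(* The inner product is linear in the second argument and induces the norm. *)
class complex_hilbert_space = banach +
  fixes scaleC :: "complex \<Rightarrow> 'a \<Rightarrow> 'a"  (infixr "*\<^sub>C" 75)
    and cinner :: "'a \<Rightarrow> 'a \<Rightarrow> complex"
  assumes scaleC_add_right: "c *\<^sub>C (x + y) = c *\<^sub>C x + c *\<^sub>C y"
    and scaleC_add_left: "(c + d) *\<^sub>C x = c *\<^sub>C x + d *\<^sub>C x"
    and scaleC_scaleC: "c *\<^sub>C d *\<^sub>C x = (c * d) *\<^sub>C x"
    and scaleR_eq_scaleC: "r *\<^sub>R x = complex_of_real r *\<^sub>C x"
    and cinner_commute: "cinner x y = cnj (cinner y x)"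
    and cinner_add_right: "cinner x (y + z) = cinner x y + cinner x z"
    and cinner_scaleC_right: "cinner x (c *\<^sub>C y) = c * cinner x y"
    and cinner_self: "cinner x x = complex_of_real ((norm x)\<^sup>2)"

lemma norm_scaleC: "norm (c *\<^sub>C x) = cmod c * norm x" for x :: "'h::complex_hilbert_space"
proof -
  have "complex_of_real ((norm (c *\<^sub>C x))\<^sup>2) = c * cinner (c *\<^sub>C x) x"
    by (metis cinner_self cinner_scaleC_right)
  also have "cinner (c *\<^sub>C x) x = cnj c * cinner x x"
    by (metis cinner_commute cinner_scaleC_right complex_cnj_mult)
  also have "c * (cnj c * cinner x x) = complex_of_real ((cmod c * norm x)\<^sup>2)"
    by (simp add: cinner_self power_mult_distrib complex_norm_square[symmetric]
        mult.assoc[symmetric] del: of_real_power)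
  finally have "(norm (c *\<^sub>C x))\<^sup>2 = (cmod c * norm x)\<^sup>2"
    using of_real_eq_iff by blast
  then show ?thesis by (simp add: power2_eq_iff_nonneg)
qed

(* The operator c 1; a complex multiple c T of an operator is scalar_op c o\<^sub>L T. *)
lift_definition scalar_op :: "complex \<Rightarrow> 'h::complex_hilbert_space \<Rightarrow>\<^sub>L 'h" is "scaleC"
proof (rule bounded_linear_intro)
  fix c :: complex and x y :: 'h and r :: real
  show "c *\<^sub>C (x + y) = c *\<^sub>C x + c *\<^sub>C y" by (rule scaleC_add_right)
  show "c *\<^sub>C (r *\<^sub>R x) = r *\<^sub>R (c *\<^sub>C x)"
    by (simp add: scaleR_eq_scaleC scaleC_scaleC mult.commute)
  show "norm (c *\<^sub>C x) \<le> norm x * cmod c" by (simp add: norm_scaleC mult.commute)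
qed

(* The type 'h \<Rightarrow>\<^sub>L 'h consists of the bounded real-linear operators; B(H) is the
   complex-linear part of it. *)
definition clinear_ops :: "('h::complex_hilbert_space \<Rightarrow>\<^sub>L 'h) set" where
  "clinear_ops = {T :: 'h \<Rightarrow>\<^sub>L 'h. \<forall>c x. T (c *\<^sub>C x) = c *\<^sub>C T x}"

(* Well defined for T in clinear_ops by the Riesz representation theorem. *)
definition adj :: "('h::complex_hilbert_space \<Rightarrow>\<^sub>L 'h) \<Rightarrow> 'h \<Rightarrow>\<^sub>L 'h" where
  "adj T = (THE S :: 'h \<Rightarrow>\<^sub>L 'h. \<forall>x y. cinner (S x) y = cinner x (T y))"

definition unitary_op :: "('h::complex_hilbert_space \<Rightarrow>\<^sub>L 'h) \<Rightarrow> bool" where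
  "unitary_op U \<longleftrightarrow> U \<in> clinear_ops \<and> adj U o\<^sub>L U = id_blinfun \<and> U o\<^sub>L adj U = id_blinfun"

section \<open>The hyperfinite II\<open>\<^sub>1\<close> factor\<close>

(* Closure under complex multiples follows from containing all c 1. *)
definition unital_star_subalgebra :: "('h::complex_hilbert_space \<Rightarrow>\<^sub>L 'h) set \<Rightarrow> bool" where
  "unital_star_subalgebra N \<longleftrightarrow>
     N \<subseteq> clinear_ops \<and> range scalar_op \<subseteq> N \<and>
     (\<forall>S\<in>N. \<forall>T\<in>N. S + T \<in> N \<and> S o\<^sub>L T \<in> N) \<and> (\<forall>T\<in>N. adj T \<in> N)"

definition von_neumann_algebra :: "('h::complex_hilbert_space \<Rightarrow>\<^sub>L 'h) set \<Rightarrow> bool" where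
  "von_neumann_algebra M \<longleftrightarrow>
     unital_star_subalgebra M \<and> closedin strong_operator_topology M"

definition factor :: "('h::complex_hilbert_space \<Rightarrow>\<^sub>L 'h) set \<Rightarrow> bool" where
  "factor M \<longleftrightarrow>
     von_neumann_algebra M \<and> {T \<in> M. \<forall>S\<in>M. S o\<^sub>L T = T o\<^sub>L S} = range scalar_op"

(* Real and complex finite-dimensionality agree, so the real span may be used. *)
definition finite_dim :: "('h::complex_hilbert_space \<Rightarrow>\<^sub>L 'h) set \<Rightarrow> bool" where
  "finite_dim N \<longleftrightarrow> (\<exists>B. finite B \<and> N \<subseteq> span B)"

(* The last clause is normality: the ultraweakly continuous functionals are those of the form
   T \<mapsto> \<Sum>n. \<langle>y n, T (x n)\<rangle> with square-summable sequences x and y of vectors. *)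
definition faithful_normal_trace ::
    "('h::complex_hilbert_space \<Rightarrow>\<^sub>L 'h) set \<Rightarrow> (('h \<Rightarrow>\<^sub>L 'h) \<Rightarrow> complex) \<Rightarrow> bool" where
  "faithful_normal_trace M \<tau> \<longleftrightarrow>
     \<tau> id_blinfun = 1 \<and>
     (\<forall>S\<in>M. \<forall>T\<in>M. \<tau> (S + T) = \<tau> S + \<tau> T) \<and>
     (\<forall>c. \<forall>T\<in>M. \<tau> (scalar_op c o\<^sub>L T) = c * \<tau> T) \<and>
     (\<forall>T\<in>M. \<tau> (adj T o\<^sub>L T) \<in> \<real>\<^sub>\<ge>\<^sub>0) \<and>
     (\<forall>T\<in>M. \<tau> (adj T o\<^sub>L T) = 0 \<longrightarrow> T = 0) \<and>
     (\<forall>S\<in>M. \<forall>T\<in>M. \<tau> (S o\<^sub>L T) = \<tau> (T o\<^sub>L S)) \<and>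
     (\<exists>x y :: nat \<Rightarrow> 'h. summable (\<lambda>n. (norm (x n))\<^sup>2) \<and> summable (\<lambda>n. (norm (y n))\<^sup>2) \<and>
        (\<forall>T\<in>M. (\<lambda>n. cinner (y n) (blinfun_apply T (x n))) sums \<tau> T))"

definition II1_factor :: "('h::complex_hilbert_space \<Rightarrow>\<^sub>L 'h) set \<Rightarrow> bool" where
  "II1_factor M \<longleftrightarrow> factor M \<and> \<not> finite_dim M \<and> (\<exists>\<tau>. faithful_normal_trace M \<tau>)"

definition hyperfinite :: "('h::complex_hilbert_space \<Rightarrow>\<^sub>L 'h) set \<Rightarrow> bool" where
  "hyperfinite M \<longleftrightarrow>
     (\<exists>N :: nat \<Rightarrow> ('h \<Rightarrow>\<^sub>L 'h) set.
        (\<forall>k. unital_star_subalgebra (N k) \<and> finite_dim (N k) \<and> N k \<subseteq> N (Suc k)) \<and>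
        strong_operator_topology closure_of (\<Union>k. N k) = M)"

definition hyperfinite_II1_factor :: "('h::complex_hilbert_space \<Rightarrow>\<^sub>L 'h) set \<Rightarrow> bool" where
  "hyperfinite_II1_factor M \<longleftrightarrow> II1_factor M \<and> hyperfinite M"

section \<open>Endomorphisms and binary shifts\<close>

(* Maps of M are total functions on operators; only their values on M matter. *)
definition unital_star_endo ::
    "('h::complex_hilbert_space \<Rightarrow>\<^sub>L 'h) set \<Rightarrow> (('h \<Rightarrow>\<^sub>L 'h) \<Rightarrow> 'h \<Rightarrow>\<^sub>L 'h) \<Rightarrow> bool" where
  "unital_star_endo M \<alpha> \<longleftrightarrow>
     \<alpha> ` M \<subseteq> M \<and> \<alpha> id_blinfun = id_blinfun \<and>
     (\<forall>S\<in>M. \<forall>T\<in>M. \<alpha> (S + T) = \<alpha> S + \<alpha> T) \<and>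
     (\<forall>c. \<forall>T\<in>M. \<alpha> (scalar_op c o\<^sub>L T) = scalar_op c o\<^sub>L \<alpha> T) \<and>
     (\<forall>S\<in>M. \<forall>T\<in>M. \<alpha> (S o\<^sub>L T) = \<alpha> S o\<^sub>L \<alpha> T) \<and>
     (\<forall>T\<in>M. \<alpha> (adj T) = adj (\<alpha> T))"

definition star_automorphism ::
    "('h::complex_hilbert_space \<Rightarrow>\<^sub>L 'h) set \<Rightarrow> (('h \<Rightarrow>\<^sub>L 'h) \<Rightarrow> 'h \<Rightarrow>\<^sub>L 'h) \<Rightarrow> bool" where
  "star_automorphism M \<gamma> \<longleftrightarrow> unital_star_endo M \<gamma> \<and> bij_betw \<gamma> M M"

definition bitstream :: "(nat \<Rightarrow> bit) \<Rightarrow> bool" where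
  "bitstream a \<longleftrightarrow> a 0 = 0"

definition mirror :: "(nat \<Rightarrow> bit) \<Rightarrow> int \<Rightarrow> bit" where
  "mirror a j = a (nat \<bar>j\<bar>)"

definition periodic :: "(int \<Rightarrow> bit) \<Rightarrow> bool" where
  "periodic s \<longleftrightarrow> (\<exists>p>0. \<forall>j. s (j + p) = s j)"

definition binary_shift ::
    "('h::complex_hilbert_space \<Rightarrow>\<^sub>L 'h) set \<Rightarrow> (('h \<Rightarrow>\<^sub>L 'h) \<Rightarrow> 'h \<Rightarrow>\<^sub>L 'h) \<Rightarrow> bool" where
  "binary_shift M \<alpha> \<longleftrightarrow>
     unital_star_endo M \<alpha> \<and>
     (\<exists>(a :: nat \<Rightarrow> bit) (v :: nat \<Rightarrow> 'h \<Rightarrow>\<^sub>L 'h).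
        bitstream a \<and> \<not> periodic (mirror a) \<and>
        (\<forall>i. v i \<in> M \<and> unitary_op (v i) \<and> adj (v i) = v i) \<and>
        (\<forall>i j. v i o\<^sub>L v (i + j) = (if a j = 1 then -1 else 1) *\<^sub>R (v (i + j) o\<^sub>L v i)) \<and>
        von_neumann_algebra hull (range v) = M \<and>
        (\<forall>i. \<alpha> (v i) = v (Suc i)))"

definition conjugate ::
    "('h::complex_hilbert_space \<Rightarrow>\<^sub>L 'h) set \<Rightarrow> (('h \<Rightarrow>\<^sub>L 'h) \<Rightarrow> 'h \<Rightarrow>\<^sub>L 'h) \<Rightarrow>
      (('h \<Rightarrow>\<^sub>L 'h) \<Rightarrow> 'h \<Rightarrow>\<^sub>L 'h) \<Rightarrow> bool" where
  "conjugate M \<alpha> \<beta> \<longleftrightarrow>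
     (\<exists>\<gamma>. star_automorphism M \<gamma> \<and> (\<forall>T\<in>M. \<alpha> T = \<gamma> (\<beta> (inv_into M \<gamma> T))))"

definition Ad :: "('h::complex_hilbert_space \<Rightarrow>\<^sub>L 'h) \<Rightarrow> ('h \<Rightarrow>\<^sub>L 'h) \<Rightarrow> 'h \<Rightarrow>\<^sub>L 'h" where
  "Ad u T = u o\<^sub>L T o\<^sub>L adj u"

definition cocycle_conjugate ::
    "('h::complex_hilbert_space \<Rightarrow>\<^sub>L 'h) set \<Rightarrow> (('h \<Rightarrow>\<^sub>L 'h) \<Rightarrow> 'h \<Rightarrow>\<^sub>L 'h) \<Rightarrow>
      (('h \<Rightarrow>\<^sub>L 'h) \<Rightarrow> 'h \<Rightarrow>\<^sub>L 'h) \<Rightarrow> bool" where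
  "cocycle_conjugate M \<alpha> \<beta> \<longleftrightarrow> (\<exists>u\<in>M. unitary_op u \<and> conjugate M (Ad u \<circ> \<alpha>) \<beta>)"

end

theory Submission
  imports Defs "HOL-Computational_Algebra.Polynomial"
begin

text \<open>Write \<open>v\<^sub>p\<close> for the product of the generators \<open>v\<^sub>i\<close> over the exponents \<open>i\<close> of a polynomial \<open>p\<close> over the
  two-element field.  Up to signs, words multiply as polynomials add, the binary shift is
  multiplication by the indeterminate \<open>X\<close>, and commutation of words is an alternating bilinear form
  built from the mirror sequence.  Non-periodicity of the mirror sequence makes this form
  non-degenerate (\<open>nonperiodic_imp_nondegenerate\<close>).

  \<^emph>\<open>Producing the shifts.\<close>  For a word \<open>Z\<close> that is a self-adjoint unitary, conjugation by
  \<open>u = (1 + iZ)/\<surd>2\<close> acts on words as a symplectic transvection.  If \<open>Z\<close> is built from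
  \<open>v\<^sub>0, \<dots>, v\<^sub>m\<close>, commutes with \<open>v\<^sub>1, \<dots>, v\<^sub>m\<close> and anticommutes with \<open>v\<^sub>0\<close> and \<open>v\<^sub>m\<^sub>+\<^sub>1\<close>, then the orbit of
  \<open>v\<^sub>0\<close> under \<open>Ad(u) \<circ> \<alpha>\<close> is \<open>v\<^sub>0, \<dots>, v\<^sub>m\<close> followed by a multiple of \<open>Z v\<^sub>m\<^sub>+\<^sub>1\<close> and then by multiples of
  words of increasing degree.  So \<open>Ad(u) \<circ> \<alpha>\<close> is a binary shift whose bitstream first differs from
  that of \<open>\<alpha>\<close> at position \<open>m + 1\<close> (\<open>perturbed_shift\<close>).  Such \<open>Z\<close> exist for arbitrarily large \<open>m\<close>
  (\<open>exists_perturbing_word\<close>), which gives infinitely many different bitstreams.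

  \<^emph>\<open>Telling them apart.\<close>  Conjugate binary shifts have the same bitstream
  (\<open>conjugate_bitstreams_agree\<close>).  A conjugacy carries the generators of one shift to a second
  generating sequence \<open>u\<^sub>i\<close> of the other.  The 2-norm closure \<open>H k\<close> of the range of the \<open>k\<close>-th power
  of the shift is spanned by the words in \<open>v\<^sub>i\<close>, \<open>i \<ge> k\<close>, and also by the words in \<open>u\<^sub>i\<close>, \<open>i \<ge> k\<close>;
  therefore conjugation by \<open>u\<^sub>0\<close> preserves it.  If \<open>v\<^sub>p\<close> occurs in the expansion of \<open>u\<^sub>0\<close>, an averaging
  argument shows inductively that \<open>u\<^sub>0 v\<^sub>p\<close> lies in every \<open>H k\<close>, so that \<open>u\<^sub>0\<close> is a multiple of \<open>v\<^sub>p\<close>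
  (\<open>occurring_words\<close>, \<open>generator_is_word\<close>).  By symmetry \<open>v\<^sub>0\<close> is a multiple of some \<open>u\<^sub>q\<close>; then
  \<open>q p = 1\<close>, hence \<open>p = 1\<close>, and the commutation relations agree.

  \<^emph>\<open>The analysis behind the second part.\<close>  Endomorphisms and automorphisms are given as algebraic maps,
  so one has to see that they preserve the trace.  This follows from uniqueness of the tracial state
  (\<open>tracial_state_unique\<close>), which is proved by Dixmier's contraction argument: by comparison of
  projections (\<open>comparison\<close>) a self-adjoint contraction has the same trace as one whose spectrum lies
  in an interval three quarters as long.  Expansions in words converge in the 2-norm because the trace
  is dominated by a vector functional of the amplified algebra, for which von Neumann's density
  theorem holds (\<open>amplified_density\<close>, \<open>trace_dominated\<close>).\<close>

section \<open>Hilbert space geometry\<close>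

lemma scaleC_zero_left [simp]: "0 *\<^sub>C x = (0::'h::complex_hilbert_space)"
  using scaleR_eq_scaleC[of 0 x] by simp

lemma scaleC_zero_right [simp]: "c *\<^sub>C (0::'h::complex_hilbert_space) = 0"
  using norm_scaleC[of c "0::'h"] by simp

lemma scaleC_one [simp]: "1 *\<^sub>C x = (x::'h::complex_hilbert_space)"
  using scaleR_eq_scaleC[of 1 x] by simp

lemma scaleC_minus_right [simp]: "c *\<^sub>C (- x) = - (c *\<^sub>C (x::'h::complex_hilbert_space))"
  by (metis add.right_inverse add_eq_0_iff scaleC_add_right scaleC_zero_right)

lemma scaleC_minus_left [simp]: "(- c) *\<^sub>C x = - (c *\<^sub>C (x::'h::complex_hilbert_space))"
  by (metis add.right_inverse add_eq_0_iff scaleC_add_left scaleC_zero_left)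

lemma scaleC_diff_right: "c *\<^sub>C (x - y) = c *\<^sub>C x - c *\<^sub>C (y::'h::complex_hilbert_space)"
  using scaleC_add_right[of c x "- y"] by simp

lemma scaleC_scaleR: "c *\<^sub>C (r *\<^sub>R x) = r *\<^sub>R (c *\<^sub>C (x::'h::complex_hilbert_space))"
  by (simp add: scaleR_eq_scaleC scaleC_scaleC mult.commute)

lemma cinner_add_left: "cinner (x + y) z = cinner x z + cinner y (z::'h::complex_hilbert_space)"
  by (metis cinner_add_right cinner_commute complex_cnj_add)

lemma cinner_scaleC_left: "cinner (c *\<^sub>C x) y = cnj c * cinner x (y::'h::complex_hilbert_space)"
  by (metis cinner_commute cinner_scaleC_right complex_cnj_mult)

lemma cinner_zero_right [simp]: "cinner x (0::'h::complex_hilbert_space) = 0"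
  using cinner_scaleC_right[of x 0 0] by simp

lemma cinner_zero_left [simp]: "cinner (0::'h::complex_hilbert_space) x = 0"
  using cinner_scaleC_left[of 0 0 x] by simp

lemma cinner_minus_right [simp]: "cinner x (- y) = - cinner x (y::'h::complex_hilbert_space)"
  by (metis add.right_inverse add_eq_0_iff cinner_add_right cinner_zero_right)

lemma cinner_minus_left [simp]: "cinner (- x) y = - cinner x (y::'h::complex_hilbert_space)"
  by (metis add.right_inverse add_eq_0_iff cinner_add_left cinner_zero_left)

lemma cinner_diff_right: "cinner x (y - z) = cinner x y - cinner x (z::'h::complex_hilbert_space)"
  using cinner_add_right[of x y "- z"] by simp

lemma cinner_diff_left: "cinner (x - y) z = cinner x z - cinner y (z::'h::complex_hilbert_space)"
  using cinner_add_left[of x "- y" z] by simp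

lemma cinner_scaleR_right: "cinner x (r *\<^sub>R y) = of_real r * cinner x (y::'h::complex_hilbert_space)"
  by (simp add: scaleR_eq_scaleC cinner_scaleC_right)

lemma cinner_scaleR_left: "cinner (r *\<^sub>R x) y = of_real r * cinner x (y::'h::complex_hilbert_space)"
  by (simp add: scaleR_eq_scaleC cinner_scaleC_left)

lemmas cinner_simps = cinner_add_left cinner_add_right cinner_diff_left cinner_diff_right
  cinner_scaleC_left cinner_scaleC_right cinner_scaleR_left cinner_scaleR_right

lemma Re_cinner_self: "Re (cinner x x) = (norm (x::'h::complex_hilbert_space))\<^sup>2"
  by (simp add: cinner_self)

lemma cinner_eq_zeroD: "(\<And>y. cinner x y = 0) \<Longrightarrow> x = (0::'h::complex_hilbert_space)"
  using cinner_self[of x] by simp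

lemma cinner_extI: "(\<And>z. cinner z x = cinner z y) \<Longrightarrow> x = (y::'h::complex_hilbert_space)"
  using cinner_eq_zeroD[of "x - y"] 
  by (metis cinner_commute cinner_diff_right complex_cnj_zero eq_iff_diff_eq_0)

lemma cinner_extI_left: "(\<And>z. cinner x z = cinner y z) \<Longrightarrow> x = (y::'h::complex_hilbert_space)"
  using cinner_eq_zeroD[of "x - y"] by (simp add: cinner_diff_left)

lemma Re_cinner_commute: "Re (cinner x y) = Re (cinner y (x::'h::complex_hilbert_space))"
  by (subst cinner_commute) simp

lemma norm_add_sq:
  "(norm (x + y))\<^sup>2 = (norm x)\<^sup>2 + 2 * Re (cinner x y) + (norm (y::'h::complex_hilbert_space))\<^sup>2"
  using Re_cinner_commute[of y x] by (simp add: Re_cinner_self[symmetric] cinner_simps)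

lemma norm_diff_sq:
  "(norm (x - y))\<^sup>2 = (norm x)\<^sup>2 - 2 * Re (cinner x y) + (norm (y::'h::complex_hilbert_space))\<^sup>2"
  using norm_add_sq[of x "- y"] by simp

lemma parallelogram:
  "(norm (x + y))\<^sup>2 + (norm (x - y))\<^sup>2 = 2 * (norm x)\<^sup>2 + 2 * (norm (y::'h::complex_hilbert_space))\<^sup>2"
  by (simp add: norm_add_sq norm_diff_sq)

lemma cinner_Cauchy_Schwarz: "cmod (cinner x y) \<le> norm x * norm (y::'h::complex_hilbert_space)"
proof (cases "y = 0")
  case False
  define c where "c = cinner y x / of_real ((norm y)\<^sup>2)"
  have ny: "norm y > 0" using False by simp
  have cc: "c * of_real ((norm y)\<^sup>2) = cinner y x"
    using False by (simp add: c_def)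
  have "0 \<le> (norm (x - c *\<^sub>C y))\<^sup>2" by simp
  also have "\<dots> = (norm x)\<^sup>2 - 2 * Re (c * cinner x y) + (cmod c)\<^sup>2 * (norm y)\<^sup>2"
    by (simp add: norm_diff_sq cinner_scaleC_right norm_scaleC power_mult_distrib)
  also have "c * cinner x y = of_real ((cmod (cinner x y))\<^sup>2 / (norm y)\<^sup>2)"
    by (simp add: c_def cinner_commute[of y x] complex_norm_square mult.commute del: of_real_power)
  also have "(cmod c)\<^sup>2 * (norm y)\<^sup>2 = (cmod (cinner x y))\<^sup>2 / (norm y)\<^sup>2"
  proof -
    have "cmod c = cmod (cinner x y) / (norm y)\<^sup>2"
      by (simp add: c_def cinner_commute[of y x] norm_divide norm_power)
    then show ?thesis using ny by (simp add: power_divide power2_eq_square)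
  qed
  finally have "(cmod (cinner x y))\<^sup>2 / (norm y)\<^sup>2 \<le> (norm x)\<^sup>2"
    by simp
  then have "(cmod (cinner x y))\<^sup>2 \<le> (norm x * norm y)\<^sup>2"
    using ny by (simp add: divide_simps power_mult_distrib)
  then show ?thesis
    by (rule power2_le_imp_le) simp
qed simp

lemma bounded_bilinear_cinner: "bounded_bilinear (cinner :: 'h::complex_hilbert_space \<Rightarrow> 'h \<Rightarrow> complex)"
proof
  show "\<exists>K. \<forall>a b. norm (cinner a (b::'h)) \<le> norm a * norm b * K"
    by (rule exI[of _ 1]) (simp add: cinner_Cauchy_Schwarz)
qed (simp_all add: cinner_simps scaleR_conv_of_real)

lemmas tendsto_cinner = bounded_bilinear.tendsto[OF bounded_bilinear_cinner]

lemma bounded_linear_scaleC: "bounded_linear (\<lambda>x::'h::complex_hilbert_space. c *\<^sub>C x)"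
  by (rule bounded_linear_intro[of _ "cmod c"])
    (simp_all add: scaleC_add_right scaleC_scaleR norm_scaleC mult.commute)

lemma scalar_op_apply [simp]: "scalar_op c x = c *\<^sub>C x"
  by (simp add: scalar_op.rep_eq)

text \<open>Subspaces over the complex numbers, as opposed to the reals.\<close>

definition csubspace :: "'h::complex_hilbert_space set \<Rightarrow> bool" where
  "csubspace K \<longleftrightarrow> 0 \<in> K \<and> (\<forall>x\<in>K. \<forall>y\<in>K. x + y \<in> K) \<and> (\<forall>c. \<forall>x\<in>K. c *\<^sub>C x \<in> K)"

lemma csubspaceD:
  assumes "csubspace K"
  shows "0 \<in> K" "x \<in> K \<Longrightarrow> y \<in> K \<Longrightarrow> x + y \<in> K" "x \<in> K \<Longrightarrow> c *\<^sub>C x \<in> K"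
    "x \<in> K \<Longrightarrow> y \<in> K \<Longrightarrow> x - y \<in> K" "x \<in> K \<Longrightarrow> r *\<^sub>R x \<in> K"
proof -
  show "0 \<in> K" "x \<in> K \<Longrightarrow> y \<in> K \<Longrightarrow> x + y \<in> K"
    using assms unfolding csubspace_def by auto
  have sc: "\<And>c x. x \<in> K \<Longrightarrow> c *\<^sub>C x \<in> K"
    using assms unfolding csubspace_def by auto
  then show "x \<in> K \<Longrightarrow> c *\<^sub>C x \<in> K" "x \<in> K \<Longrightarrow> r *\<^sub>R x \<in> K"
    by (auto simp: scaleR_eq_scaleC)
  show "x \<in> K \<Longrightarrow> y \<in> K \<Longrightarrow> x - y \<in> K"
    using assms sc[of y "-1"] unfolding csubspace_def
    by (metis diff_conv_add_uminus scaleC_minus_left scaleC_one)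
qed

lemma csubspace_closure:
  assumes "csubspace K" shows "csubspace (closure K)"
  unfolding csubspace_def
proof (intro conjI ballI allI)
  show "0 \<in> closure K" using csubspaceD(1)[OF assms] closure_subset by auto
  fix x assume "x \<in> closure K"
  then obtain f where f: "\<And>n. f n \<in> K" "f \<longlonglongrightarrow> x" by (auto simp: closure_sequential)
  { fix y assume "y \<in> closure K"
    then obtain g where g: "\<And>n. g n \<in> K" "g \<longlonglongrightarrow> y" by (auto simp: closure_sequential)
    show "x + y \<in> closure K"
      unfolding closure_sequential using f g csubspaceD(2)[OF assms]
      by (intro exI[of _ "\<lambda>n. f n + g n"]) (auto intro: tendsto_add) }
  fix c show "c *\<^sub>C x \<in> closure K"
    unfolding closure_sequential using f csubspaceD(3)[OF assms]
    by (intro exI[of _ "\<lambda>n. c *\<^sub>C f n"]) (auto intro: bounded_linear.tendsto[OF bounded_linear_scaleC])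
qed

text \<open>The distance to a closed subspace is attained because the parallelogram law makes every
  minimizing sequence a Cauchy sequence; the minimizer is the foot of the perpendicular.\<close>

lemma exists_orthogonal_foot:
  fixes K :: "'h::complex_hilbert_space set"
  assumes K: "csubspace K" and cl: "closed K"
  shows "\<exists>y\<in>K. \<forall>z\<in>K. cinner (x - y) z = 0"
proof -
  define d where "d = (INF k\<in>K. (norm (x - k))\<^sup>2)"
  have bdd: "bdd_below ((\<lambda>k. (norm (x - k))\<^sup>2) ` K)"
    by (rule bdd_belowI[of _ 0]) auto
  have ne: "K \<noteq> {}" using csubspaceD(1)[OF K] by auto
  have dle: "d \<le> (norm (x - k))\<^sup>2" if "k \<in> K" for k
    unfolding d_def using bdd that by (rule cINF_lower)
  have "\<exists>k\<in>K. (norm (x - k))\<^sup>2 < d + inverse (real (Suc n))" for n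
  proof (rule ccontr)
    assume "\<not> ?thesis"
    then have "d + inverse (real (Suc n)) \<le> d"
      unfolding d_def by (intro cINF_greatest[OF ne]) (force simp: d_def)
    then show False by (simp del: of_nat_Suc)
  qed
  then obtain k where k: "\<And>n. k n \<in> K" "\<And>n. (norm (x - k n))\<^sup>2 < d + inverse (real (Suc n))"
    by metis
  have est: "(norm (k m - k n))\<^sup>2 \<le> 2 * inverse (real (Suc m)) + 2 * inverse (real (Suc n))" for m n
  proof -
    let ?a = "x - k m" and ?b = "x - k n"
    have mid: "(1/2) *\<^sub>R (k m + k n) \<in> K" using k csubspaceD[OF K] by auto
    have e: "?a + ?b = 2 *\<^sub>R (x - (1/2) *\<^sub>R (k m + k n))"
      by (simp add: algebra_simps scaleR_2)
    have "(norm (?a + ?b))\<^sup>2 \<ge> 4 * d"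
      unfolding e using dle[OF mid] by (simp add: power_mult_distrib)
    moreover have "(norm (?a - ?b))\<^sup>2 = (norm (k m - k n))\<^sup>2"
      by (simp add: norm_minus_commute)
    ultimately show ?thesis
      using parallelogram[of ?a ?b] k(2)[of m] k(2)[of n] by linarith
  qed
  have "Cauchy k"
  proof (rule metric_CauchyI)
    fix e :: real assume e: "e > 0"
    obtain N where N: "inverse (real (Suc N)) < e\<^sup>2 / 4"
      using reals_Archimedean[of "e\<^sup>2/4"] e by auto
    have "dist (k m) (k n) < e" if "m \<ge> N" "n \<ge> N" for m n
    proof -
      have "inverse (real (Suc m)) \<le> inverse (real (Suc N))" "inverse (real (Suc n)) \<le> inverse (real (Suc N))"
        using that by (simp_all add: le_imp_inverse_le)
      then have "(norm (k m - k n))\<^sup>2 < e\<^sup>2" using est[of m n] N by linarith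
      then show ?thesis using e by (simp add: dist_norm power2_less_imp_less)
    qed
    then show "\<exists>M. \<forall>m\<ge>M. \<forall>n\<ge>M. dist (k m) (k n) < e" by blast
  qed
  then obtain y where y: "k \<longlonglongrightarrow> y" using convergent_eq_Cauchy by (auto simp: convergent_def)
  have yK: "y \<in> K" using closed_sequentially[OF cl] k(1) y by blast
  have "(\<lambda>n. (norm (x - k n))\<^sup>2) \<longlonglongrightarrow> (norm (x - y))\<^sup>2"
    by (intro tendsto_intros y)
  moreover have "(\<lambda>n. d + inverse (real (Suc n))) \<longlonglongrightarrow> d + 0"
    by (intro tendsto_intros LIMSEQ_inverse_real_of_nat)
  ultimately have "(norm (x - y))\<^sup>2 \<le> d + 0"
    by (rule LIMSEQ_le) (use k(2) less_imp_le in blast)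
  then have nd: "(norm (x - y))\<^sup>2 \<le> d" by simp
  have "cinner (x - y) z = 0" if z: "z \<in> K" for z
  proof (rule ccontr)
    assume nz: "cinner (x - y) z \<noteq> 0"
    define w where "w = cnj (cinner (x - y) z) *\<^sub>C z"
    define s where "s = (cmod (cinner (x - y) z))\<^sup>2"
    have s: "s > 0" using nz by (simp add: s_def)
    have wK: "w \<in> K" using z csubspaceD[OF K] by (simp add: w_def)
    have cw: "Re (cinner (x - y) w) = s"
      by (simp add: w_def s_def cinner_scaleC_right cmod_power2) (simp add: power2_eq_square)
    have "0 \<le> - 2 * t * s + t\<^sup>2 * (norm w)\<^sup>2" for t :: real
    proof -
      have "y + t *\<^sub>R w \<in> K" using wK yK csubspaceD[OF K] by auto
      then have "(norm (x - y))\<^sup>2 \<le> (norm ((x - y) - t *\<^sub>R w))\<^sup>2"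
        using dle[of "y + t *\<^sub>R w"] nd by (simp add: diff_diff_eq[symmetric] del: power_mono_iff)
      then show ?thesis
        using cw by (simp add: norm_diff_sq cinner_scaleR_right power_mult_distrib)
    qed
    from this[of "s / (1 + (norm w)\<^sup>2)"] 
    have "2 * (s / (1 + (norm w)\<^sup>2)) * s \<le> (s / (1 + (norm w)\<^sup>2))\<^sup>2 * (norm w)\<^sup>2" by simp
    also have "\<dots> = (s / (1 + (norm w)\<^sup>2)) * s * ((norm w)\<^sup>2 / (1 + (norm w)\<^sup>2))"
      by (simp add: power2_eq_square)
    also have "\<dots> \<le> (s / (1 + (norm w)\<^sup>2)) * s * 1"
      using s by (intro mult_left_mono) (auto simp: divide_le_eq_1_pos add_pos_nonneg)
    finally have "(s / (1 + (norm w)\<^sup>2)) * s \<le> 0" by simp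
    moreover have "(s / (1 + (norm w)\<^sup>2)) * s > 0" using s by (simp add: add_pos_nonneg)
    ultimately show False by simp
  qed
  then show ?thesis using yK by blast
qed

lemma orthogonal_projection:
  fixes K :: "'h::complex_hilbert_space set"
  assumes K: "csubspace K" and cl: "closed K"
  obtains P :: "'h \<Rightarrow>\<^sub>L 'h" where "\<And>x. P x \<in> K" "\<And>x z. z \<in> K \<Longrightarrow> cinner (x - P x) z = 0"
    "\<And>x. x \<in> K \<Longrightarrow> P x = x" "\<And>x. norm (P x) \<le> norm x"
    "\<And>c x. P (c *\<^sub>C x) = c *\<^sub>C P x"
    "\<And>x y. y \<in> K \<Longrightarrow> (\<And>z. z \<in> K \<Longrightarrow> cinner (x - y) z = 0) \<Longrightarrow> P x = y"
proof -
  obtain p where p: "\<And>x. p x \<in> K" "\<And>x z. z \<in> K \<Longrightarrow> cinner (x - p x) z = 0"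
    using exists_orthogonal_foot[OF assms] by metis
  have uniq: "p x = y" if "y \<in> K" "\<And>z. z \<in> K \<Longrightarrow> cinner (x - y) z = 0" for x y
  proof -
    have "p x - y \<in> K" using p that csubspaceD[OF K] by auto
    then have "cinner (x - y) (p x - y) - cinner (x - p x) (p x - y) = 0" using p that by auto
    then have "cinner (p x - y) (p x - y) = 0" by (simp add: cinner_diff_left)
    then show ?thesis by (simp add: cinner_self)
  qed
  have idem: "p x = x" if "x \<in> K" for x by (rule uniq) (use that in auto)
  have le: "norm (p x) \<le> norm x" for x
  proof -
    have "(norm x)\<^sup>2 = (norm ((x - p x) + p x))\<^sup>2" by simp
    also have "\<dots> = (norm (x - p x))\<^sup>2 + (norm (p x))\<^sup>2"
      unfolding norm_add_sq using p by simp
    finally have "(norm (p x))\<^sup>2 \<le> (norm x)\<^sup>2" by simp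
    then show ?thesis by (rule power2_le_imp_le) simp
  qed
  have sc: "p (c *\<^sub>C x) = c *\<^sub>C p x" for c x
    by (rule uniq) (use p csubspaceD[OF K] in \<open>auto simp: scaleC_diff_right[symmetric] cinner_scaleC_left\<close>)
  have ad: "p (x + y) = p x + p y" for x y
  proof (rule uniq)
    show "p x + p y \<in> K" using p csubspaceD[OF K] by auto
    fix z assume "z \<in> K"
    then have "cinner (x - p x) z + cinner (y - p y) z = 0" using p by simp
    moreover have "cinner (x + y - (p x + p y)) z = cinner (x - p x) z + cinner (y - p y) z"
      by (simp add: cinner_simps)
    ultimately show "cinner (x + y - (p x + p y)) z = 0" by simp
  qed
  have bl: "bounded_linear p"
    by (rule bounded_linear_intro[of _ 1]) (use ad sc le in \<open>auto simp: scaleR_eq_scaleC\<close>)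
  show ?thesis
    by (rule that[of "Blinfun p"]) (use p uniq idem le sc in \<open>auto simp: bounded_linear_Blinfun_apply[OF bl]\<close>)
qed

lemma Riesz_representation:
  fixes f :: "'h::complex_hilbert_space \<Rightarrow> complex"
  assumes bl: "bounded_linear f" and cl: "\<And>c x. f (c *\<^sub>C x) = c * f x"
  shows "\<exists>y. \<forall>x. f x = cinner y x"
proof (cases "\<forall>x. f x = 0")
  case True then show ?thesis by (intro exI[of _ 0]) simp
next
  case False
  then obtain u where u: "f u \<noteq> 0" by auto
  interpret f: bounded_linear f by fact
  define K where "K = {x. f x = 0}"
  have K: "csubspace K" by (auto simp: csubspace_def K_def f.zero f.add cl)
  have "closed K" unfolding K_def
    by (intro closed_Collect_eq continuous_intros f.continuous_on)
  from exists_orthogonal_foot[OF K this, of u] obtain k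
    where k: "k \<in> K" "\<And>z. z \<in> K \<Longrightarrow> cinner (u - k) z = 0" by auto
  define w where "w = u - k"
  have fw: "f w \<noteq> 0" using u k by (simp add: w_def f.diff K_def)
  have w0: "norm w \<noteq> 0" using fw f.zero by auto
  have "f x = cinner ((cnj (f w) / of_real ((norm w)\<^sup>2)) *\<^sub>C w) x" for x
  proof -
    have "x - (f x / f w) *\<^sub>C w \<in> K" using fw by (simp add: K_def f.diff cl)
    then have "cinner w (x - (f x / f w) *\<^sub>C w) = 0" using k by (simp add: w_def)
    then have "cinner w x = f x / f w * of_real ((norm w)\<^sup>2)"
      by (simp add: cinner_diff_right cinner_scaleC_right cinner_self)
    then show ?thesis using fw w0 by (simp add: cinner_scaleC_left)
  qed
  then show ?thesis by blast
qed

section \<open>Adjoints\<close>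

lemma clinear_opsD: "T \<in> clinear_ops \<Longrightarrow> T (c *\<^sub>C x) = c *\<^sub>C T x"
  by (simp add: clinear_ops_def)

lemma adj_exists:
  fixes T :: "'h::complex_hilbert_space \<Rightarrow>\<^sub>L 'h"
  assumes T: "T \<in> clinear_ops"
  shows "\<exists>S :: 'h \<Rightarrow>\<^sub>L 'h. \<forall>x y. cinner (S x) y = cinner x (T y)"
proof -
  have "\<exists>z. \<forall>y. cinner x (T y) = cinner z y" for x
  proof (rule Riesz_representation)
    show "bounded_linear (\<lambda>y. cinner x (T y))"
      by (intro bounded_linear_compose[OF bounded_bilinear.bounded_linear_right[OF bounded_bilinear_cinner]]
          blinfun.bounded_linear_right)
  qed (simp add: clinear_opsD[OF T] cinner_scaleC_right)
  then obtain s where s: "\<And>x y. cinner x (T y) = cinner (s x) y" by metis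
  have bl: "bounded_linear s"
  proof (rule bounded_linear_intro[of _ "norm T"])
    fix x y r
    show "s (x + y) = s x + s y" by (rule cinner_extI_left) (simp add: s[symmetric] cinner_simps)
    show "s (r *\<^sub>R x) = r *\<^sub>R s x" by (rule cinner_extI_left) (simp add: s[symmetric] cinner_simps)
    have "(norm (s x))\<^sup>2 = cmod (cinner (s x) (s x))" by (simp add: cinner_self norm_power)
    also have "\<dots> = cmod (cinner x (T (s x)))" by (simp add: s)
    also have "\<dots> \<le> norm x * norm (T (s x))" by (rule cinner_Cauchy_Schwarz)
    also have "\<dots> \<le> norm x * (norm T * norm (s x))" by (intro mult_left_mono norm_blinfun) simp
    finally have "norm (s x) * norm (s x) \<le> (norm x * norm T) * norm (s x)" by (simp add: power2_eq_square mult_ac)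
    then show "norm (s x) \<le> norm x * norm T"
      by (cases "norm (s x) = 0") (auto simp: mult_le_cancel_right)
  qed
  show ?thesis by (rule exI[of _ "Blinfun s"]) (simp add: bounded_linear_Blinfun_apply[OF bl] s)
qed

lemma adj_eqI:
  fixes T S :: "'h::complex_hilbert_space \<Rightarrow>\<^sub>L 'h"
  assumes "\<And>x y. cinner (S x) y = cinner x (T y)"
  shows "adj T = S"
  unfolding adj_def
proof (rule the_equality)
  show "\<forall>x y. cinner (S x) y = cinner x (T y)" using assms by simp
  show "S' = S" if "\<forall>x y. cinner (blinfun_apply S' x) y = cinner x (T y)" for S'
    by (rule blinfun_eqI, rule cinner_extI_left) (simp add: that assms)
qed

lemma cinner_adj_left: "T \<in> clinear_ops \<Longrightarrow> cinner (adj T x) y = cinner x (T y)"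
  using adj_exists[of T] adj_eqI by blast

lemma cinner_adj_right: "T \<in> clinear_ops \<Longrightarrow> cinner x (adj T y) = cinner (T x) y"
  by (metis cinner_adj_left cinner_commute)

lemma clinear_ops_intros:
  "id_blinfun \<in> clinear_ops" "0 \<in> clinear_ops" "scalar_op c \<in> clinear_ops"
  "S \<in> clinear_ops \<Longrightarrow> T \<in> clinear_ops \<Longrightarrow> S + T \<in> clinear_ops"
  "S \<in> clinear_ops \<Longrightarrow> T \<in> clinear_ops \<Longrightarrow> S - T \<in> clinear_ops"
  "S \<in> clinear_ops \<Longrightarrow> T \<in> clinear_ops \<Longrightarrow> S o\<^sub>L T \<in> clinear_ops"
  "T \<in> clinear_ops \<Longrightarrow> r *\<^sub>R T \<in> clinear_ops"
  "T \<in> clinear_ops \<Longrightarrow> - T \<in> clinear_ops"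
  by (auto simp: clinear_ops_def blinfun.bilinear_simps scaleC_add_right scaleC_scaleR scaleC_diff_right
      scaleC_scaleC mult.commute)

lemma adj_clinear: "T \<in> clinear_ops \<Longrightarrow> adj T \<in> clinear_ops"
proof -
  assume T: "T \<in> clinear_ops"
  have "adj T (c *\<^sub>C x) = c *\<^sub>C adj T x" for c x
    by (rule cinner_extI_left) (simp add: cinner_adj_left[OF T] cinner_scaleC_left)
  then show ?thesis by (simp add: clinear_ops_def)
qed

lemma adj_adj: "T \<in> clinear_ops \<Longrightarrow> adj (adj T) = T"
  by (rule adj_eqI) (simp add: cinner_adj_right)

lemma adj_compose: "S \<in> clinear_ops \<Longrightarrow> T \<in> clinear_ops \<Longrightarrow> adj (S o\<^sub>L T) = adj T o\<^sub>L adj S"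
  by (rule adj_eqI) (simp add: cinner_adj_left)

lemma adj_add: "S \<in> clinear_ops \<Longrightarrow> T \<in> clinear_ops \<Longrightarrow> adj (S + T) = adj S + adj T"
  by (rule adj_eqI) (simp add: cinner_adj_left blinfun.bilinear_simps cinner_simps)

lemma adj_diff: "S \<in> clinear_ops \<Longrightarrow> T \<in> clinear_ops \<Longrightarrow> adj (S - T) = adj S - adj T"
  by (rule adj_eqI) (simp add: cinner_adj_left blinfun.bilinear_simps cinner_simps)

lemma adj_minus: "T \<in> clinear_ops \<Longrightarrow> adj (- T) = - adj T"
  by (rule adj_eqI) (simp add: cinner_adj_left blinfun.bilinear_simps cinner_simps)

lemma adj_scaleR: "T \<in> clinear_ops \<Longrightarrow> adj (r *\<^sub>R T) = r *\<^sub>R adj T"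
  by (rule adj_eqI) (simp add: cinner_adj_left blinfun.bilinear_simps cinner_simps)

lemma adj_id [simp]: "adj id_blinfun = (id_blinfun :: 'h::complex_hilbert_space \<Rightarrow>\<^sub>L 'h)"
  by (rule adj_eqI) simp

lemma adj_zero [simp]: "adj 0 = (0 :: 'h::complex_hilbert_space \<Rightarrow>\<^sub>L 'h)"
  by (rule adj_eqI) simp

lemma adj_scalar_op: "adj (scalar_op c) = scalar_op (cnj c)"
  by (rule adj_eqI) (simp add: cinner_simps)

lemma norm_adj_apply_sq: "T \<in> clinear_ops \<Longrightarrow> (norm (T x))\<^sup>2 = Re (cinner (adj T (T x)) x)"
  by (simp add: cinner_adj_left Re_cinner_self)

lemma norm_adj_le: "T \<in> clinear_ops \<Longrightarrow> norm (adj T) \<le> norm T"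
proof (rule norm_blinfun_bound)
  fix x assume T: "T \<in> clinear_ops"
  have "(norm (adj T x))\<^sup>2 = Re (cinner (adj T x) (adj T x))" by (simp add: Re_cinner_self)
  also have "\<dots> = Re (cinner x (T (adj T x)))" by (simp add: cinner_adj_left T)
  also have "\<dots> \<le> norm x * norm (T (adj T x))"
    by (meson cinner_Cauchy_Schwarz complex_Re_le_cmod order_trans)
  also have "\<dots> \<le> norm x * (norm T * norm (adj T x))" by (intro mult_left_mono norm_blinfun) simp
  finally have "norm (adj T x) * norm (adj T x) \<le> (norm T * norm x) * norm (adj T x)"
    by (simp add: power2_eq_square mult_ac)
  then show "norm (adj T x) \<le> norm T * norm x"
    by (cases "norm (adj T x) = 0") (auto simp: mult_le_cancel_right)
qed simp

text \<open>Polarization: the quadratic form of a self-adjoint operator controls its norm.\<close>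

lemma norm_selfadjoint_le:
  fixes T :: "'h::complex_hilbert_space \<Rightarrow>\<^sub>L 'h"
  assumes T: "T \<in> clinear_ops" "adj T = T" and c: "c \<ge> 0"
    and b: "\<And>x. \<bar>Re (cinner (T x) x)\<bar> \<le> c * (norm x)\<^sup>2"
  shows "norm T \<le> c"
proof (rule norm_blinfun_bound[OF c])
  fix x
  have sym: "cinner (T a) b = cinner a (T b)" for a b
    using cinner_adj_left[OF T(1)] T(2) by metis
  have key: "2 * Re (cinner (T x) y) \<le> c * ((norm x)\<^sup>2 + (norm y)\<^sup>2)" for y
  proof -
    have "Re (cinner (T y) x) = Re (cinner (T x) y)"
      by (simp add: sym Re_cinner_commute[of y])
    then have "4 * Re (cinner (T x) y) = Re (cinner (T (x + y)) (x + y)) - Re (cinner (T (x - y)) (x - y))"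
      by (simp add: cinner_simps blinfun.bilinear_simps)
    also have "\<dots> \<le> c * (norm (x + y))\<^sup>2 + c * (norm (x - y))\<^sup>2"
      using b[of "x + y"] b[of "x - y"] by linarith
    also have "\<dots> = c * ((norm (x + y))\<^sup>2 + (norm (x - y))\<^sup>2)"
      by (simp add: distrib_left)
    also have "\<dots> = 2 * (c * ((norm x)\<^sup>2 + (norm y)\<^sup>2))"
      unfolding parallelogram by (simp add: algebra_simps)
    finally show ?thesis by simp
  qed
  show "norm (T x) \<le> c * norm x"
  proof (cases "T x = 0 \<or> x = 0")
    case False
    define t where "t = norm x / norm (T x)"
    have t: "t > 0" using False by (simp add: t_def)
    from key[of "t *\<^sub>R T x"] have "2 * (t * (norm (T x))\<^sup>2) \<le> c * ((norm x)\<^sup>2 + (t * norm (T x))\<^sup>2)"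
      using t by (simp add: cinner_scaleR_right Re_cinner_self)
    moreover have "t * norm (T x) = norm x" using False by (simp add: t_def)
    moreover have "t * (norm (T x))\<^sup>2 = norm x * norm (T x)" using False by (simp add: t_def power2_eq_square)
    ultimately have "2 * (norm x * norm (T x)) \<le> c * ((norm x)\<^sup>2 + (norm x)\<^sup>2)"
      by metis
    then have "norm x * norm (T x) \<le> norm x * (c * norm x)"
      by (simp add: power2_eq_square mult_ac)
    then show ?thesis using False by (simp add: mult_le_cancel_left)
  qed (use c in auto)
qed

section \<open>Square-summable sequences of vectors\<close>

text \<open>The trace is given by infinitely many vectors of the Hilbert space at once.  Such a sequence is a
  single vector of the amplified Hilbert space, on which operators act coordinatewise.\<close>

typedef (overloaded) 'h ell2 = "{f :: nat \<Rightarrow> 'h::complex_hilbert_space. summable (\<lambda>n. (norm (f n))\<^sup>2)}"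
  morphisms coord Abs_ell2
  by (rule exI[of _ "\<lambda>_. 0"]) simp

setup_lifting type_definition_ell2

lemma summable_coord: "summable (\<lambda>n. (norm (coord f n))\<^sup>2)"
  using coord by auto

lemma L2_set_le_sqrt_suminf:
  fixes f :: "nat \<Rightarrow> 'h::real_normed_vector"
  assumes "summable (\<lambda>n. (norm (f n))\<^sup>2)"
  shows "L2_set (\<lambda>n. norm (f n)) {..<k} \<le> sqrt (\<Sum>n. (norm (f n))\<^sup>2)"
  unfolding L2_set_def by (intro real_sqrt_le_mono sum_le_suminf assms) auto

lemma square_summable_bound:
  fixes f :: "nat \<Rightarrow> 'h::real_normed_vector"
  assumes b: "\<And>k. L2_set (\<lambda>n. norm (f n)) {..<k} \<le> B"
  shows "summable (\<lambda>n. (norm (f n))\<^sup>2)" "sqrt (\<Sum>n. (norm (f n))\<^sup>2) \<le> B"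
proof -
  have B: "B \<ge> 0" using b[of 0] by simp
  have s: "(\<Sum>n<k. (norm (f n))\<^sup>2) \<le> B\<^sup>2" for k
    using b[of k] B unfolding L2_set_def by (simp add: sqrt_le_D real_sqrt_le_iff sum_nonneg)
  show sm: "summable (\<lambda>n. (norm (f n))\<^sup>2)"
    by (rule summableI_nonneg_bounded[of _ "B\<^sup>2"]) (use s in auto)
  have "(\<Sum>n. (norm (f n))\<^sup>2) \<le> B\<^sup>2" by (rule suminf_le_const[OF sm s])
  then show "sqrt (\<Sum>n. (norm (f n))\<^sup>2) \<le> B" using B by (simp add: real_le_lsqrt suminf_nonneg sm)
qed

lemma square_summable_add:
  fixes f g :: "nat \<Rightarrow> 'h::real_normed_vector"
  assumes f: "summable (\<lambda>n. (norm (f n))\<^sup>2)" and g: "summable (\<lambda>n. (norm (g n))\<^sup>2)"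
  shows "summable (\<lambda>n. (norm (f n + g n))\<^sup>2)"
    "sqrt (\<Sum>n. (norm (f n + g n))\<^sup>2) \<le> sqrt (\<Sum>n. (norm (f n))\<^sup>2) + sqrt (\<Sum>n. (norm (g n))\<^sup>2)"
proof -
  have b: "L2_set (\<lambda>n. norm (f n + g n)) {..<k} \<le> sqrt (\<Sum>n. (norm (f n))\<^sup>2) + sqrt (\<Sum>n. (norm (g n))\<^sup>2)" for k
  proof -
    have "L2_set (\<lambda>n. norm (f n + g n)) {..<k} \<le> L2_set (\<lambda>n. norm (f n) + norm (g n)) {..<k}"
      by (rule L2_set_mono) (auto intro: norm_triangle_ineq)
    also have "\<dots> \<le> L2_set (\<lambda>n. norm (f n)) {..<k} + L2_set (\<lambda>n. norm (g n)) {..<k}"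
      by (rule L2_set_triangle_ineq)
    also have "\<dots> \<le> sqrt (\<Sum>n. (norm (f n))\<^sup>2) + sqrt (\<Sum>n. (norm (g n))\<^sup>2)"
      by (intro add_mono L2_set_le_sqrt_suminf f g)
    finally show ?thesis .
  qed
  from square_summable_bound[OF b] show "summable (\<lambda>n. (norm (f n + g n))\<^sup>2)"
    "sqrt (\<Sum>n. (norm (f n + g n))\<^sup>2) \<le> sqrt (\<Sum>n. (norm (f n))\<^sup>2) + sqrt (\<Sum>n. (norm (g n))\<^sup>2)" .
qed

lemma summable_cinner:
  fixes f g :: "nat \<Rightarrow> 'h::complex_hilbert_space"
  assumes f: "summable (\<lambda>n. (norm (f n))\<^sup>2)" and g: "summable (\<lambda>n. (norm (g n))\<^sup>2)"
  shows "summable (\<lambda>n. cinner (f n) (g n))"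
proof (rule summable_comparison_test'[OF summable_add[OF f g], of 0])
  fix n
  have "norm (cinner (f n) (g n)) \<le> norm (f n) * norm (g n)" by (rule cinner_Cauchy_Schwarz)
  also have "\<dots> \<le> (norm (f n))\<^sup>2 + (norm (g n))\<^sup>2"
    using sum_squares_bound[of "norm (f n)" "norm (g n)"] zero_le_power2[of "norm (f n)"] zero_le_power2[of "norm (g n)"]
    by linarith
  finally show "norm (cinner (f n) (g n)) \<le> (norm (f n))\<^sup>2 + (norm (g n))\<^sup>2" .
qed

lemma square_summable_scale:
  fixes f :: "nat \<Rightarrow> 'h::complex_hilbert_space"
  assumes f: "summable (\<lambda>n. (norm (f n))\<^sup>2)"
  shows "summable (\<lambda>n. (norm (c *\<^sub>C f n))\<^sup>2)" "summable (\<lambda>n. (norm (r *\<^sub>R f n))\<^sup>2)"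
  using summable_mult[OF f, of "(cmod c)\<^sup>2"] summable_mult[OF f, of "r\<^sup>2"]
  by (simp_all add: norm_scaleC power_mult_distrib)

instantiation ell2 :: (complex_hilbert_space) real_normed_vector
begin

lift_definition zero_ell2 :: "'a ell2" is "\<lambda>_. 0" by simp
lift_definition plus_ell2 :: "'a ell2 \<Rightarrow> 'a ell2 \<Rightarrow> 'a ell2" is "\<lambda>f g n. f n + g n"
  by (rule square_summable_add(1))
lift_definition uminus_ell2 :: "'a ell2 \<Rightarrow> 'a ell2" is "\<lambda>f n. - f n" by simp
lift_definition minus_ell2 :: "'a ell2 \<Rightarrow> 'a ell2 \<Rightarrow> 'a ell2" is "\<lambda>f g n. f n - g n"
proof -
  fix f g :: "nat \<Rightarrow> 'a"
  assume "summable (\<lambda>n. (norm (f n))\<^sup>2)" "summable (\<lambda>n. (norm (g n))\<^sup>2)"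
  then show "summable (\<lambda>n. (norm (f n - g n))\<^sup>2)"
    using square_summable_add(1)[of f "\<lambda>n. - g n"] by simp
qed
lift_definition scaleR_ell2 :: "real \<Rightarrow> 'a ell2 \<Rightarrow> 'a ell2" is "\<lambda>r f n. r *\<^sub>R f n"
  by (rule square_summable_scale)
lift_definition norm_ell2 :: "'a ell2 \<Rightarrow> real" is "\<lambda>f. sqrt (\<Sum>n. (norm (f n))\<^sup>2)" .
definition dist_ell2 :: "'a ell2 \<Rightarrow> 'a ell2 \<Rightarrow> real" where "dist_ell2 f g = norm (f - g)"
definition sgn_ell2 :: "'a ell2 \<Rightarrow> 'a ell2" where "sgn_ell2 f = scaleR (inverse (norm f)) f"
definition uniformity_ell2 :: "('a ell2 \<times> 'a ell2) filter" where
  "uniformity_ell2 = (INF e\<in>{0<..}. principal {(x, y). dist x y < e})"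
definition open_ell2 :: "'a ell2 set \<Rightarrow> bool" where
  "open_ell2 U \<longleftrightarrow> (\<forall>x\<in>U. eventually (\<lambda>(x', y). x' = x \<longrightarrow> y \<in> U) uniformity)"

lemma norm_coord_le: "norm (coord f n) \<le> norm f"
proof -
  have "(norm (coord f n))\<^sup>2 \<le> (\<Sum>n. (norm (coord f n))\<^sup>2)"
    using sum_le_suminf[OF summable_coord, of "{n}" f] by simp
  then show ?thesis by (simp add: norm_ell2.rep_eq real_le_rsqrt)
qed

instance proof
  fix x y z :: "'a ell2" and r s :: real
  note ext = coord_inject[symmetric] fun_eq_iff
  note reps = zero_ell2.rep_eq plus_ell2.rep_eq uminus_ell2.rep_eq minus_ell2.rep_eq scaleR_ell2.rep_eq
    norm_ell2.rep_eq
  show "x + y + z = x + (y + z)" "x + y = y + x" "0 + x = x" "- x + x = 0" "x - y = x + - y"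
    "r *\<^sub>R (x + y) = r *\<^sub>R x + r *\<^sub>R y" "(r + s) *\<^sub>R x = r *\<^sub>R x + s *\<^sub>R x"
    "r *\<^sub>R s *\<^sub>R x = (r * s) *\<^sub>R x" "1 *\<^sub>R x = x"
    by (simp_all add: ext reps algebra_simps)
  show "dist x y = norm (x - y)" by (simp add: dist_ell2_def)
  show "sgn x = inverse (norm x) *\<^sub>R x" by (simp add: sgn_ell2_def)
  show "(uniformity :: ('a ell2 \<times> 'a ell2) filter) = (INF e\<in>{0<..}. principal {(x, y). dist x y < e})"
    by (simp add: uniformity_ell2_def)
  show "open U \<longleftrightarrow> (\<forall>x\<in>U. eventually (\<lambda>(x', y). x' = x \<longrightarrow> y \<in> U) uniformity)" for U :: "'a ell2 set"
    by (simp add: open_ell2_def)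
  show "norm x = 0 \<longleftrightarrow> x = 0"
  proof
    assume "norm x = 0"
    then have "coord x n = 0" for n using norm_coord_le[of x n] by simp
    then show "x = 0" by (simp add: ext reps)
  qed (simp add: reps)
  show "norm (x + y) \<le> norm x + norm y"
    unfolding reps by (rule square_summable_add(2)[OF summable_coord summable_coord])
  show "norm (r *\<^sub>R x) = \<bar>r\<bar> * norm x"
    by (simp add: reps power_mult_distrib suminf_mult[OF summable_coord] real_sqrt_mult)
qed

end

instance ell2 :: (complex_hilbert_space) banach
proof
  fix X :: "nat \<Rightarrow> 'a ell2" assume X: "Cauchy X"
  note reps = minus_ell2.rep_eq norm_ell2.rep_eq plus_ell2.rep_eq
  have d: "dist a b = norm (a - b)" for a b :: "'a ell2" by (simp add: dist_ell2_def)
  have "Cauchy (\<lambda>m. coord (X m) n)" for n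
  proof (rule metric_CauchyI)
    fix e :: real assume "e > 0"
    then obtain M where "\<forall>m\<ge>M. \<forall>k\<ge>M. dist (X m) (X k) < e" using metric_CauchyD[OF X] by blast
    moreover have "dist (coord (X m) n) (coord (X k) n) \<le> dist (X m) (X k)" for m k
      using norm_coord_le[of "X m - X k" n] by (simp add: d dist_norm reps)
    ultimately show "\<exists>M. \<forall>m\<ge>M. \<forall>k\<ge>M. dist (coord (X m) n) (coord (X k) n) < e"
      using order.strict_trans1 by blast
  qed
  then have "\<exists>L. (\<lambda>m. coord (X m) n) \<longlonglongrightarrow> L" for n
    by (simp add: convergent_eq_Cauchy[symmetric] convergent_def)
  then obtain L where L: "\<And>n. (\<lambda>m. coord (X m) n) \<longlonglongrightarrow> L n" by metis
  have bnd: "L2_set (\<lambda>n. norm (coord (X m) n - L n)) {..<k} \<le> e"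
    if e: "\<forall>m\<ge>M. \<forall>j\<ge>M. dist (X m) (X j) < e" and m: "m \<ge> M" for M e m k
  proof (rule LIMSEQ_le_const2)
    show "(\<lambda>j. L2_set (\<lambda>n. norm (coord (X m) n - coord (X j) n)) {..<k})
      \<longlonglongrightarrow> L2_set (\<lambda>n. norm (coord (X m) n - L n)) {..<k}"
      unfolding L2_set_def by (intro tendsto_intros L)
    have "L2_set (\<lambda>n. norm (coord (X m) n - coord (X j) n)) {..<k} \<le> e" if "j \<ge> M" for j
      using L2_set_le_sqrt_suminf[OF summable_coord, of "X m - X j" k] e m that
      by (force simp: d reps less_imp_le)
    then show "\<exists>N. \<forall>j\<ge>N. L2_set (\<lambda>n. norm (coord (X m) n - coord (X j) n)) {..<k} \<le> e" by blast
  qed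
  obtain M1 where M1: "\<forall>m\<ge>M1. \<forall>j\<ge>M1. dist (X m) (X j) < 1" using metric_CauchyD[OF X, of 1] by auto
  have "summable (\<lambda>n. (norm (coord (X M1) n - L n))\<^sup>2)"
    by (rule square_summable_bound(1)[OF bnd[OF M1]]) simp
  then have "summable (\<lambda>n. (norm (L n - coord (X M1) n))\<^sup>2)" by (simp add: norm_minus_commute)
  from square_summable_add(1)[OF this summable_coord[of "X M1"]]
  have sL: "summable (\<lambda>n. (norm (L n))\<^sup>2)" by simp
  have cL: "coord (Abs_ell2 L) = L" by (rule Abs_ell2_inverse) (simp add: sL)
  have "X \<longlonglongrightarrow> Abs_ell2 L"
  proof (rule metric_LIMSEQ_I)
    fix e :: real assume "e > 0"
    then obtain M where M: "\<forall>m\<ge>M. \<forall>j\<ge>M. dist (X m) (X j) < e/2" using metric_CauchyD[OF X, of "e/2"] by auto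
    have "dist (X m) (Abs_ell2 L) < e" if "m \<ge> M" for m
      using square_summable_bound(2)[OF bnd[OF M that]] \<open>e > 0\<close> by (simp add: d reps cL)
    then show "\<exists>no. \<forall>n\<ge>no. dist (X n) (Abs_ell2 L) < e" by blast
  qed
  then show "convergent X" by (auto simp: convergent_def)
qed

instantiation ell2 :: (complex_hilbert_space) complex_hilbert_space
begin

lift_definition scaleC_ell2 :: "complex \<Rightarrow> 'a ell2 \<Rightarrow> 'a ell2" is "\<lambda>r f n. r *\<^sub>C f n"
  by (rule square_summable_scale)
lift_definition cinner_ell2 :: "'a ell2 \<Rightarrow> 'a ell2 \<Rightarrow> complex" is "\<lambda>f g. \<Sum>n. cinner (f n) (g n)" .

instance proof
  fix x y z :: "'a ell2" and r :: real and c d :: complex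
  note reps = scaleC_ell2.rep_eq cinner_ell2.rep_eq plus_ell2.rep_eq scaleR_ell2.rep_eq norm_ell2.rep_eq
  show "c *\<^sub>C (x + y) = c *\<^sub>C x + c *\<^sub>C y" "(c + d) *\<^sub>C x = c *\<^sub>C x + d *\<^sub>C x"
    "c *\<^sub>C d *\<^sub>C x = (c * d) *\<^sub>C x" "r *\<^sub>R x = complex_of_real r *\<^sub>C x"
    by (simp_all add: coord_inject[symmetric] fun_eq_iff reps scaleC_add_right scaleC_add_left
        scaleC_scaleC scaleR_eq_scaleC)
  show "cinner x y = cnj (cinner y x)"
    unfolding reps
    by (subst bounded_linear.suminf[OF bounded_linear_cnj]) (auto intro!: suminf_cong summable_cinner summable_coord simp: cinner_commute[symmetric])
  show "cinner x (y + z) = cinner x y + cinner x z"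
    by (simp add: reps cinner_add_right suminf_add summable_cinner summable_coord)
  show "cinner x (c *\<^sub>C y) = c * cinner x y"
    by (simp add: reps cinner_scaleC_right suminf_mult summable_cinner summable_coord)
  have "(\<Sum>n. complex_of_real ((norm (coord x n))\<^sup>2)) = complex_of_real (\<Sum>n. (norm (coord x n))\<^sup>2)"
    by (rule suminf_of_real[symmetric]) (rule summable_coord)
  then show "cinner x x = complex_of_real ((norm x)\<^sup>2)"
    by (simp add: reps cinner_self suminf_nonneg summable_coord)
qed

end

lemmas coord_simps [simp] = zero_ell2.rep_eq plus_ell2.rep_eq minus_ell2.rep_eq scaleR_ell2.rep_eq
  scaleC_ell2.rep_eq uminus_ell2.rep_eq

lift_definition ell2_single :: "nat \<Rightarrow> 'h::complex_hilbert_space \<Rightarrow> 'h ell2" is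
  "\<lambda>k x n. if n = k then x else 0"
proof -
  fix k and x :: 'h
  show "summable (\<lambda>n. (norm (if n = k then x else 0))\<^sup>2)"
    by (rule summable_finite[of "{k}"]) auto
qed

definition ell2_diag :: "('h::complex_hilbert_space \<Rightarrow>\<^sub>L 'h) \<Rightarrow> 'h ell2 \<Rightarrow> 'h ell2" where
  "ell2_diag T x = Abs_ell2 (\<lambda>n. T (coord x n))"

lemma coord_ell2_diag [simp]: "coord (ell2_diag T x) n = T (coord x n)"
proof -
  have "summable (\<lambda>n. (norm (T (coord x n)))\<^sup>2)"
  proof (rule summable_comparison_test'[OF summable_mult[OF summable_coord, of "(norm T)\<^sup>2" x], of 0])
    fix n
    show "norm ((norm (T (coord x n)))\<^sup>2) \<le> (norm T)\<^sup>2 * (norm (coord x n))\<^sup>2"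
      using power_mono[OF norm_blinfun[of T "coord x n"], of 2] by (simp add: power_mult_distrib)
  qed
  then show ?thesis by (simp add: ell2_diag_def Abs_ell2_inverse)
qed

lemma ell2_eqI: "(\<And>n. coord x n = coord y n) \<Longrightarrow> x = y"
  by (simp add: coord_inject[symmetric] fun_eq_iff)

lemma norm_ell2_sq: "(norm x)\<^sup>2 = (\<Sum>n. (norm (coord x n))\<^sup>2)"
  by (simp add: norm_ell2.rep_eq suminf_nonneg summable_coord)

lemma bounded_linear_coord: "bounded_linear (\<lambda>x. coord x n)"
  by (rule bounded_linear_intro[of _ 1]) (use norm_coord_le in auto)

lemma norm_ell2_single [simp]: "norm (ell2_single k x) = norm x"
proof -
  have "(\<Sum>n. (norm (coord (ell2_single k x) n))\<^sup>2) = (\<Sum>n\<in>{k}. (norm (coord (ell2_single k x) n))\<^sup>2)"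
    by (rule suminf_finite) (auto simp: ell2_single.rep_eq)
  then show ?thesis by (simp add: norm_ell2.rep_eq ell2_single.rep_eq)
qed

lemma bounded_linear_ell2_single: "bounded_linear (ell2_single k)"
  by (rule bounded_linear_intro[of _ 1]) (auto intro!: ell2_eqI simp: ell2_single.rep_eq)

lemma coord_sum [simp]: "coord (\<Sum>i\<in>F. f i) n = (\<Sum>i\<in>F. coord (f i) n)"
  by (induction F rule: infinite_finite_induct) auto

lemma ell2_single_sums: "(\<lambda>k. ell2_single k (coord x k)) sums x"
proof -
  have "(\<lambda>N. norm (x - (\<Sum>k<N. ell2_single k (coord x k)))) \<longlonglongrightarrow> 0"
  proof -
    have "norm (x - (\<Sum>k<N. ell2_single k (coord x k))) = sqrt (\<Sum>n. (norm (coord x (n + N)))\<^sup>2)" for N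
    proof -
      have c: "coord (x - (\<Sum>k<N. ell2_single k (coord x k))) n = (if n < N then 0 else coord x n)" for n
        by (simp add: ell2_single.rep_eq sum.delta)
      have "(\<Sum>n. (norm (coord (x - (\<Sum>k<N. ell2_single k (coord x k))) n))\<^sup>2)
        = (\<Sum>n. (norm (coord (x - (\<Sum>k<N. ell2_single k (coord x k))) (n + N)))\<^sup>2)"
        by (subst suminf_split_initial_segment[OF summable_coord, of _ N]) (simp only: c, simp)
      then show ?thesis unfolding norm_ell2.rep_eq c by simp
    qed
    moreover have "(\<lambda>N. sqrt (\<Sum>n. (norm (coord x (n + N)))\<^sup>2)) \<longlonglongrightarrow> sqrt 0"
      by (intro tendsto_intros suminf_exist_split2 summable_coord)
    ultimately show ?thesis by simp
  qed
  then have "(\<lambda>N. - (x - (\<Sum>k<N. ell2_single k (coord x k))) + x) \<longlonglongrightarrow> - 0 + x"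
    by (intro tendsto_intros) (simp add: tendsto_norm_zero_iff)
  then show ?thesis by (simp add: sums_def)
qed

lemma bounded_linear_ell2_diag: "bounded_linear (ell2_diag T)"
proof (rule bounded_linear_intro[of _ "norm T"])
  fix x
  have "(norm (ell2_diag T x))\<^sup>2 \<le> (\<Sum>n. (norm T)\<^sup>2 * (norm (coord x n))\<^sup>2)"
    unfolding norm_ell2_sq
  proof (rule suminf_le[OF _ summable_coord summable_mult[OF summable_coord]])
    show "(norm (coord (ell2_diag T x) n))\<^sup>2 \<le> (norm T)\<^sup>2 * (norm (coord x n))\<^sup>2" for n
      using power_mono[OF norm_blinfun[of T "coord x n"], of 2]
      by (simp add: power_mult_distrib coord_ell2_diag)
  qed
  also have "\<dots> = (norm x * norm T)\<^sup>2"
    by (simp add: suminf_mult[OF summable_coord] norm_ell2_sq power_mult_distrib)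
  finally show "norm (ell2_diag T x) \<le> norm x * norm T" by (rule power2_le_imp_le) simp
qed (auto intro!: ell2_eqI simp: coord_ell2_diag blinfun.bilinear_simps)

lemma cinner_ell2_diag: "T \<in> clinear_ops \<Longrightarrow> cinner (ell2_diag T x) y = cinner x (ell2_diag (adj T) y)"
  by (simp add: cinner_ell2.rep_eq coord_ell2_diag cinner_adj_right)

section \<open>Von Neumann algebras\<close>

lemma closedin_sot_sequentially:
  assumes R: "closedin strong_operator_topology R" and T: "\<And>n. T n \<in> R"
    and lim: "\<And>x. (\<lambda>n. blinfun_apply (T n) x) \<longlonglongrightarrow> blinfun_apply S x"
  shows "S \<in> R"
proof (rule ccontr)
  assume "S \<notin> R"
  have "openin strong_operator_topology (UNIV - R)"
    using R unfolding closedin_def strong_operator_topology_topspace by simp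
  then obtain U where U: "open U" "UNIV - R = blinfun_apply -` U"
    unfolding strong_operator_topology_def openin_pullback_topology by auto
  have "(\<lambda>n. blinfun_apply (T n)) \<longlonglongrightarrow> blinfun_apply S"
    unfolding limitin_canonical_iff[symmetric] euclidean_product_topology[symmetric]
    by (simp add: limitin_componentwise lim)
  then have "eventually (\<lambda>n. blinfun_apply (T n) \<in> U) sequentially"
    using U \<open>S \<notin> R\<close> by (auto intro!: topological_tendstoD)
  then show False using U T by (auto simp: eventually_sequentially)
qed

lemma blinfun_eq_iff: "S = T \<longleftrightarrow> (\<forall>x. blinfun_apply S x = blinfun_apply T x)"
  by (auto intro: blinfun_eqI)

lemma blinfun_compose_assoc: "(S o\<^sub>L T) o\<^sub>L U = S o\<^sub>L (T o\<^sub>L U)"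
  by (rule blinfun_eqI) simp

lemma closedin_sot_eq:
  fixes A :: "'h::complex_hilbert_space \<Rightarrow> 'h"
  assumes A: "bounded_linear A"
  shows "closedin strong_operator_topology {T :: 'h \<Rightarrow>\<^sub>L 'h. T x = A (T y)}"
proof -
  have "continuous_map euclidean euclidean A"
    using bounded_linear.continuous_on[OF A continuous_on_id] by simp
  then have "continuous_map strong_operator_topology euclidean (A \<circ> (\<lambda>T :: 'h \<Rightarrow>\<^sub>L 'h. T y))"
    by (rule continuous_map_compose[OF strong_operator_topology_continuous_evaluation])
  then have "closedin strong_operator_topology
      {T \<in> topspace strong_operator_topology. T x = (A \<circ> (\<lambda>T :: 'h \<Rightarrow>\<^sub>L 'h. T y)) T}"
    by (intro closedin_continuous_maps_eq[where Y = euclidean] strong_operator_topology_continuous_evaluation)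
      (auto simp: o_def)
  then show ?thesis by (simp add: strong_operator_topology_topspace)
qed

definition commutant :: "('h::complex_hilbert_space \<Rightarrow>\<^sub>L 'h) set \<Rightarrow> ('h \<Rightarrow>\<^sub>L 'h) set" where
  "commutant S = {T \<in> clinear_ops. \<forall>X\<in>S. T o\<^sub>L X = X o\<^sub>L T}"

lemma adj_commute:
  assumes "S \<in> clinear_ops" "T \<in> clinear_ops" "S o\<^sub>L T = T o\<^sub>L S"
  shows "adj S o\<^sub>L adj T = adj T o\<^sub>L adj S"
  using assms by (metis adj_compose)

lemma von_neumann_algebra_commutant:
  fixes S :: "('h::complex_hilbert_space \<Rightarrow>\<^sub>L 'h) set"
  assumes S: "S \<subseteq> clinear_ops" "\<And>X. X \<in> S \<Longrightarrow> adj X \<in> S"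
  shows "von_neumann_algebra (commutant S)"
  unfolding von_neumann_algebra_def
proof
  show "unital_star_subalgebra (commutant S)"
    unfolding unital_star_subalgebra_def
  proof (intro conjI ballI)
    show "commutant S \<subseteq> clinear_ops" by (auto simp: commutant_def)
    show "range scalar_op \<subseteq> commutant S"
      using S by (auto simp: commutant_def clinear_ops_intros subset_iff clinear_opsD intro!: blinfun_eqI)
    fix T assume T: "T \<in> commutant S"
    have TX: "T o\<^sub>L X = X o\<^sub>L T" if "X \<in> S" for X using T that by (simp add: commutant_def)
    have Tc: "T \<in> clinear_ops" using T by (simp add: commutant_def)
    have "adj T o\<^sub>L X = X o\<^sub>L adj T" if X: "X \<in> S" for X
    proof -
      have "adj X \<in> S" "X \<in> clinear_ops" "adj X \<in> clinear_ops" using S X by auto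
      then show ?thesis using adj_commute[OF Tc _ TX[of "adj X"]] adj_adj[of X] by simp
    qed
    then show "adj T \<in> commutant S" using Tc by (simp add: commutant_def adj_clinear)
    fix U assume U: "U \<in> commutant S"
    have UX: "U o\<^sub>L X = X o\<^sub>L U" if "X \<in> S" for X using U that by (simp add: commutant_def)
    have Uc: "U \<in> clinear_ops" using U by (simp add: commutant_def)
    have "(T + U) o\<^sub>L X = X o\<^sub>L (T + U)" if "X \<in> S" for X
      unfolding bounded_bilinear.add_left[OF bounded_bilinear_blinfun_compose]
        bounded_bilinear.add_right[OF bounded_bilinear_blinfun_compose] TX[OF that] UX[OF that] ..
    then show "T + U \<in> commutant S" using Tc Uc by (simp add: commutant_def clinear_ops_intros)
    have "(T o\<^sub>L U) o\<^sub>L X = X o\<^sub>L (T o\<^sub>L U)" if "X \<in> S" for X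
      by (metis TX[OF that] UX[OF that] blinfun_compose_assoc)
    then show "T o\<^sub>L U \<in> commutant S" using Tc Uc by (simp add: commutant_def clinear_ops_intros)
  qed
  have "commutant S = (\<Inter>c. \<Inter>x. {T :: 'h \<Rightarrow>\<^sub>L 'h. T (c *\<^sub>C x) = c *\<^sub>C T x}) \<inter>
    (\<Inter>X \<in> insert id_blinfun S. \<Inter>x. {T :: 'h \<Rightarrow>\<^sub>L 'h. T (blinfun_apply X x) = blinfun_apply X (T x)})"
    by (auto simp: commutant_def clinear_ops_def blinfun_eq_iff)
  moreover have "closedin strong_operator_topology \<dots>"
    by (intro closedin_Int closedin_INT closedin_sot_eq bounded_linear_scaleC blinfun.bounded_linear_right) auto
  ultimately show "closedin strong_operator_topology (commutant S)" by simp
qed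

text \<open>Amplified density theorem.  The projection onto the closure of the orbit of a vector of the
  amplified Hilbert space commutes with the amplified generators; so its matrix entries commute
  with the generators, hence with the von Neumann algebra that they generate.\<close>

theorem amplified_density:
  fixes G A :: "('h::complex_hilbert_space \<Rightarrow>\<^sub>L 'h) set" and \<zeta> :: "'h ell2"
  assumes G: "G \<subseteq> clinear_ops" "\<And>g. g \<in> G \<Longrightarrow> adj g \<in> G"
    and A0: "id_blinfun \<in> A" "\<And>S T. S \<in> A \<Longrightarrow> T \<in> A \<Longrightarrow> S + T \<in> A"
      "\<And>c T. T \<in> A \<Longrightarrow> scalar_op c o\<^sub>L T \<in> A"
    and A1: "\<And>g T. g \<in> G \<Longrightarrow> T \<in> A \<Longrightarrow> g o\<^sub>L T \<in> A"
    and T: "T \<in> von_neumann_algebra hull G" and e: "e > 0"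
  shows "\<exists>S\<in>A. norm (ell2_diag (T - S) \<zeta>) < e"
proof -
  define K0 where "K0 = (\<lambda>S. ell2_diag S \<zeta>) ` A"
  define K where "K = closure K0"
  have "csubspace K0"
    unfolding csubspace_def
  proof (intro conjI ballI allI)
    have "scalar_op 0 o\<^sub>L id_blinfun \<in> A" by (intro A0)
    moreover have "ell2_diag (scalar_op 0 o\<^sub>L id_blinfun) \<zeta> = 0" by (rule ell2_eqI) simp
    ultimately show "0 \<in> K0" by (force simp: K0_def)
    fix x assume "x \<in> K0"
    then obtain S where S: "S \<in> A" "x = ell2_diag S \<zeta>" by (auto simp: K0_def)
    { fix y assume "y \<in> K0"
      then obtain U where U: "U \<in> A" "y = ell2_diag U \<zeta>" by (auto simp: K0_def)
      have "x + y = ell2_diag (S + U) \<zeta>" by (rule ell2_eqI) (simp add: S U blinfun.add_left)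
      then show "x + y \<in> K0" using A0(2) S U by (auto simp: K0_def) }
    fix c
    have "c *\<^sub>C x = ell2_diag (scalar_op c o\<^sub>L S) \<zeta>" by (rule ell2_eqI) (simp add: S)
    then show "c *\<^sub>C x \<in> K0" using A0(3) S by (auto simp: K0_def)
  qed
  then have "csubspace K" "closed K" unfolding K_def by (auto intro: csubspace_closure)
  then obtain P :: "'h ell2 \<Rightarrow>\<^sub>L 'h ell2" where P: "\<And>x. P x \<in> K" "\<And>x z. z \<in> K \<Longrightarrow> cinner (x - P x) z = 0"
    "\<And>x. x \<in> K \<Longrightarrow> P x = x" "\<And>c x. P (c *\<^sub>C x) = c *\<^sub>C P x"
    and Pu: "\<And>x y. y \<in> K \<Longrightarrow> (\<And>z. z \<in> K \<Longrightarrow> cinner (x - y) z = 0) \<Longrightarrow> P x = y"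
    by (rule orthogonal_projection) blast
  have Kinv: "ell2_diag g x \<in> K" if "g \<in> G" "x \<in> K" for g x
  proof -
    have "ell2_diag g y \<in> K0" if y: "y \<in> K0" for y
    proof -
      obtain S where S: "S \<in> A" "y = ell2_diag S \<zeta>" using y by (auto simp: K0_def)
      have "ell2_diag g y = ell2_diag (g o\<^sub>L S) \<zeta>" by (rule ell2_eqI) (simp add: S)
      then show ?thesis using A1[OF \<open>g \<in> G\<close> S(1)] by (auto simp: K0_def)
    qed
    moreover obtain f where "\<And>n. f n \<in> K0" "f \<longlonglongrightarrow> x"
      using \<open>x \<in> K\<close> by (auto simp: K_def closure_sequential)
    ultimately show ?thesis
      unfolding K_def closure_sequential
      by (intro exI[of _ "\<lambda>n. ell2_diag g (f n)"]) (auto intro: bounded_linear.tendsto[OF bounded_linear_ell2_diag])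
  qed
  have Pg: "P (ell2_diag g x) = ell2_diag g (P x)" if g: "g \<in> G" for g x
  proof (rule Pu)
    show "ell2_diag g (P x) \<in> K" using Kinv P(1) g by blast
    fix z assume z: "z \<in> K"
    have "ell2_diag g x - ell2_diag g (P x) = ell2_diag g (x - P x)"
      by (rule ell2_eqI) (simp add: blinfun.diff_right)
    then show "cinner (ell2_diag g x - ell2_diag g (P x)) z = 0"
      using P(2)[OF Kinv[OF G(2)[OF g] z]] cinner_ell2_diag[of g] G(1) g by auto
  qed
  define C where "C = {X \<in> clinear_ops. \<forall>g\<in>G. X o\<^sub>L g = g o\<^sub>L X}"
  have "von_neumann_algebra (commutant C)"
  proof (rule von_neumann_algebra_commutant)
    show "C \<subseteq> clinear_ops" by (auto simp: C_def)
    fix X assume X: "X \<in> C"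
    have "adj X o\<^sub>L g = g o\<^sub>L adj X" if g: "g \<in> G" for g
    proof -
      have "adj g \<in> G" "g \<in> clinear_ops" "adj g \<in> clinear_ops" using G g by auto
      then show ?thesis using adj_commute[of X "adj g"] adj_adj[of g] X by (simp add: C_def)
    qed
    then show "adj X \<in> C" using X by (auto simp: C_def adj_clinear)
  qed
  moreover have "G \<subseteq> commutant C" using G(1) by (auto simp: commutant_def C_def)
  ultimately have TC: "T \<in> commutant C" using T hull_minimal[of G "commutant C"] by blast
  have comm: "T (coord (P (ell2_single n x)) m) = coord (P (ell2_single n (T x))) m" for m n x
  proof -
    have bl: "bounded_linear (\<lambda>x. coord (P (ell2_single n x)) m)"
      by (intro bounded_linear_compose[OF bounded_linear_coord]
          bounded_linear_compose[OF blinfun.bounded_linear_right] bounded_linear_ell2_single)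
    define X where "X = Blinfun (\<lambda>x. coord (P (ell2_single n x)) m)"
    have X: "X x = coord (P (ell2_single n x)) m" for x
      unfolding X_def bounded_linear_Blinfun_apply[OF bl] ..
    have sC: "ell2_single n (c *\<^sub>C x) = c *\<^sub>C ell2_single n x" for c and x :: 'h
      by (rule ell2_eqI) (simp add: ell2_single.rep_eq)
    have sg: "ell2_single n (g x) = ell2_diag g (ell2_single n x)" for g :: "'h \<Rightarrow>\<^sub>L 'h" and x
      by (rule ell2_eqI) (simp add: ell2_single.rep_eq)
    have "X \<in> C" unfolding C_def clinear_ops_def
      by (auto intro!: blinfun_eqI simp: X sC P sg Pg)
    then have "T o\<^sub>L X = X o\<^sub>L T" using TC by (auto simp: commutant_def)
    then show ?thesis by (metis X blinfun_apply_blinfun_compose)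
  qed
  have \<zeta>K: "\<zeta> \<in> K"
  proof -
    have "\<zeta> = ell2_diag id_blinfun \<zeta>" by (rule ell2_eqI) simp
    then show ?thesis using A0(1) closure_subset by (force simp: K_def K0_def)
  qed
  have "coord (P (ell2_diag T \<zeta>)) m = coord (ell2_diag T \<zeta>) m" for m
  proof -
    have bl: "bounded_linear (\<lambda>x. coord (P x) m)"
      by (intro bounded_linear_compose[OF bounded_linear_coord] blinfun.bounded_linear_right)
    have "(\<lambda>n. coord (P (ell2_single n (T (coord \<zeta> n)))) m) sums coord (P (ell2_diag T \<zeta>)) m"
      using bounded_linear.sums[OF bl ell2_single_sums[of "ell2_diag T \<zeta>"]] by simp
    moreover have "(\<lambda>n. T (coord (P (ell2_single n (coord \<zeta> n))) m)) sums T (coord (P \<zeta>) m)"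
      by (rule bounded_linear.sums[OF blinfun.bounded_linear_right bounded_linear.sums[OF bl ell2_single_sums]])
    ultimately have "coord (P (ell2_diag T \<zeta>)) m = T (coord (P \<zeta>) m)"
      by (simp add: comm sums_unique2)
    then show ?thesis by (simp add: P(3)[OF \<zeta>K])
  qed
  then have "ell2_diag T \<zeta> \<in> K" using P(1)[of "ell2_diag T \<zeta>"] ell2_eqI by metis
  then obtain y where y: "y \<in> K0" "dist y (ell2_diag T \<zeta>) < e"
    using e by (auto simp: K_def closure_approachable)
  then obtain S where S: "S \<in> A" "y = ell2_diag S \<zeta>" by (auto simp: K0_def)
  have "ell2_diag (T - S) \<zeta> = ell2_diag T \<zeta> - y" by (rule ell2_eqI) (simp add: S blinfun.diff_left)
  then have "norm (ell2_diag (T - S) \<zeta>) < e" using y(2) by (simp add: dist_norm norm_minus_commute)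
  then show ?thesis using S(1) by blast
qed

lemmas compose_bilinear =
  bounded_bilinear.add_left[OF bounded_bilinear_blinfun_compose]
  bounded_bilinear.add_right[OF bounded_bilinear_blinfun_compose]
  bounded_bilinear.diff_left[OF bounded_bilinear_blinfun_compose]
  bounded_bilinear.diff_right[OF bounded_bilinear_blinfun_compose]
  bounded_bilinear.minus_left[OF bounded_bilinear_blinfun_compose]
  bounded_bilinear.minus_right[OF bounded_bilinear_blinfun_compose]
  bounded_bilinear.scaleR_left[OF bounded_bilinear_blinfun_compose]
  bounded_bilinear.scaleR_right[OF bounded_bilinear_blinfun_compose]
  bounded_bilinear.zero_left[OF bounded_bilinear_blinfun_compose]
  bounded_bilinear.zero_right[OF bounded_bilinear_blinfun_compose]

lemmas tendsto_compose_op = bounded_bilinear.tendsto[OF bounded_bilinear_blinfun_compose]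

lemma compose_id [simp]: "id_blinfun o\<^sub>L T = T" "T o\<^sub>L id_blinfun = T"
  by (auto intro: blinfun_eqI)

section \<open>Square roots of positive operators\<close>

locale vN_algebra =
  fixes R :: "('h::complex_hilbert_space \<Rightarrow>\<^sub>L 'h) set"
  assumes vN: "von_neumann_algebra R"
begin

lemma clinear: "T \<in> R \<Longrightarrow> T \<in> clinear_ops"
  using vN by (auto simp: von_neumann_algebra_def unital_star_subalgebra_def)

lemma mem_compose [intro]: "S \<in> R \<Longrightarrow> T \<in> R \<Longrightarrow> S o\<^sub>L T \<in> R"
  and mem_add [intro]: "S \<in> R \<Longrightarrow> T \<in> R \<Longrightarrow> S + T \<in> R"
  and mem_adj [intro]: "T \<in> R \<Longrightarrow> adj T \<in> R"
  and mem_scalar [intro, simp]: "scalar_op c \<in> R"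
  using vN by (auto simp: von_neumann_algebra_def unital_star_subalgebra_def)

lemma mem_scaleR [intro]: "T \<in> R \<Longrightarrow> r *\<^sub>R T \<in> R"
proof -
  assume "T \<in> R"
  then have "scalar_op (of_real r) o\<^sub>L T \<in> R" by blast
  moreover have "scalar_op (of_real r) o\<^sub>L T = r *\<^sub>R T"
    by (rule blinfun_eqI) (simp add: scaleR_eq_scaleC blinfun.scaleR_left)
  ultimately show ?thesis by simp
qed

lemma mem_minus [intro]: "T \<in> R \<Longrightarrow> - T \<in> R"
  using mem_scaleR[of T "-1"] by simp

lemma mem_diff [intro]: "S \<in> R \<Longrightarrow> T \<in> R \<Longrightarrow> S - T \<in> R"
  using mem_add[of S "- T"] by auto

lemma mem_id [intro, simp]: "id_blinfun \<in> R"
proof -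
  have "scalar_op 1 = (id_blinfun :: 'h \<Rightarrow>\<^sub>L 'h)" by (rule blinfun_eqI) simp
  then show ?thesis by (metis mem_scalar)
qed

lemma mem_zero [intro, simp]: "0 \<in> R"
  using mem_scaleR[OF mem_id, of 0] by simp

lemma mem_sum [intro]: "(\<And>i. i \<in> F \<Longrightarrow> f i \<in> R) \<Longrightarrow> (\<Sum>i\<in>F. f i) \<in> R"
  by (induction F rule: infinite_finite_induct) auto

lemma mem_limit:
  assumes "\<And>n. T n \<in> R" "\<And>x. (\<lambda>n. blinfun_apply (T n) x) \<longlonglongrightarrow> blinfun_apply S x"
  shows "S \<in> R"
  using closedin_sot_sequentially[of R T S] assms vN by (auto simp: von_neumann_algebra_def)

lemma mem_norm_limit:
  assumes "\<And>n. T n \<in> R" "T \<longlonglongrightarrow> S" shows "S \<in> R"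
  using assms by (intro mem_limit[of T S]) (auto intro: blinfun.tendsto)

text \<open>The iteration \<open>Y \<mapsto> (A + Y\<^sup>2)/2\<close> with \<open>A = 1 - X\<close> converges to \<open>1 - \<surd>X\<close>; its increments are
  dominated by those of the scalar iteration started with \<open>A = 1\<close>.\<close>

lemma square_root:
  assumes X: "X \<in> R" "adj X = X" "norm (id_blinfun - X) \<le> 1"
  obtains Q where "Q \<in> R" "adj Q = Q" "norm (id_blinfun - Q) \<le> 1" "Q o\<^sub>L Q = X"
    "\<And>Z. Z o\<^sub>L X = X o\<^sub>L Z \<Longrightarrow> Z o\<^sub>L Q = Q o\<^sub>L Z"
proof -
  define A where "A = id_blinfun - X"
  define Y :: "nat \<Rightarrow> 'h \<Rightarrow>\<^sub>L 'h" where "Y = rec_nat 0 (\<lambda>_ Z. (1/2) *\<^sub>R (A + (Z o\<^sub>L Z)))"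
  define y :: "nat \<Rightarrow> real" where "y = rec_nat 0 (\<lambda>_ z. (1 + z * z) / 2)"
  have Y0: "Y 0 = 0" and YS: "\<And>n. Y (Suc n) = (1/2) *\<^sub>R (A + (Y n o\<^sub>L Y n))" by (simp_all add: Y_def)
  have y0: "y 0 = 0" and yS: "\<And>n. y (Suc n) = (1 + y n * y n) / 2" by (simp_all add: y_def)
  have y01: "0 \<le> y n \<and> y n \<le> 1" for n
  proof (induction n)
    case (Suc n)
    then have "y n * y n \<le> 1 * 1" by (intro mult_mono) auto
    then show ?case using Suc by (simp add: yS)
  qed (simp add: y0)
  have AR: "A \<in> R" "adj A = A"
    using X by (auto simp: A_def adj_diff clinear)
  have YR: "Y n \<in> R \<and> adj (Y n) = Y n" for n
    by (induction n) (use AR in \<open>auto simp: Y0 YS adj_scaleR adj_add adj_compose clinear clinear_ops_intros\<close>)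
  have comm: "Z o\<^sub>L Y n = Y n o\<^sub>L Z" if "Z o\<^sub>L A = A o\<^sub>L Z" for Z n
  proof (induction n)
    case (Suc n)
    have "Z o\<^sub>L (Y n o\<^sub>L Y n) = (Y n o\<^sub>L Y n) o\<^sub>L Z" by (metis Suc blinfun_compose_assoc)
    then show ?case using that by (simp add: YS compose_bilinear)
  qed (simp add: Y0)
  have YY: "Y m o\<^sub>L Y n = Y n o\<^sub>L Y m" for m n
    by (rule comm) (rule comm[symmetric], simp)
  have nY: "norm (Y n) \<le> y n" for n
  proof (induction n)
    case (Suc n)
    have "norm (Y (Suc n)) \<le> (norm A + norm (Y n) * norm (Y n)) / 2"
      unfolding YS using norm_triangle_ineq[of A "Y n o\<^sub>L Y n"] norm_blinfun_compose[of "Y n" "Y n"] by simp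
    also have "\<dots> \<le> (1 + y n * y n) / 2"
      using X(3) Suc y01[of n] by (intro divide_right_mono add_mono mult_mono) (auto simp: A_def)
    finally show ?case by (simp add: yS)
  qed (simp add: Y0 y0)
  have step: "norm (Y (Suc n) - Y n) \<le> y (Suc n) - y n" for n
  proof (induction n)
    case 0 then show ?case using nY[of 1] by (simp add: Y0 y0)
  next
    case (Suc n)
    have "Y (Suc (Suc n)) - Y (Suc n) = (1/2) *\<^sub>R ((Y (Suc n) + Y n) o\<^sub>L (Y (Suc n) - Y n))"
      unfolding YS[of "Suc n"] by (subst (3) YS) (simp add: compose_bilinear YY[of "Suc n" n] algebra_simps)
    then have "norm (Y (Suc (Suc n)) - Y (Suc n)) \<le> (norm (Y (Suc n) + Y n) * norm (Y (Suc n) - Y n)) / 2"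
      using norm_blinfun_compose[of "Y (Suc n) + Y n" "Y (Suc n) - Y n"] by simp
    also have "\<dots> \<le> ((y (Suc n) + y n) * (y (Suc n) - y n)) / 2"
      using Suc y01 nY norm_triangle_ineq[of "Y (Suc n)" "Y n"] add_mono[OF nY[of "Suc n"] nY[of n]]
      by (intro divide_right_mono mult_mono) (auto intro: order_trans add_nonneg_nonneg)
    also have "\<dots> = y (Suc (Suc n)) - y (Suc n)"
      by (simp add: yS[of "Suc n"]) (simp add: yS[of n] field_simps)
    finally show ?case .
  qed
  have diff: "norm (Y m - Y n) \<le> y m - y n" if "n \<le> m" for m n
    using that
  proof (induction rule: dec_induct)
    case (step k)
    show ?case using norm_triangle_ineq[of "Y (Suc k) - Y k" "Y k - Y n"] step.IH \<open>\<And>n. norm (Y (Suc n) - Y n) \<le> y (Suc n) - y n\<close>[of k]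
      by simp
  qed simp
  have "incseq y" by (rule incseq_SucI) (use step norm_ge_zero in \<open>smt (verit)\<close>)
  then have "convergent y" using y01 incseq_convergent[of y 1] by (metis convergentI)
  then have Cy: "Cauchy y" by (simp add: Cauchy_convergent_iff)
  have "Cauchy Y"
  proof (rule metric_CauchyI)
    fix e :: real assume "e > 0"
    then obtain M where M: "\<forall>m\<ge>M. \<forall>n\<ge>M. dist (y m) (y n) < e" using metric_CauchyD[OF Cy] by blast
    have "dist (Y m) (Y n) \<le> dist (y m) (y n)" for m n
    proof (cases "n \<le> m")
      case True then show ?thesis using diff[of n m] by (simp add: dist_norm)
    next
      case False then show ?thesis using diff[of m n] by (simp add: dist_norm norm_minus_commute)
    qed
    then show "\<exists>M. \<forall>m\<ge>M. \<forall>n\<ge>M. dist (Y m) (Y n) < e" using M order.strict_trans1 by blast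
  qed
  then obtain L where L: "Y \<longlonglongrightarrow> L" by (auto simp: Cauchy_convergent_iff convergent_def)
  have "(\<lambda>n. (1/2) *\<^sub>R (A + (Y n o\<^sub>L Y n))) \<longlonglongrightarrow> (1/2) *\<^sub>R (A + (L o\<^sub>L L))"
    by (intro tendsto_intros tendsto_compose_op L)
  moreover have "(\<lambda>n. Y (Suc n)) \<longlonglongrightarrow> L" using L by (rule LIMSEQ_Suc)
  ultimately have fixp: "L = (1/2) *\<^sub>R (A + (L o\<^sub>L L))" by (simp add: YS LIMSEQ_unique)
  have LR: "L \<in> R" by (rule mem_norm_limit[OF _ L]) (use YR in blast)
  have La: "adj L = L"
  proof (rule adj_eqI)
    fix u v
    have "(\<lambda>n. cinner (Y n u) v) \<longlonglongrightarrow> cinner (L u) v"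
      by (intro tendsto_cinner blinfun.tendsto L tendsto_const)
    moreover have "(\<lambda>n. cinner u (Y n v)) \<longlonglongrightarrow> cinner u (L v)"
      by (intro tendsto_cinner blinfun.tendsto L tendsto_const)
    moreover have "cinner (Y n u) v = cinner u (Y n v)" for n
      using cinner_adj_left[of "Y n" u v] YR clinear by simp
    ultimately show "cinner (L u) v = cinner u (L v)" using LIMSEQ_unique by auto
  qed
  show ?thesis
  proof (rule that[of "id_blinfun - L"])
    show "id_blinfun - L \<in> R" using LR by auto
    show "adj (id_blinfun - L) = id_blinfun - L" using LR La by (simp add: adj_diff clinear)
    have "norm L \<le> 1"
      by (rule LIMSEQ_le_const2[OF tendsto_norm[OF L]]) (use nY y01 order_trans in blast)
    then show "norm (id_blinfun - (id_blinfun - L)) \<le> 1" by simp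
    have "2 *\<^sub>R L = A + (L o\<^sub>L L)" by (subst fixp) simp
    then show "(id_blinfun - L) o\<^sub>L (id_blinfun - L) = X"
      by (simp add: compose_bilinear A_def scaleR_2 algebra_simps)
    fix Z assume "Z o\<^sub>L X = X o\<^sub>L Z"
    then have "Z o\<^sub>L A = A o\<^sub>L Z" by (simp add: A_def compose_bilinear)
    then have ZY: "(\<lambda>n. Z o\<^sub>L Y n) = (\<lambda>n. Y n o\<^sub>L Z)" using comm by blast
    have "(\<lambda>n. Z o\<^sub>L Y n) \<longlonglongrightarrow> (Z o\<^sub>L L)" "(\<lambda>n. Y n o\<^sub>L Z) \<longlonglongrightarrow> (L o\<^sub>L Z)"
      by (intro tendsto_compose_op tendsto_const L)+
    then have "Z o\<^sub>L L = L o\<^sub>L Z" unfolding ZY by (rule LIMSEQ_unique)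
    then show "Z o\<^sub>L (id_blinfun - L) = (id_blinfun - L) o\<^sub>L Z" by (simp add: compose_bilinear)
  qed
qed

end

section \<open>Tracial states and the 2-norm\<close>

text \<open>A purely algebraic notion, which the composition of a trace with a unital endomorphism satisfies.\<close>

definition tracial_state ::
    "('h::complex_hilbert_space \<Rightarrow>\<^sub>L 'h) set \<Rightarrow> (('h \<Rightarrow>\<^sub>L 'h) \<Rightarrow> complex) \<Rightarrow> bool" where
  "tracial_state M \<tau> \<longleftrightarrow>
     \<tau> id_blinfun = 1 \<and>
     (\<forall>S\<in>M. \<forall>T\<in>M. \<tau> (S + T) = \<tau> S + \<tau> T) \<and>
     (\<forall>c. \<forall>T\<in>M. \<tau> (scalar_op c o\<^sub>L T) = c * \<tau> T) \<and>
     (\<forall>T\<in>M. \<tau> (adj T o\<^sub>L T) \<in> \<real>\<^sub>\<ge>\<^sub>0) \<and>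
     (\<forall>S\<in>M. \<forall>T\<in>M. \<tau> (S o\<^sub>L T) = \<tau> (T o\<^sub>L S))"

lemma scalar_op_of_real: "scalar_op (of_real r) o\<^sub>L T = r *\<^sub>R (T :: 'h::complex_hilbert_space \<Rightarrow>\<^sub>L 'h)"
  by (rule blinfun_eqI) (simp add: scaleR_eq_scaleC blinfun.scaleR_left)

lemma scalar_op_add: "scalar_op (c + d) = scalar_op c + (scalar_op d :: 'h::complex_hilbert_space \<Rightarrow>\<^sub>L 'h)"
  by (rule blinfun_eqI) (simp add: scaleC_add_left blinfun.add_left)

lemma scalar_op_0 [simp]: "scalar_op 0 = (0 :: 'h::complex_hilbert_space \<Rightarrow>\<^sub>L 'h)"
  by (rule blinfun_eqI) simp

lemma scalar_op_1 [simp]: "scalar_op 1 = (id_blinfun :: 'h::complex_hilbert_space \<Rightarrow>\<^sub>L 'h)"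
  by (rule blinfun_eqI) simp

lemma scalar_op_minus: "scalar_op (- c) = - (scalar_op c :: 'h::complex_hilbert_space \<Rightarrow>\<^sub>L 'h)"
  by (rule blinfun_eqI) (simp add: blinfun.minus_left)

lemma scalar_op_mult: "scalar_op c o\<^sub>L scalar_op d = (scalar_op (c * d) :: 'h::complex_hilbert_space \<Rightarrow>\<^sub>L 'h)"
  by (rule blinfun_eqI) (simp add: scaleC_scaleC)

lemma scalar_op_commute:
  "T \<in> clinear_ops \<Longrightarrow> T o\<^sub>L (scalar_op c :: 'h::complex_hilbert_space \<Rightarrow>\<^sub>L 'h) = scalar_op c o\<^sub>L T"
  by (rule blinfun_eqI) (simp add: clinear_opsD)

context vN_algebra
begin

context
  fixes \<tau> :: "('h \<Rightarrow>\<^sub>L 'h) \<Rightarrow> complex"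
  assumes \<tau>: "tracial_state R \<tau>"
begin

lemma tau_id: "\<tau> id_blinfun = 1"
  and tau_add: "S \<in> R \<Longrightarrow> T \<in> R \<Longrightarrow> \<tau> (S + T) = \<tau> S + \<tau> T"
  and tau_scalar: "T \<in> R \<Longrightarrow> \<tau> (scalar_op c o\<^sub>L T) = c * \<tau> T"
  and tau_pos: "T \<in> R \<Longrightarrow> \<tau> (adj T o\<^sub>L T) \<in> \<real>\<^sub>\<ge>\<^sub>0"
  and tau_commute: "S \<in> R \<Longrightarrow> T \<in> R \<Longrightarrow> \<tau> (S o\<^sub>L T) = \<tau> (T o\<^sub>L S)"
  using \<tau> by (auto simp: tracial_state_def)

lemma tau_scaleR: "T \<in> R \<Longrightarrow> \<tau> (r *\<^sub>R T) = of_real r * \<tau> T"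
  by (metis scalar_op_of_real tau_scalar)

lemma tau_minus: "T \<in> R \<Longrightarrow> \<tau> (- T) = - \<tau> T"
  using tau_scaleR[of T "-1"] by simp

lemma tau_diff: "S \<in> R \<Longrightarrow> T \<in> R \<Longrightarrow> \<tau> (S - T) = \<tau> S - \<tau> T"
  using tau_add[of S "- T"] tau_minus[of T] by auto

lemma tau_zero: "\<tau> 0 = 0"
  using tau_scaleR[of id_blinfun 0] by simp

lemma tau_sum: "(\<And>i. i \<in> F \<Longrightarrow> f i \<in> R) \<Longrightarrow> \<tau> (\<Sum>i\<in>F. f i) = (\<Sum>i\<in>F. \<tau> (f i))"
  by (induction F rule: infinite_finite_induct) (auto simp: tau_zero tau_add mem_sum)

lemma tau_pos_real: "T \<in> R \<Longrightarrow> \<exists>r\<ge>0. \<tau> (adj T o\<^sub>L T) = of_real r"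
  using tau_pos[of T] by (auto elim: nonneg_Reals_cases)

lemma tau_adj: assumes T: "T \<in> R" shows "\<tau> (adj T) = cnj (\<tau> T)"
proof -
  have Im0: "Im (\<tau> (adj U o\<^sub>L U)) = 0" if "U \<in> R" for U
    using tau_pos_real[OF that] by auto
  have key: "Im (cnj c * \<tau> (adj T) + c * \<tau> T) = 0" for c
  proof -
    have U: "id_blinfun + (scalar_op c o\<^sub>L T) \<in> R" using T by auto
    have "adj (id_blinfun + (scalar_op c o\<^sub>L T)) o\<^sub>L (id_blinfun + (scalar_op c o\<^sub>L T))
      = id_blinfun + (scalar_op c o\<^sub>L T) + (scalar_op (cnj c) o\<^sub>L adj T)
        + (adj (scalar_op c o\<^sub>L T) o\<^sub>L (scalar_op c o\<^sub>L T))"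
      using clinear[OF T] adj_clinear[OF clinear[OF T]]
      by (intro blinfun_eqI) (simp add: adj_add adj_compose clinear_ops_intros adj_scalar_op
          blinfun.bilinear_simps scaleC_add_right clinear_opsD)
    then have "\<tau> (adj (id_blinfun + (scalar_op c o\<^sub>L T)) o\<^sub>L (id_blinfun + (scalar_op c o\<^sub>L T)))
      = 1 + c * \<tau> T + cnj c * \<tau> (adj T) + \<tau> (adj (scalar_op c o\<^sub>L T) o\<^sub>L (scalar_op c o\<^sub>L T))"
      using T by (simp add: tau_add tau_id tau_scalar mem_add mem_compose mem_adj)
    moreover have "Im (\<tau> (adj (scalar_op c o\<^sub>L T) o\<^sub>L (scalar_op c o\<^sub>L T))) = 0" using Im0 T by blast
    ultimately show ?thesis using Im0[OF U] by (simp add: algebra_simps)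
  qed
  show ?thesis using key[of 1] key[of \<i>] by (auto simp: complex_eq_iff)
qed

end

end

locale traced_algebra = vN_algebra R for R :: "('h::complex_hilbert_space \<Rightarrow>\<^sub>L 'h) set" +
  fixes \<tau> :: "('h \<Rightarrow>\<^sub>L 'h) \<Rightarrow> complex"
  assumes trace: "faithful_normal_trace R \<tau>"
begin

lemma tracial: "tracial_state R \<tau>"
  using trace by (auto simp: faithful_normal_trace_def tracial_state_def)

lemmas t_id = tau_id[OF tracial] and t_add = tau_add[OF tracial] and t_scalar = tau_scalar[OF tracial]
  and t_commute = tau_commute[OF tracial] and t_scaleR = tau_scaleR[OF tracial]
  and t_minus = tau_minus[OF tracial] and t_diff = tau_diff[OF tracial] and t_zero = tau_zero[OF tracial]
  and t_sum = tau_sum[OF tracial] and t_adj = tau_adj[OF tracial] and t_pos_real = tau_pos_real[OF tracial]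

lemma t_faithful: "T \<in> R \<Longrightarrow> \<tau> (adj T o\<^sub>L T) = 0 \<Longrightarrow> T = 0"
  using trace by (auto simp: faithful_normal_trace_def)

text \<open>The norm of the GNS space of the trace.\<close>

definition n2 :: "('h \<Rightarrow>\<^sub>L 'h) \<Rightarrow> real" where
  "n2 T = sqrt (Re (\<tau> (adj T o\<^sub>L T)))"

lemma n2_sq: "T \<in> R \<Longrightarrow> \<tau> (adj T o\<^sub>L T) = of_real ((n2 T)\<^sup>2)"
  using t_pos_real[of T] by (auto simp: n2_def simp flip: of_real_power)

lemma n2_nonneg: "T \<in> R \<Longrightarrow> n2 T \<ge> 0"
  using t_pos_real[of T] by (auto simp: n2_def)

lemma n2_eq_0: "T \<in> R \<Longrightarrow> n2 T = 0 \<Longrightarrow> T = 0"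
  using t_faithful[of T] n2_sq[of T] by simp

lemma t_Cauchy_Schwarz:
  assumes S: "S \<in> R" and T: "T \<in> R"
  shows "cmod (\<tau> (adj S o\<^sub>L T)) \<le> n2 S * n2 T"
proof (cases "n2 T = 0")
  case True then show ?thesis using n2_eq_0[OF T] by (simp add: compose_bilinear t_zero)
next
  case False
  define s where "s = \<tau> (adj S o\<^sub>L T)"
  have s': "\<tau> (adj T o\<^sub>L S) = cnj s"
    using t_adj[of "adj S o\<^sub>L T"] S T by (simp add: s_def adj_compose clinear adj_clinear adj_adj mem_compose mem_adj)
  define c where "c = cnj s / of_real ((n2 T)\<^sup>2)"
  have cm: "scalar_op c o\<^sub>L T \<in> R" using T by auto
  have e: "adj (S - (scalar_op c o\<^sub>L T)) o\<^sub>L (S - (scalar_op c o\<^sub>L T))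
    = (adj S o\<^sub>L S) - (scalar_op c o\<^sub>L (adj S o\<^sub>L T)) - (scalar_op (cnj c) o\<^sub>L (adj T o\<^sub>L S))
      + (scalar_op (cnj c * c) o\<^sub>L (adj T o\<^sub>L T))"
    using S T cm clinear[OF S] clinear[OF T] adj_clinear[OF clinear[OF S]] adj_clinear[OF clinear[OF T]]
    by (intro blinfun_eqI)
      (simp add: adj_diff clinear adj_compose clinear_ops_intros adj_scalar_op blinfun.bilinear_simps
        clinear_opsD scaleC_diff_right scaleC_scaleC mult.commute)
  have "\<tau> (adj (S - (scalar_op c o\<^sub>L T)) o\<^sub>L (S - (scalar_op c o\<^sub>L T)))
    = of_real ((n2 S)\<^sup>2) - c * s - cnj c * cnj s + cnj c * c * of_real ((n2 T)\<^sup>2)"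
    unfolding e using S T
    by (simp add: t_add t_diff t_scalar n2_sq mem_compose mem_adj mem_add mem_diff s_def[symmetric] s' del: of_real_power)
  also have "c * s = of_real ((cmod s)\<^sup>2 / (n2 T)\<^sup>2)"
    by (simp add: c_def complex_norm_square mult.commute del: of_real_power)
  also have "cnj c * cnj s = of_real ((cmod s)\<^sup>2 / (n2 T)\<^sup>2)"
    by (simp add: c_def complex_norm_square mult.commute del: of_real_power)
  also have "cnj c * c * of_real ((n2 T)\<^sup>2) = of_real ((cmod s)\<^sup>2 / (n2 T)\<^sup>2)"
  proof -
    have "cnj c * c = of_real ((cmod s)\<^sup>2) / (of_real ((n2 T)\<^sup>2) * of_real ((n2 T)\<^sup>2))"
      unfolding complex_norm_square by (simp add: c_def mult.commute)
    then show ?thesis using False by (simp add: power4_eq_xxxx power2_eq_square)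
  qed
  finally have "\<tau> (adj (S - (scalar_op c o\<^sub>L T)) o\<^sub>L (S - (scalar_op c o\<^sub>L T)))
    = of_real ((n2 S)\<^sup>2 - (cmod s)\<^sup>2 / (n2 T)\<^sup>2)" by simp
  then have "(n2 S)\<^sup>2 - (cmod s)\<^sup>2 / (n2 T)\<^sup>2 \<ge> 0"
    using t_pos_real[OF mem_diff[OF S cm]] by (metis of_real_eq_iff)
  then have "(cmod s)\<^sup>2 \<le> (n2 S * n2 T)\<^sup>2"
    using False by (simp add: field_simps power_mult_distrib)
  then show ?thesis unfolding s_def
    by (rule power2_le_imp_le) (simp add: n2_nonneg S T)
qed

lemma n2_add: assumes S: "S \<in> R" and T: "T \<in> R" shows "n2 (S + T) \<le> n2 S + n2 T"
proof -
  have e: "adj (S + T) o\<^sub>L (S + T) = (adj S o\<^sub>L S) + (adj S o\<^sub>L T) + ((adj T o\<^sub>L S) + (adj T o\<^sub>L T))"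
    using S T by (simp add: adj_add clinear compose_bilinear algebra_simps)
  have "complex_of_real ((n2 (S + T))\<^sup>2)
    = of_real ((n2 S)\<^sup>2) + \<tau> (adj S o\<^sub>L T) + (\<tau> (adj T o\<^sub>L S) + of_real ((n2 T)\<^sup>2))"
    unfolding n2_sq[OF mem_add[OF S T], symmetric] e using S T
    by (simp add: t_add mem_compose mem_adj mem_add n2_sq del: of_real_power)
  then have "(n2 (S + T))\<^sup>2 = (n2 S)\<^sup>2 + Re (\<tau> (adj S o\<^sub>L T)) + (Re (\<tau> (adj T o\<^sub>L S)) + (n2 T)\<^sup>2)"
    by (metis Re_complex_of_real plus_complex.sel(1))
  also have "\<dots> \<le> (n2 S)\<^sup>2 + n2 S * n2 T + (n2 T * n2 S + (n2 T)\<^sup>2)"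
    using t_Cauchy_Schwarz[OF S T] t_Cauchy_Schwarz[OF T S] complex_Re_le_cmod order_trans
    by (intro add_mono) blast+
  also have "\<dots> = (n2 S + n2 T)\<^sup>2" by (simp add: power2_eq_square algebra_simps)
  finally show ?thesis by (rule power2_le_imp_le) (simp add: n2_nonneg S T)
qed

lemma n2_scalar: assumes T: "T \<in> R" shows "n2 (scalar_op c o\<^sub>L T) = cmod c * n2 T"
proof -
  have "adj (scalar_op c o\<^sub>L T) o\<^sub>L (scalar_op c o\<^sub>L T) = scalar_op (cnj c * c) o\<^sub>L (adj T o\<^sub>L T)"
    using adj_clinear[OF clinear[OF T]]
    by (intro blinfun_eqI) (simp add: adj_compose clinear T clinear_ops_intros adj_scalar_op clinear_opsD scaleC_scaleC mult.commute)
  moreover have "cnj c * c = of_real ((cmod c)\<^sup>2)"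
    by (simp add: complex_norm_square mult.commute del: of_real_power)
  ultimately have "adj (scalar_op c o\<^sub>L T) o\<^sub>L (scalar_op c o\<^sub>L T) = (cmod c)\<^sup>2 *\<^sub>R (adj T o\<^sub>L T)"
    by (metis scalar_op_of_real)
  then have "complex_of_real ((n2 (scalar_op c o\<^sub>L T))\<^sup>2) = of_real ((cmod c * n2 T)\<^sup>2)"
    using T n2_sq[of "scalar_op c o\<^sub>L T"] n2_sq[of T]
    by (simp add: t_scaleR mem_compose mem_adj power_mult_distrib)
  then have "(n2 (scalar_op c o\<^sub>L T))\<^sup>2 = (cmod c * n2 T)\<^sup>2" by (simp only: of_real_eq_iff)
  then show ?thesis using T n2_nonneg[of T] n2_nonneg[of "scalar_op c o\<^sub>L T"] by (simp add: power2_eq_iff_nonneg mem_compose)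
qed

lemma n2_scaleR: "T \<in> R \<Longrightarrow> n2 (r *\<^sub>R T) = \<bar>r\<bar> * n2 T"
  using n2_scalar[of T "of_real r"] by (simp add: scalar_op_of_real)

lemma n2_minus: "T \<in> R \<Longrightarrow> n2 (- T) = n2 T"
  using n2_scaleR[of T "-1"] by simp

lemma n2_zero: "n2 0 = 0"
  by (simp add: n2_def compose_bilinear t_zero)

lemma n2_id: "n2 id_blinfun = 1"
  by (simp add: n2_def t_id)

lemma n2_adj: "T \<in> R \<Longrightarrow> n2 (adj T) = n2 T"
  using t_commute[of T "adj T"] by (simp add: n2_def adj_adj clinear mem_adj)

text \<open>If \<open>Q\<^sup>2 = 1 - S\<^sup>*S/r\<^sup>2\<close> with \<open>r = \<parallel>S\<parallel>\<close>, then \<open>\<tau> ((QT)\<^sup>*(QT)) \<ge> 0\<close> is the claim.\<close>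

lemma n2_compose_left: assumes S: "S \<in> R" and T: "T \<in> R" shows "n2 (S o\<^sub>L T) \<le> norm S * n2 T"
proof (cases "norm S = 0")
  case True then show ?thesis using n2_zero by (simp add: compose_bilinear)
next
  case False
  define r where "r = norm S"
  have r: "r > 0" using False by (simp add: r_def)
  define X where "X = id_blinfun - (1 / r\<^sup>2) *\<^sub>R (adj S o\<^sub>L S)"
  note cl = clinear[OF S] clinear[OF T] adj_clinear[OF clinear[OF S]] clinear_ops_intros
  have X: "X \<in> R" "adj X = X" using S
    by (auto simp: X_def adj_diff adj_scaleR adj_compose adj_adj cl)
  have "norm (adj S o\<^sub>L S) \<le> r * r"
    using norm_blinfun_compose[of "adj S" S] norm_adj_le[OF cl(1)] r
    by (smt (verit, best) mult_right_mono norm_ge_zero r_def)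
  then have "norm (id_blinfun - X) \<le> 1" using r by (simp add: X_def power2_eq_square divide_le_eq_1)
  from square_root[OF X this] obtain Q where Q: "Q \<in> R" "adj Q = Q" "Q o\<^sub>L Q = X" by blast
  have QT: "Q o\<^sub>L T \<in> R" "S o\<^sub>L T \<in> R" using Q S T by auto
  have "adj (Q o\<^sub>L T) o\<^sub>L (Q o\<^sub>L T) = adj T o\<^sub>L (X o\<^sub>L T)"
    using Q(2,3) by (simp add: adj_compose clinear Q(1) T blinfun_compose_assoc[symmetric])
      (simp add: blinfun_compose_assoc Q(3))
  also have "\<dots> = (adj T o\<^sub>L T) - (1 / r\<^sup>2) *\<^sub>R (adj (S o\<^sub>L T) o\<^sub>L (S o\<^sub>L T))"
    by (simp add: X_def compose_bilinear adj_compose cl blinfun_compose_assoc)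
  finally have "complex_of_real ((n2 (Q o\<^sub>L T))\<^sup>2) = of_real ((n2 T)\<^sup>2) - of_real (1 / r\<^sup>2) * of_real ((n2 (S o\<^sub>L T))\<^sup>2)"
    using QT T by (simp add: n2_sq[symmetric] t_diff t_scaleR mem_compose mem_adj mem_scaleR del: of_real_power of_real_divide)
  then have "complex_of_real ((n2 (Q o\<^sub>L T))\<^sup>2) = of_real ((n2 T)\<^sup>2 - 1 / r\<^sup>2 * (n2 (S o\<^sub>L T))\<^sup>2)"
    by simp
  then have "(n2 T)\<^sup>2 - 1 / r\<^sup>2 * (n2 (S o\<^sub>L T))\<^sup>2 \<ge> 0"
    by (metis of_real_eq_iff zero_le_power2)
  then have "(n2 (S o\<^sub>L T))\<^sup>2 \<le> (r * n2 T)\<^sup>2"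
    using r by (simp add: field_simps power_mult_distrib)
  then show ?thesis unfolding r_def by (rule power2_le_imp_le) (simp add: n2_nonneg T)
qed

lemma n2_compose_right: assumes S: "S \<in> R" and T: "T \<in> R" shows "n2 (T o\<^sub>L S) \<le> n2 T * norm S"
proof -
  have "n2 (T o\<^sub>L S) = n2 (adj S o\<^sub>L adj T)"
    using n2_adj[of "T o\<^sub>L S"] S T by (simp add: adj_compose clinear mem_compose)
  also have "\<dots> \<le> norm (adj S) * n2 (adj T)" using S T by (intro n2_compose_left) auto
  also have "\<dots> \<le> norm S * n2 T"
    using norm_adj_le[OF clinear[OF S]] n2_adj[OF T] n2_nonneg[OF T] by (simp add: mult_right_mono)
  finally show ?thesis by (simp add: mult.commute)
qed

text \<open>Although the trace is given by two different square-summable sequences, positivity lets it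
  be dominated by the vector functional of their mean; this replaces ultraweak continuity.\<close>

lemma trace_dominated: "\<exists>\<zeta> :: 'h ell2. \<forall>T\<in>R. n2 T \<le> norm (ell2_diag T \<zeta>)"
proof -
  obtain x y :: "nat \<Rightarrow> 'h" where x: "summable (\<lambda>n. (norm (x n))\<^sup>2)" and y: "summable (\<lambda>n. (norm (y n))\<^sup>2)"
    and s: "\<And>T. T \<in> R \<Longrightarrow> (\<lambda>n. cinner (y n) (T (x n))) sums \<tau> T"
    using trace by (auto simp: faithful_normal_trace_def)
  define X where "X = Abs_ell2 x"
  define Y where "Y = Abs_ell2 y"
  have X: "coord X = x" "coord Y = y" using x y by (auto simp: X_def Y_def Abs_ell2_inverse)
  define \<zeta> where "\<zeta> = (1/2) *\<^sub>R (X + Y)"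
  have "n2 T \<le> norm (ell2_diag T \<zeta>)" if T: "T \<in> R" for T
  proof (rule power2_le_imp_le)
    have eq: "cinner (y n) ((adj T o\<^sub>L T) (x n)) = cinner (T (y n)) (T (x n))" for n
      using cinner_adj_right[OF clinear[OF T]] by simp
    have "(\<lambda>n. cinner (T (y n)) (T (x n))) sums \<tau> (adj T o\<^sub>L T)"
      using s[of "adj T o\<^sub>L T"] T unfolding eq by blast
    moreover have "(\<lambda>n. cinner (T (y n)) (T (x n))) sums cinner (ell2_diag T Y) (ell2_diag T X)"
      using summable_sums[OF summable_cinner[OF summable_coord summable_coord, of "ell2_diag T Y" "ell2_diag T X"]]
      by (simp add: cinner_ell2.rep_eq X)
    ultimately have c: "cinner (ell2_diag T Y) (ell2_diag T X) = of_real ((n2 T)\<^sup>2)"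
      using sums_unique2 n2_sq[OF T] by metis
    have "ell2_diag T \<zeta> = (1/2) *\<^sub>R (ell2_diag T Y + ell2_diag T X)"
      by (rule ell2_eqI) (simp add: \<zeta>_def blinfun.bilinear_simps add.commute)
    then have "(norm (ell2_diag T \<zeta>))\<^sup>2 = (norm (ell2_diag T Y + ell2_diag T X))\<^sup>2 / 4"
      by (simp add: power_mult_distrib power_divide)
    also have "(norm (ell2_diag T Y + ell2_diag T X))\<^sup>2
      = (norm (ell2_diag T Y - ell2_diag T X))\<^sup>2 + 4 * (n2 T)\<^sup>2"
      by (simp add: norm_add_sq norm_diff_sq c)
    finally have eq: "(norm (ell2_diag T \<zeta>))\<^sup>2
      = ((norm (ell2_diag T Y - ell2_diag T X))\<^sup>2 + 4 * (n2 T)\<^sup>2) / 4" .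
    show "(n2 T)\<^sup>2 \<le> (norm (ell2_diag T \<zeta>))\<^sup>2" unfolding eq by simp
  qed simp
  then show ?thesis by blast
qed

end

section \<open>Words in a spin system\<close>

text \<open>Finite sets of generator indices are encoded as polynomials over the two-element field: addition
  of polynomials is multiplication of words up to sign, and multiplication by the indeterminate is
  the shift.  Degree and divisibility by powers of the indeterminate then say which generators can
  occur.\<close>

definition sg :: "bit \<Rightarrow> real" where "sg c = (if c = 1 then -1 else 1)"

lemma sg_simps [simp]: "sg 0 = 1" "sg 1 = -1" "sg c * sg c = 1" "\<bar>sg c\<bar> = 1" "sg c \<noteq> 0"
  by (auto simp: sg_def)

lemma sg_inject: "sg c = sg d \<longleftrightarrow> c = d"
  by (cases c; cases d) auto

lemma bit_add_self [simp]: "c + c = (0::bit)" by (cases c) auto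

lemma two_bit_poly [simp]: "2 = (0::bit poly)"
  by (metis bit_2_eq_0 of_nat_numeral of_nat_poly pCons_0_0)

lemma bit_poly_add_self [simp]: "p + p = (0::bit poly)"
  by (metis mult_2 mult_zero_left two_bit_poly)

lemma bit_poly_diff [simp]: "p - q = p + (q::bit poly)"
  by (rule poly_eqI) simp

lemma bit_poly_add_eq_0: "p + q = 0 \<longleftrightarrow> p = (q::bit poly)"
  by (metis add_0 add.assoc bit_poly_add_self add.right_neutral)

fun convolve :: "(int \<Rightarrow> bit) \<Rightarrow> int \<Rightarrow> bit list \<Rightarrow> bit" where
  "convolve s i [] = 0"
| "convolve s i (c # cs) = c * s i + convolve s (i - 1) cs"

definition conv :: "(int \<Rightarrow> bit) \<Rightarrow> int \<Rightarrow> bit poly \<Rightarrow> bit" where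
  "conv s i p = convolve s i (coeffs p)"

text \<open>\<open>pairing a i p\<close> is \<open>0\<close> or \<open>1\<close> according to whether the generator with index \<open>i\<close> commutes or
  anticommutes with the word of \<open>p\<close>.  It is defined for all integers \<open>i\<close> because the mirror sequence
  is.\<close>

abbreviation pairing :: "(nat \<Rightarrow> bit) \<Rightarrow> int \<Rightarrow> bit poly \<Rightarrow> bit" where
  "pairing a \<equiv> conv (mirror a)"

lemma conv_0 [simp]: "conv s i 0 = 0"
  by (simp add: conv_def)

lemma conv_pCons [simp]: "conv s i (pCons c p) = c * s i + conv s (i - 1) p"
  by (simp add: conv_def cCons_def)

lemma conv_add: "conv s i (p + q) = conv s i p + conv s i q"
  by (induction p q arbitrary: i rule: poly_induct2) (auto simp: algebra_simps)

lemma mirror_uminus [simp]: "mirror a (- i) = mirror a i"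
  by (simp add: mirror_def)

lemma mirror_minus_commute: "mirror a (i - j) = mirror a (j - i)"
  by (metis minus_diff_eq mirror_uminus)

lemma mirror_of_nat [simp]: "mirror a (int n) = a n"
  by (simp add: mirror_def)

definition spin_system :: "(nat \<Rightarrow> bit) \<Rightarrow> (nat \<Rightarrow> 'h::complex_hilbert_space \<Rightarrow>\<^sub>L 'h) \<Rightarrow> bool" where
  "spin_system a v \<longleftrightarrow> a 0 = 0 \<and>
     (\<forall>i. v i \<in> clinear_ops \<and> adj (v i) = v i \<and> v i o\<^sub>L v i = id_blinfun) \<and>
     (\<forall>i j. v i o\<^sub>L v (i + j) = sg (a j) *\<^sub>R (v (i + j) o\<^sub>L v i))"

fun list_word :: "(nat \<Rightarrow> 'h::real_normed_vector \<Rightarrow>\<^sub>L 'h) \<Rightarrow> bit list \<Rightarrow> 'h \<Rightarrow>\<^sub>L 'h" where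
  "list_word v [] = id_blinfun"
| "list_word v (c # cs) = (if c = 1 then v 0 else id_blinfun) o\<^sub>L list_word (\<lambda>n. v (Suc n)) cs"

definition word :: "(nat \<Rightarrow> 'h::real_normed_vector \<Rightarrow>\<^sub>L 'h) \<Rightarrow> bit poly \<Rightarrow> 'h \<Rightarrow>\<^sub>L 'h" where
  "word v p = list_word v (coeffs p)"

lemma word_0 [simp]: "word v 0 = id_blinfun"
  by (simp add: word_def)

lemma word_pCons: "word v (pCons c p) = (if c = 1 then v 0 else id_blinfun) o\<^sub>L word (\<lambda>n. v (Suc n)) p"
  by (simp add: word_def cCons_def)

lemma word_pCons_0 [simp]: "word v (pCons 0 p) = word (\<lambda>n. v (Suc n)) p"
  by (simp add: word_pCons)

lemma word_1 [simp]: "word v 1 = v 0"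
  by (simp add: one_pCons word_pCons)

lemma word_monom: "word v (monom 1 i) = v i"
  by (induction i arbitrary: v) (simp_all add: monom_0 word_pCons monom_Suc)

text \<open>Products and adjoints of words are words only up to sign; the sign does not matter for membership
  in an algebra or for the vanishing of a trace.\<close>

definition pm :: "('h::real_normed_vector \<Rightarrow>\<^sub>L 'h) \<Rightarrow> ('h \<Rightarrow>\<^sub>L 'h) \<Rightarrow> bool" where
  "pm S T \<longleftrightarrow> S = T \<or> S = - T"

lemma pm_refl [simp]: "pm S S"
  and pm_sym: "pm S T \<Longrightarrow> pm T S"
  and pm_trans [trans]: "pm S T \<Longrightarrow> pm T U \<Longrightarrow> pm S U"
  and pm_compose: "pm S S' \<Longrightarrow> pm T T' \<Longrightarrow> pm (S o\<^sub>L T) (S' o\<^sub>L T')"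
  and pm_scaleR: "pm (sg c *\<^sub>R S) S"
  by (auto simp: pm_def compose_bilinear sg_def)

lemma spin_systemD:
  assumes "spin_system a v"
  shows "a 0 = 0" "v i \<in> clinear_ops" "adj (v i) = v i" "v i o\<^sub>L v i = id_blinfun"
    "v i o\<^sub>L v (i + j) = sg (a j) *\<^sub>R (v (i + j) o\<^sub>L v i)"
  using assms by (auto simp: spin_system_def)

lemma spin_system_Suc: "spin_system a v \<Longrightarrow> spin_system a (\<lambda>n. v (Suc n))"
  unfolding spin_system_def by (metis add_Suc)

lemma spin_square_apply: "spin_system a v \<Longrightarrow> v i (v i x) = x"
  using spin_systemD(4)[of a v i] by (metis blinfun_apply_blinfun_compose id_blinfun.rep_eq)

lemma spin_norm: assumes "spin_system a v" shows "norm (v i x) = norm x"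
proof -
  have "(norm (v i x))\<^sup>2 = (norm x)\<^sup>2"
    using norm_adj_apply_sq[OF spin_systemD(2)[OF assms, of i], of x] spin_systemD(3)[OF assms, of i]
      spin_square_apply[OF assms, of i] by (simp add: Re_cinner_self)
  then show ?thesis by simp
qed

lemma spin_norm_le: "spin_system a v \<Longrightarrow> norm (v i) \<le> 1"
  by (rule norm_blinfun_bound) (simp_all add: spin_norm)

lemma spin_commute: assumes "spin_system a v"
  shows "v i o\<^sub>L v j = sg (mirror a (int i - int j)) *\<^sub>R (v j o\<^sub>L v i)"
proof (cases "i \<le> j")
  case True
  then obtain k where k: "j = i + k" using le_Suc_ex by blast
  then show ?thesis using spin_systemD(5)[OF assms, of i k] by (simp add: mirror_def)
next
  case False
  then obtain k where k: "i = j + k" using le_Suc_ex nat_le_linear by blast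
  then show ?thesis using spin_systemD(5)[OF assms, of j k] by (simp add: mirror_def)
qed

text \<open>The offset \<open>k\<close> makes the induction possible: removing the first letter of a word shifts the
  remaining generators.\<close>

lemma spin_commute_word_aux:
  assumes sp: "spin_system a v"
  shows "v i o\<^sub>L word (\<lambda>n. v (n + k)) p = sg (pairing a (int i - int k) p) *\<^sub>R (word (\<lambda>n. v (n + k)) p o\<^sub>L v i)"
proof (induction p arbitrary: k)
  case 0 then show ?case by simp
next
  case (pCons c p)
  let ?W = "word (\<lambda>n. v (Suc (n + k))) p"
  have IH: "v i (?W x) = sg (pairing a (int i - int k - 1) p) *\<^sub>R ?W (v i x)" for x
  proof -
    have "(v i o\<^sub>L ?W) x = (sg (pairing a (int i - int k - 1) p) *\<^sub>R (?W o\<^sub>L v i)) x"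
      using pCons.IH[of "Suc k"] by (simp add: algebra_simps)
    then show ?thesis by (simp add: blinfun.scaleR_left)
  qed
  have C: "v i (v k x) = sg (mirror a (int i - int k)) *\<^sub>R v k (v i x)" for x
  proof -
    have "(v i o\<^sub>L v k) x = (sg (mirror a (int i - int k)) *\<^sub>R (v k o\<^sub>L v i)) x"
      using spin_commute[OF sp, of i k] by simp
    then show ?thesis by (simp add: blinfun.scaleR_left)
  qed
  show ?case
    by (rule blinfun_eqI, cases c; cases "mirror a (int i - int k)"; cases "pairing a (int i - int k - 1) p")
      (simp_all add: word_pCons IH C blinfun.bilinear_simps)
qed

lemma spin_commute_word:
  assumes sp: "spin_system a v"
  shows "v i o\<^sub>L word v p = sg (pairing a (int i) p) *\<^sub>R (word v p o\<^sub>L v i)"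
  using spin_commute_word_aux[OF sp, of i 0 p] by simp

lemma spin_commute_word_apply:
  assumes sp: "spin_system a v"
  shows "v i (word v p x) = sg (pairing a (int i) p) *\<^sub>R word v p (v i x)"
  by (metis spin_commute_word[OF sp] blinfun_apply_blinfun_compose blinfun.scaleR_left)

lemma pm_commute_word:
  assumes sp: "spin_system a v"
  shows "pm (word (\<lambda>n. v (n + k)) p o\<^sub>L v i) (v i o\<^sub>L word (\<lambda>n. v (n + k)) p)"
  unfolding spin_commute_word_aux[OF sp] by (rule pm_sym[OF pm_scaleR])

lemma word_mult:
  assumes "spin_system a v"
  shows "pm (word v p o\<^sub>L word v q) (word v (p + q))"
  using assms
proof (induction p q arbitrary: v rule: poly_induct2)
  case 0 then show ?case by simp
next
  case (pCons c p d q)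
  let ?v = "\<lambda>n. v (Suc n)" and ?e = "\<lambda>c::bit. if c = 1 then v 0 else id_blinfun"
  have IH: "pm (word ?v p o\<^sub>L word ?v q) (word ?v (p + q))"
    using pCons by (intro pCons.IH spin_system_Suc)
  have "pm (word ?v p o\<^sub>L ?e d) (?e d o\<^sub>L word ?v p)"
    using pm_commute_word[OF pCons.prems, of 1 p 0] by simp
  from pm_compose[OF pm_refl pm_compose[OF this pm_refl]] have "pm (?e c o\<^sub>L ((word ?v p o\<^sub>L ?e d) o\<^sub>L word ?v q)) (?e c o\<^sub>L ((?e d o\<^sub>L word ?v p) o\<^sub>L word ?v q))" .
  then have "pm (word v (pCons c p) o\<^sub>L word v (pCons d q)) ((?e c o\<^sub>L ?e d) o\<^sub>L (word ?v p o\<^sub>L word ?v q))"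
    by (simp add: word_pCons blinfun_compose_assoc)
  also have "pm \<dots> ((?e c o\<^sub>L ?e d) o\<^sub>L word ?v (p + q))" by (intro pm_compose pm_refl IH)
  also have "?e c o\<^sub>L ?e d = ?e (c + d)"
    using spin_systemD(4)[OF pCons.prems, of 0] by (cases c; cases d) auto
  also have "?e (c + d) o\<^sub>L word ?v (p + q) = word v (pCons c p + pCons d q)" by (simp add: word_pCons)
  finally show ?case .
qed

lemma word_clinear:
  assumes "spin_system a v" shows "word v p \<in> clinear_ops"
  using assms
proof (induction p arbitrary: v)
  case (pCons c p)
  then show ?case
    using pCons.IH[OF spin_system_Suc[OF pCons.prems]] spin_systemD(2)[OF pCons.prems]
    by (simp add: word_pCons clinear_ops_intros)
qed (simp add: clinear_ops_intros)

lemma word_adj: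
  assumes "spin_system a v" shows "pm (adj (word v p)) (word v p)"
  using assms
proof (induction p arbitrary: v)
  case (pCons c p)
  let ?v = "\<lambda>n. v (Suc n)" and ?e = "\<lambda>c::bit. if c = 1 then v 0 else id_blinfun"
  note sp = spin_system_Suc[OF pCons.prems]
  have "adj (word v (pCons c p)) = adj (word ?v p) o\<^sub>L ?e c"
    using word_clinear[OF sp] spin_systemD(2,3)[OF pCons.prems]
    by (simp add: word_pCons adj_compose clinear_ops_intros)
  also have "pm \<dots> (word ?v p o\<^sub>L ?e c)" by (intro pm_compose pm_refl pCons.IH sp)
  also have "pm \<dots> (?e c o\<^sub>L word ?v p)"
    using pm_commute_word[OF pCons.prems, of 1 p 0] by simp
  finally show ?case by (simp add: word_pCons)
qed simp

lemma word_unitary: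
  assumes "spin_system a v"
  shows "adj (word v p) o\<^sub>L word v p = id_blinfun" "word v p o\<^sub>L adj (word v p) = id_blinfun"
proof -
  have "adj (word v p) o\<^sub>L word v p = id_blinfun \<and> word v p o\<^sub>L adj (word v p) = id_blinfun"
    using assms
  proof (induction p arbitrary: v)
    case (pCons c p)
    let ?v = "\<lambda>n. v (Suc n)" and ?e = "\<lambda>c::bit. if c = 1 then v 0 else id_blinfun"
    note sp = spin_system_Suc[OF pCons.prems]
    have e: "?e c (?e c y) = y" for y using spin_square_apply[OF pCons.prems, of 0] by auto
    have u: "adj (word ?v p) (word ?v p y) = y" "word ?v p (adj (word ?v p) y) = y" for y
      using pCons.IH[OF sp] by (metis blinfun_apply_blinfun_compose id_blinfun.rep_eq)+
    have a: "adj (word v (pCons c p)) = adj (word ?v p) o\<^sub>L ?e c"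
      using word_clinear[OF sp] spin_systemD(2,3)[OF pCons.prems]
      by (simp add: word_pCons adj_compose clinear_ops_intros)
    have w: "word v (pCons c p) = ?e c o\<^sub>L word ?v p" by (rule word_pCons)
    show ?case unfolding a unfolding w blinfun_eq_iff blinfun_apply_blinfun_compose id_blinfun.rep_eq e u by simp
  qed simp
  then show "adj (word v p) o\<^sub>L word v p = id_blinfun" "word v p o\<^sub>L adj (word v p) = id_blinfun" by auto
qed

lemma word_norm_le: assumes "spin_system a v" shows "norm (word v p) \<le> 1"
proof (rule norm_blinfun_bound)
  fix x
  have "adj (word v p) (word v p x) = x"
    using word_unitary(1)[OF assms, of p] by (metis blinfun_apply_blinfun_compose id_blinfun.rep_eq)
  then have "(norm (word v p x))\<^sup>2 = (norm x)\<^sup>2"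
    using norm_adj_apply_sq[OF word_clinear[OF assms, of p], of x] by (simp add: Re_cinner_self)
  then show "norm (word v p x) \<le> 1 * norm x" by simp
qed simp

definition nondegenerate :: "(nat \<Rightarrow> bit) \<Rightarrow> bool" where
  "nondegenerate a \<longleftrightarrow> (\<forall>p. p \<noteq> 0 \<longrightarrow> (\<exists>i. pairing a (int i) p = 1))"

definition comb :: "(nat \<Rightarrow> 'h::complex_hilbert_space \<Rightarrow>\<^sub>L 'h) \<Rightarrow> bit poly set \<Rightarrow> (bit poly \<Rightarrow> complex) \<Rightarrow> 'h \<Rightarrow>\<^sub>L 'h" where
  "comb v F c = (\<Sum>p\<in>F. scalar_op (c p) o\<^sub>L word v p)"

text \<open>The closure properties of the span are rule inductions for this description, whereas \<open>comb\<close> has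
  one coefficient for each word; the next lemma collects equal words to pass from one to the other.\<close>

inductive_set words_span :: "(nat \<Rightarrow> 'h::complex_hilbert_space \<Rightarrow>\<^sub>L 'h) \<Rightarrow> ('h \<Rightarrow>\<^sub>L 'h) set" for v where
  zero: "0 \<in> words_span v"
| add: "T \<in> words_span v \<Longrightarrow> (scalar_op c o\<^sub>L word v p) + T \<in> words_span v"

lemma words_span_comb: "T \<in> words_span v \<Longrightarrow> \<exists>F c. finite F \<and> T = comb v F c"
proof (induction rule: words_span.induct)
  case zero show ?case by (rule exI[of _ "{}"]) (simp add: comb_def)
next
  case (add T c p)
  then obtain F d where F: "finite F" "T = comb v F d" by blast
  define d' where "d' = d(p := c + (if p \<in> F then d p else 0))"
  have "comb v (insert p F) d' = (scalar_op (d' p) o\<^sub>L word v p) + comb v (F - {p}) d'"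
    unfolding comb_def using F by (simp add: sum.insert_remove)
  also have "comb v (F - {p}) d' = comb v (F - {p}) d"
    unfolding comb_def by (rule sum.cong) (auto simp: d'_def)
  also have "(scalar_op (d' p) o\<^sub>L word v p) + comb v (F - {p}) d = (scalar_op c o\<^sub>L word v p) + comb v F d"
    using F(1) by (cases "p \<in> F")
      (simp_all add: comb_def d'_def sum.remove[of F p] scalar_op_add compose_bilinear algebra_simps)
  finally show ?case using F by (intro exI[of _ "insert p F"] exI[of _ d']) simp
qed

lemma words_span_closed:
  assumes sp: "spin_system a v"
  shows "id_blinfun \<in> words_span v"
    and "S \<in> words_span v \<Longrightarrow> T \<in> words_span v \<Longrightarrow> S + T \<in> words_span v"
    and "T \<in> words_span v \<Longrightarrow> scalar_op c o\<^sub>L T \<in> words_span v"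
    and "T \<in> words_span v \<Longrightarrow> v i o\<^sub>L T \<in> words_span v"
proof -
  show "id_blinfun \<in> words_span v"
    using words_span.add[OF words_span.zero, of 1 v 0] by (simp add: compose_bilinear)
  show "S \<in> words_span v \<Longrightarrow> T \<in> words_span v \<Longrightarrow> S + T \<in> words_span v"
    by (induction rule: words_span.induct) (auto intro: words_span.add simp: add.assoc)
  show "T \<in> words_span v \<Longrightarrow> scalar_op c o\<^sub>L T \<in> words_span v"
  proof (induction rule: words_span.induct)
    case (add T d p)
    have "scalar_op c o\<^sub>L ((scalar_op d o\<^sub>L word v p) + T) = (scalar_op (c * d) o\<^sub>L word v p) + (scalar_op c o\<^sub>L T)"
      by (simp add: compose_bilinear blinfun_compose_assoc[symmetric] scalar_op_mult)
    then show ?case using words_span.add[OF add.IH] by simp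
  qed (simp add: compose_bilinear words_span.zero)
  show "T \<in> words_span v \<Longrightarrow> v i o\<^sub>L T \<in> words_span v"
  proof (induction rule: words_span.induct)
    case (add T d p)
    have "pm (v i o\<^sub>L word v p) (word v (monom 1 i + p))"
      using word_mult[OF sp, of "monom 1 i" p] by (simp add: word_monom)
    then obtain c where c: "v i o\<^sub>L word v p = scalar_op c o\<^sub>L word v (monom 1 i + p)"
      unfolding pm_def by (metis compose_id(1) scalar_op_1 scalar_op_minus
          bounded_bilinear.minus_left[OF bounded_bilinear_blinfun_compose])
    have "v i o\<^sub>L ((scalar_op d o\<^sub>L word v p) + T) = (scalar_op (d * c) o\<^sub>L word v (monom 1 i + p)) + (v i o\<^sub>L T)"
      using c scalar_op_commute[OF spin_systemD(2)[OF sp, of i], of d]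
      by (simp add: compose_bilinear) (metis blinfun_compose_assoc scalar_op_mult)
    then show ?case using words_span.add[OF add.IH] by simp
  qed (simp add: compose_bilinear words_span.zero)
qed

text \<open>Von Neumann's density theorem for the amplified algebra: the 2-norm is dominated by the norm of the
  image of one vector.\<close>

lemma (in traced_algebra) words_dense:
  assumes spin: "spin_system a v" and gen: "von_neumann_algebra hull (range v) = R"
    and T: "T \<in> R" and e: "e > 0"
  shows "\<exists>F c. finite F \<and> n2 (T - comb v F c) < e"
proof -
  have v_mem: "v i \<in> R" for i
    using gen hull_subset[of "range v" von_neumann_algebra] by auto
  have span_mem: "S \<in> R" if "S \<in> words_span v" for S
  proof -
    have "list_word w cs \<in> R" if "\<And>i. w i \<in> R" for w cs
      using that by (induction w cs rule: list_word.induct) auto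
    then have wm: "word v p \<in> R" for p by (simp add: word_def v_mem)
    show ?thesis using that by (induction rule: words_span.induct) (intro mem_zero mem_add mem_compose mem_scalar wm)+
  qed
  obtain \<zeta> :: "'h ell2" where \<zeta>: "\<And>T. T \<in> R \<Longrightarrow> n2 T \<le> norm (ell2_diag T \<zeta>)"
    using trace_dominated by blast
  have "\<exists>S\<in>words_span v. norm (ell2_diag (T - S) \<zeta>) < e"
  proof (rule amplified_density[where G = "range v"])
    show "range v \<subseteq> clinear_ops" using spin_systemD(2)[OF spin] by auto
    show "adj g \<in> range v" if "g \<in> range v" for g using that spin_systemD(3)[OF spin] by auto
    show "T \<in> von_neumann_algebra hull range v" using T gen by simp
  qed (use words_span_closed[OF spin] e in auto)
  then obtain S where S: "S \<in> words_span v" "norm (ell2_diag (T - S) \<zeta>) < e" by blast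
  have "n2 (T - S) < e" using \<zeta>[OF mem_diff[OF T span_mem[OF S(1)]]] S(2) by simp
  then show ?thesis using words_span_comb[OF S(1)] by blast
qed

text \<open>Generation is recorded by its consequence, 2-norm density of the words, which passes to the image
  of the generators under any trace-preserving automorphism.\<close>

locale spin_generated = traced_algebra R \<tau> for R :: "('h::complex_hilbert_space \<Rightarrow>\<^sub>L 'h) set" and \<tau> +
  fixes a :: "nat \<Rightarrow> bit" and v :: "nat \<Rightarrow> 'h \<Rightarrow>\<^sub>L 'h"
  assumes spin: "spin_system a v" and nondeg: "nondegenerate a"
    and v_mem [intro, simp]: "\<And>i. v i \<in> R"
    and comb_dense: "\<And>T e. T \<in> R \<Longrightarrow> e > 0 \<Longrightarrow> \<exists>F c. finite F \<and> n2 (T - comb v F c) < e"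
begin

lemma list_word_mem: "(\<And>i. w i \<in> R) \<Longrightarrow> list_word w cs \<in> R"
  by (induction w cs rule: list_word.induct) auto

lemma word_mem [intro, simp]: "word v p \<in> R"
  by (simp add: word_def list_word_mem)

lemma comb_mem [intro, simp]: "comb v F c \<in> R"
  unfolding comb_def by auto

text \<open>A non-empty word anticommutes with some generator, so its trace equals its negative.\<close>

lemma trace_word: assumes \<phi>: "tracial_state R \<phi>" and p: "p \<noteq> 0" shows "\<phi> (word v p) = 0"
proof -
  obtain i where i: "pairing a (int i) p = 1" using nondeg p by (auto simp: nondegenerate_def)
  have anti: "v i (word v p x) = - word v p (v i x)" for x
    using spin_commute_word_apply[OF spin, of i p x] i by simp
  have "\<phi> (v i o\<^sub>L (v i o\<^sub>L word v p)) = \<phi> ((v i o\<^sub>L word v p) o\<^sub>L v i)"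
    by (rule tau_commute[OF \<phi>]) auto
  also have "(v i o\<^sub>L word v p) o\<^sub>L v i = - word v p"
    by (rule blinfun_eqI) (simp add: anti spin_square_apply[OF spin] blinfun.bilinear_simps)
  also have "v i o\<^sub>L (v i o\<^sub>L word v p) = word v p"
    by (rule blinfun_eqI) (simp add: spin_square_apply[OF spin])
  finally show ?thesis by (simp add: tau_minus[OF \<phi>])
qed

definition coef :: "bit poly \<Rightarrow> ('h \<Rightarrow>\<^sub>L 'h) \<Rightarrow> complex" where
  "coef p T = \<tau> (adj (word v p) o\<^sub>L T)"

lemma coef_word: "coef p (word v q) = (if p = q then 1 else 0)"
proof (cases "p = q")
  case True then show ?thesis by (simp add: coef_def word_unitary(1)[OF spin] t_id)
next
  case False
  have "pm (adj (word v p) o\<^sub>L word v q) (word v p o\<^sub>L word v q)"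
    by (intro pm_compose pm_refl word_adj[OF spin])
  also have "pm \<dots> (word v (p + q))" by (rule word_mult[OF spin])
  finally show ?thesis
    using False trace_word[OF tracial, of "p + q"] by (auto simp: pm_def coef_def t_minus bit_poly_add_eq_0)
qed

lemma coef_add: "S \<in> R \<Longrightarrow> T \<in> R \<Longrightarrow> coef p (S + T) = coef p S + coef p T"
  by (simp add: coef_def compose_bilinear t_add mem_compose mem_adj)

lemma coef_diff: "S \<in> R \<Longrightarrow> T \<in> R \<Longrightarrow> coef p (S - T) = coef p S - coef p T"
  by (simp add: coef_def compose_bilinear t_diff mem_compose mem_adj)

lemma coef_scalar: assumes T: "T \<in> R" shows "coef p (scalar_op c o\<^sub>L T) = c * coef p T"
proof -
  have "adj (word v p) o\<^sub>L (scalar_op c o\<^sub>L T) = scalar_op c o\<^sub>L (adj (word v p) o\<^sub>L T)"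
    by (rule blinfun_eqI) (simp add: clinear_opsD adj_clinear word_clinear[OF spin])
  then show ?thesis using T by (simp add: coef_def t_scalar mem_compose mem_adj)
qed

lemma coef_sum: "(\<And>i. i \<in> F \<Longrightarrow> f i \<in> R) \<Longrightarrow> coef p (\<Sum>i\<in>F. f i) = (\<Sum>i\<in>F. coef p (f i))"
proof (induction F rule: infinite_finite_induct)
  case (insert i F)
  then show ?case by (simp add: coef_add mem_sum)
qed (simp_all add: coef_def compose_bilinear t_zero)

lemma coef_comb: "finite F \<Longrightarrow> coef p (comb v F c) = (if p \<in> F then c p else 0)"
  by (simp add: comb_def coef_sum mem_compose coef_scalar coef_word if_distrib cong: if_cong)

lemma n2_word: "n2 (word v p) = 1"
  by (simp add: n2_def word_unitary(1)[OF spin] t_id)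

lemma coef_le: "T \<in> R \<Longrightarrow> cmod (coef p T) \<le> n2 T"
  using t_Cauchy_Schwarz[of "word v p" T] by (simp add: coef_def n2_word)

lemma t_comb:
  assumes T: "T \<in> R"
  shows "\<tau> (adj T o\<^sub>L comb v F c) = (\<Sum>p\<in>F. c p * cnj (coef p T))"
proof -
  have z: "\<tau> (adj T o\<^sub>L word v p) = cnj (coef p T)" for p
  proof -
    have "adj T o\<^sub>L word v p = adj (adj (word v p) o\<^sub>L T)"
      by (simp add: adj_compose adj_clinear word_clinear[OF spin] clinear T adj_adj)
    then show ?thesis using t_adj[of "adj (word v p) o\<^sub>L T"] T by (simp add: coef_def mem_compose mem_adj)
  qed
  have "adj T o\<^sub>L comb v F c = (\<Sum>p\<in>F. scalar_op (c p) o\<^sub>L (adj T o\<^sub>L word v p))"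
    unfolding comb_def bounded_bilinear.sum_right[OF bounded_bilinear_blinfun_compose]
    by (intro sum.cong blinfun_eqI) (simp_all add: clinear_opsD adj_clinear clinear T)
  then show ?thesis using T by (simp add: t_sum mem_compose mem_adj t_scalar z)
qed

text \<open>Pythagoras: truncated expansions approximate at least as well as any other combination of the same
  words.\<close>

lemma best_approximation:
  assumes T: "T \<in> R" and F: "finite F"
  shows "n2 (T - comb v F (\<lambda>p. coef p T)) \<le> n2 (T - comb v F c)"
proof -
  define S where "S = T - comb v F (\<lambda>p. coef p T)"
  define U where "U = comb v F (\<lambda>p. coef p T - c p)"
  have S: "S \<in> R" and U: "U \<in> R" using T by (auto simp: S_def U_def)
  have "U = comb v F (\<lambda>p. coef p T) - comb v F c"
    unfolding U_def comb_def sum_subtractf[symmetric]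
    by (intro sum.cong refl blinfun_eqI)
      (simp add: blinfun.diff_left scaleC_add_left[of _ "- _", simplified])
  then have e: "T - comb v F c = S + U" by (simp add: S_def)
  have "\<tau> (adj S o\<^sub>L U) = 0"
    unfolding U_def t_comb[OF S] using T F by (intro sum.neutral) (simp add: S_def coef_diff coef_comb)
  moreover from this have "\<tau> (adj U o\<^sub>L S) = 0"
    using t_adj[of "adj S o\<^sub>L U"] S U by (simp add: mem_compose mem_adj adj_compose adj_clinear clinear adj_adj)
  moreover have "adj (S + U) o\<^sub>L (S + U) = (adj S o\<^sub>L S) + (adj S o\<^sub>L U) + ((adj U o\<^sub>L S) + (adj U o\<^sub>L U))"
    using S U by (simp add: adj_add clinear compose_bilinear algebra_simps)
  ultimately have "complex_of_real ((n2 (S + U))\<^sup>2) = of_real ((n2 S)\<^sup>2 + (n2 U)\<^sup>2)"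
    using n2_sq[OF mem_add[OF S U]] n2_sq[OF S] n2_sq[OF U] S U
    by (simp add: t_add mem_compose mem_adj mem_add)
  then have "(n2 (S + U))\<^sup>2 = (n2 S)\<^sup>2 + (n2 U)\<^sup>2" by (simp only: of_real_eq_iff)
  then have "(n2 S)\<^sup>2 \<le> (n2 (S + U))\<^sup>2" by simp
  then show ?thesis unfolding e S_def[symmetric] using n2_nonneg[OF mem_add[OF S U]] by (rule power2_le_imp_le)
qed

text \<open>Completeness: if all coefficients vanish, no combination of words approximates better than \<open>0\<close>.\<close>

lemma coef_eq_0D:
  assumes T: "T \<in> R" and z: "\<And>p. coef p T = 0"
  shows "T = 0"
proof (rule n2_eq_0[OF T], rule ccontr)
  assume "n2 T \<noteq> 0"
  then have pos: "n2 T > 0" using n2_nonneg[OF T] by simp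
  then obtain F c where F: "finite F" "n2 (T - comb v F c) < n2 T" using comb_dense[OF T] by blast
  moreover have "comb v F (\<lambda>p. coef p T) = 0" by (simp add: comb_def z compose_bilinear)
  ultimately show False using best_approximation[OF T F(1), of c] by simp
qed

text \<open>Conjugating by a generator and averaging with the sign that fixes the word of \<open>q\<close> annihilates
  every word on which that generator acts with the other sign.\<close>

definition project_sign :: "bit poly \<Rightarrow> nat \<Rightarrow> ('h \<Rightarrow>\<^sub>L 'h) \<Rightarrow> 'h \<Rightarrow>\<^sub>L 'h" where
  "project_sign q i T = (1/2) *\<^sub>R (T + sg (pairing a (int i) q) *\<^sub>R (v i o\<^sub>L (T o\<^sub>L v i)))"

lemma project_sign_word:
  "project_sign q i (word v p) = (if pairing a (int i) p = pairing a (int i) q then word v p else 0)"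
proof -
  have "v i o\<^sub>L (word v p o\<^sub>L v i) = sg (pairing a (int i) p) *\<^sub>R word v p"
    by (rule blinfun_eqI)
      (simp add: spin_commute_word_apply[OF spin] spin_square_apply[OF spin] blinfun.scaleR_left)
  then show ?thesis
    by (cases "pairing a (int i) p"; cases "pairing a (int i) q")
      (auto simp: project_sign_def scaleR_2[symmetric])
qed

lemma project_sign_mem [intro]: "T \<in> R \<Longrightarrow> project_sign q i T \<in> R"
  unfolding project_sign_def by (intro mem_scaleR mem_add mem_compose v_mem)

lemma project_sign_add: "project_sign q i (S + T) = project_sign q i S + project_sign q i T"
  by (rule blinfun_eqI) (simp add: project_sign_def blinfun.bilinear_simps algebra_simps)

lemma project_sign_scalar: "project_sign q i (scalar_op c o\<^sub>L T) = scalar_op c o\<^sub>L project_sign q i T"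
  by (rule blinfun_eqI)
    (simp add: project_sign_def blinfun.bilinear_simps scaleC_add_right scaleC_scaleR
      clinear_opsD[OF spin_systemD(2)[OF spin]])

lemma project_sign_diff: "project_sign q i (S - T) = project_sign q i S - project_sign q i T"
  by (rule blinfun_eqI) (simp add: project_sign_def blinfun.bilinear_simps algebra_simps)

lemma project_sign_n2: assumes T: "T \<in> R" shows "n2 (project_sign q i T) \<le> n2 T"
proof -
  have "n2 (v i o\<^sub>L (T o\<^sub>L v i)) \<le> norm (v i) * n2 (T o\<^sub>L v i)" using T by (intro n2_compose_left) auto
  also have "\<dots> \<le> 1 * (n2 T * norm (v i))"
    using T spin_norm_le[OF spin, of i] by (intro mult_mono n2_compose_right n2_nonneg) auto
  also have "\<dots> \<le> 1 * (n2 T * 1)"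
    using T spin_norm_le[OF spin, of i] by (intro mult_left_mono n2_nonneg) auto
  finally have le: "n2 (v i o\<^sub>L (T o\<^sub>L v i)) \<le> n2 T" by simp
  have "n2 (project_sign q i T) = (1/2) * n2 (T + sg (pairing a (int i) q) *\<^sub>R (v i o\<^sub>L (T o\<^sub>L v i)))"
    using T by (simp add: project_sign_def n2_scaleR mem_add mem_scaleR mem_compose)
  also have "\<dots> \<le> (1/2) * (n2 T + n2 T)"
    using n2_add[of T "sg (pairing a (int i) q) *\<^sub>R (v i o\<^sub>L (T o\<^sub>L v i))"] T le
    by (simp add: n2_scaleR mem_add mem_scaleR mem_compose)
  finally show ?thesis by simp
qed

text \<open>If the signs under conjugation by the \<open>v\<^sub>i\<close>, \<open>i \<in> I\<close>, separate \<open>q\<close> from all other words that occur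
  in \<open>T\<close>, finitely many averagings remove the other words of a good approximation of \<open>T\<close>; averaging
  does not increase the error.\<close>

lemma extract_word:
  assumes T: "T \<in> R" and I: "\<And>p. coef p T \<noteq> 0 \<Longrightarrow> p \<noteq> q \<Longrightarrow> \<exists>i\<in>I. pairing a (int i) p \<noteq> pairing a (int i) q"
    and W: "W \<subseteq> R" "T \<in> W" "\<And>i S. i \<in> I \<Longrightarrow> S \<in> W \<Longrightarrow> project_sign q i S \<in> W"
    and e: "e > 0"
  shows "\<exists>S\<in>W. n2 (S - (scalar_op (coef q T) o\<^sub>L word v q)) < e"
proof -
  obtain F0 c0 where F0: "finite F0" "n2 (T - comb v F0 c0) < e" using comb_dense[OF T e] by blast
  define F where "F = {p \<in> insert q F0. coef p T \<noteq> 0 \<or> p = q}"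
  let ?c = "\<lambda>p. coef p T"
  have fF: "finite F" using F0 by (simp add: F_def)
  have "comb v F ?c = comb v (insert q F0) ?c"
    unfolding comb_def F_def using F0(1) by (intro sum.mono_neutral_left) (auto simp: compose_bilinear)
  moreover have "comb v F0 c0 = comb v (insert q F0) (\<lambda>p. if p \<in> F0 then c0 p else 0)"
    unfolding comb_def using F0(1) by (intro sum.mono_neutral_cong_left) (auto simp: compose_bilinear)
  ultimately have est: "n2 (T - comb v F ?c) < e"
    using best_approximation[OF T, of "insert q F0" "\<lambda>p. if p \<in> F0 then c0 p else 0"] F0 by simp
  \<comment> \<open>Remove the words of \<open>E\<close> one by one; each averaging may also remove words outside \<open>E\<close>.\<close>
  have "\<exists>S\<in>W. \<exists>G. G \<subseteq> F - E \<and> q \<in> G \<and> n2 (S - comb v G ?c) < e"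
    if "finite E" "E \<subseteq> F - {q}" for E
    using that
  proof (induction E rule: finite_induct)
    case empty
    then show ?case using W(2) est by (intro bexI[of _ T] exI[of _ F]) (auto simp: F_def)
  next
    case (insert p E)
    then obtain S G where S: "S \<in> W" "G \<subseteq> F - E" "q \<in> G" "n2 (S - comb v G ?c) < e" by auto
    obtain i where i: "i \<in> I" "pairing a (int i) p \<noteq> pairing a (int i) q"
      using I[of p] insert.prems by (auto simp: F_def)
    define G' where "G' = {p \<in> G. pairing a (int i) p = pairing a (int i) q}"
    have fG: "finite G" using S(2) fF finite_subset by blast
    have "project_sign q i (comb v G ?c) = (\<Sum>p\<in>G. scalar_op (?c p) o\<^sub>L project_sign q i (word v p))"
      unfolding comb_def using fG
    proof (induction G rule: finite_induct)
      case empty show ?case by (simp add: project_sign_def compose_bilinear)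
    qed (simp add: project_sign_add project_sign_scalar)
    also have "\<dots> = comb v G' ?c"
      unfolding comb_def G'_def using fG
      by (intro sum.mono_neutral_cong_right) (auto simp: project_sign_word compose_bilinear)
    finally have "project_sign q i S - comb v G' ?c = project_sign q i (S - comb v G ?c)"
      by (simp add: project_sign_diff)
    then have "n2 (project_sign q i S - comb v G' ?c) < e"
      using project_sign_n2[of "S - comb v G ?c" q i] S W(1) by (auto simp: mem_diff)
    moreover have "project_sign q i S \<in> W" using W(3) S(1) i(1) by blast
    moreover have "G' \<subseteq> F - insert p E" "q \<in> G'" using S i by (auto simp: G'_def)
    ultimately show ?case by blast
  qed
  from this[of "F - {q}"] fF obtain S G where S: "S \<in> W" "G \<subseteq> F - (F - {q})" "q \<in> G" "n2 (S - comb v G ?c) < e"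
    by auto
  have "G = {q}" using S(2,3) by auto
  then show ?thesis using S by (auto simp: comb_def)
qed

end

section \<open>Polar decomposition\<close>

lemma blinfun_compose_eqD: "S o\<^sub>L T = U \<Longrightarrow> blinfun_apply S (blinfun_apply T x) = blinfun_apply U x"
  by (metis blinfun_apply_blinfun_compose)

context vN_algebra
begin

lemma strong_limit:
  assumes T: "\<And>n. T n \<in> R" and b: "\<And>n x. norm (T n x) \<le> C * norm x"
    and C: "\<And>x. Cauchy (\<lambda>n. blinfun_apply (T n) x)"
  obtains S where "S \<in> R" "\<And>x. (\<lambda>n. blinfun_apply (T n) x) \<longlonglongrightarrow> blinfun_apply S x"
proof -
  have "\<exists>y. (\<lambda>n. blinfun_apply (T n) x) \<longlonglongrightarrow> y" for x
    using C[of x] by (simp add: Cauchy_convergent_iff convergent_def)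
  then obtain L where L: "\<And>x. (\<lambda>n. blinfun_apply (T n) x) \<longlonglongrightarrow> L x" by metis
  have bl: "bounded_linear L"
  proof (rule bounded_linear_intro[of _ C])
    fix x y and r :: real
    have "(\<lambda>n. T n x + T n y) \<longlonglongrightarrow> L x + L y" by (intro tendsto_intros L)
    then show "L (x + y) = L x + L y"
      using L[of "x + y"] LIMSEQ_unique by (auto simp: blinfun.add_right)
    have "(\<lambda>n. r *\<^sub>R T n x) \<longlonglongrightarrow> r *\<^sub>R L x" by (intro tendsto_intros L)
    then show "L (r *\<^sub>R x) = r *\<^sub>R L x"
      using L[of "r *\<^sub>R x"] LIMSEQ_unique by (auto simp: blinfun.scaleR_right)
    show "norm (L x) \<le> norm x * C"
      by (rule LIMSEQ_le_const2[OF tendsto_norm[OF L]]) (use b in \<open>auto simp: mult.commute\<close>)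
  qed
  have lim: "(\<lambda>n. blinfun_apply (T n) x) \<longlonglongrightarrow> blinfun_apply (Blinfun L) x" for x
    using L by (simp add: bounded_linear_Blinfun_apply[OF bl])
  show ?thesis using that[OF mem_limit[OF T lim] lim] .
qed

text \<open>Polar decomposition.  With \<open>A = 1 - |x|\<close>, the averages of the powers of \<open>A\<close> converge strongly to
  the projection onto the kernel of \<open>x\<close> (mean ergodic theorem).  They have the form \<open>1 - |x| B\<^sub>n\<close>, and
  \<open>x B\<^sub>n\<close> converges to the partial isometry.\<close>

lemma polar_decomposition:
  assumes x: "x \<in> R" and x1: "norm x \<le> 1"
  obtains w Q where "w \<in> R" "Q \<in> R" "adj Q = Q" "norm (id_blinfun - Q) \<le> 1" "Q o\<^sub>L Q = adj x o\<^sub>L x"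
    "w o\<^sub>L Q = x" "w o\<^sub>L (adj w o\<^sub>L w) = w"
    "\<And>f. f o\<^sub>L x = x \<Longrightarrow> f o\<^sub>L w = w" "\<And>e. x o\<^sub>L e = x \<Longrightarrow> w o\<^sub>L e = w"
    "adj x = x \<Longrightarrow> adj w = w" "adj x = x \<Longrightarrow> w o\<^sub>L Q = Q o\<^sub>L w"
proof -
  note cx = clinear[OF x]
  define X where "X = adj x o\<^sub>L x"
  have X: "X \<in> R" "adj X = X" using x by (auto simp: X_def adj_compose adj_clinear cx adj_adj)
  have "norm (id_blinfun - X) \<le> 1"
  proof (rule norm_blinfun_bound)
    fix u
    have "(norm ((id_blinfun - X) u))\<^sup>2 = (norm u)\<^sup>2 - 2 * (norm (x u))\<^sup>2 + (norm (adj x (x u)))\<^sup>2"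
      by (simp add: X_def blinfun.diff_left norm_diff_sq cinner_adj_right[OF cx] Re_cinner_self)
    also have "norm (adj x (x u)) \<le> norm (x u)"
      using norm_blinfun[of "adj x" "x u"] norm_adj_le[OF cx] x1 
      by (meson dual_order.trans mult_left_le_one_le norm_ge_zero)
    then have "(norm (adj x (x u)))\<^sup>2 \<le> (norm (x u))\<^sup>2" by (rule power_mono) simp
    then have "(norm u)\<^sup>2 - 2 * (norm (x u))\<^sup>2 + (norm (adj x (x u)))\<^sup>2 \<le> (norm u)\<^sup>2 - (norm (x u))\<^sup>2" by linarith
    also have "\<dots> \<le> (1 * norm u)\<^sup>2" by simp
    finally show "norm ((id_blinfun - X) u) \<le> 1 * norm u" by (rule power2_le_imp_le) simp
  qed simp
  from square_root[OF X this] obtain Q where Q: "Q \<in> R" "adj Q = Q" "norm (id_blinfun - Q) \<le> 1"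
    "Q o\<^sub>L Q = X" and Qc: "\<And>Z. Z o\<^sub>L X = X o\<^sub>L Z \<Longrightarrow> Z o\<^sub>L Q = Q o\<^sub>L Z" by blast
  \<comment> \<open>\<open>Q = |x|\<close>, and \<open>t k\<close> is the \<open>k\<close>-th power of \<open>1 - Q\<close>, written as \<open>1 - Q s\<^sub>k\<close>.\<close>
  have nQ: "norm (Q u) = norm (x u)" for u
  proof -
    have "(norm (Q u))\<^sup>2 = (norm (x u))\<^sup>2"
      using norm_adj_apply_sq[OF clinear[OF Q(1)], of u] norm_adj_apply_sq[OF cx, of u]
        blinfun_compose_eqD[OF Q(4), of u] Q(2) by (simp add: X_def)
    then show ?thesis by simp
  qed
  define s :: "nat \<Rightarrow> 'h \<Rightarrow>\<^sub>L 'h" where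
    "s = rec_nat 0 (\<lambda>_ Z. id_blinfun + ((id_blinfun - Q) o\<^sub>L Z))"
  have s0: "s 0 = 0" and sS: "\<And>k. s (Suc k) = id_blinfun + ((id_blinfun - Q) o\<^sub>L s k)" by (simp_all add: s_def)
  define t where "t k = id_blinfun - (Q o\<^sub>L s k)" for k
  have comm: "Z (s k u) = s k (Z u)" if "Z o\<^sub>L Q = Q o\<^sub>L Z" for Z k u
  proof (induction k arbitrary: u)
    case (Suc k)
    have "Z (Q y) = Q (Z y)" for y using that by (metis blinfun_apply_blinfun_compose)
    then show ?case by (simp add: sS blinfun.bilinear_simps Suc)
  qed (simp add: s0)
  have Qs: "Q (s k u) = s k (Q u)" for k u by (rule comm) simp
  have sR: "s k \<in> R" "adj (s k) = s k" for k
  proof -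
    have "s k \<in> R \<and> adj (s k) = s k"
    proof (induction k)
      case (Suc k)
      have "(id_blinfun - Q) o\<^sub>L s k = s k o\<^sub>L (id_blinfun - Q)"
        by (rule blinfun_eqI) (simp add: blinfun.bilinear_simps Qs)
      then show ?case using Suc Q(1,2) clinear
        by (auto simp: sS adj_add adj_diff adj_compose clinear_ops_intros)
    qed (simp add: s0)
    then show "s k \<in> R" "adj (s k) = s k" by auto
  qed
  have tS: "t (Suc k) u = t k u - Q (t k u)" for k u
    by (simp add: t_def sS blinfun.bilinear_simps)
  have nt: "norm (t k u) \<le> norm u" for k u
  proof (induction k)
    case 0 show ?case by (simp add: t_def s0 blinfun.bilinear_simps)
  next
    case (Suc k)
    have "norm (t (Suc k) u) = norm ((id_blinfun - Q) (t k u))" by (simp add: tS blinfun.diff_left)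
    also have "\<dots> \<le> norm (id_blinfun - Q) * norm (t k u)" by (rule norm_blinfun)
    also have "\<dots> \<le> 1 * norm (t k u)" by (intro mult_right_mono Q) simp
    finally show ?case using Suc by simp
  qed
  define M where "M n = (1 / real (Suc n)) *\<^sub>R (\<Sum>k\<le>n. t k)" for n
  define B where "B n = (1 / real (Suc n)) *\<^sub>R (\<Sum>k\<le>n. s k)" for n
  have B: "B n \<in> R" "adj (B n) = B n" for n
  proof -
    have "(\<Sum>k\<le>m. s k) \<in> R \<and> adj (\<Sum>k\<le>m. s k) = (\<Sum>k\<le>m. s k)" for m
      by (induction m) (use sR clinear in \<open>auto simp: adj_add\<close>)
    then show "B n \<in> R" "adj (B n) = B n" by (auto simp: B_def adj_scaleR clinear)
  qed
  have Mapp: "M n u = (1 / real (Suc n)) *\<^sub>R (\<Sum>k\<le>n. t k u)" for n u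
    by (simp add: M_def blinfun.scaleR_left blinfun.sum_left)
  have Bapp: "B n u = (1 / real (Suc n)) *\<^sub>R (\<Sum>k\<le>n. s k u)" for n u
    by (simp add: B_def blinfun.scaleR_left blinfun.sum_left)
  have QB: "Q (B n u) = u - M n u" for n u
  proof -
    have "(\<Sum>k\<le>n. t k u) = real (Suc n) *\<^sub>R u - Q (\<Sum>k\<le>n. s k u)"
      by (simp add: t_def blinfun.bilinear_simps sum_subtractf blinfun.sum_right sum_constant_scaleR del: of_nat_Suc)
    then show ?thesis
      by (simp add: Mapp Bapp blinfun.scaleR_right scaleR_diff_right del: of_nat_Suc)
  qed
  have nM: "norm (M n u) \<le> norm u" for n u
  proof -
    have "norm (\<Sum>k\<le>n. t k u) \<le> (\<Sum>k\<le>n. norm u)" by (rule sum_norm_le) (rule nt)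
    then have "norm (\<Sum>k\<le>n. t k u) \<le> real (Suc n) * norm u" by simp
    then show ?thesis by (simp add: Mapp divide_le_eq mult.commute del: of_nat_Suc)
  qed
  \<comment> \<open>On the range of \<open>Q\<close> the averages tend to zero, since the sum telescopes; on its orthogonal
    complement, the kernel of \<open>Q\<close>, they are the identity.\<close>
  have MQ: "norm (M n (Q u)) \<le> 2 * norm u * inverse (real (Suc n))" for n u
  proof -
    have tQ: "t k (Q u) = t k u - t (Suc k) u" for k
      by (simp add: tS) (simp add: t_def blinfun.bilinear_simps Qs)
    have tele: "(\<Sum>k\<le>n. t k (Q u)) = t 0 u - t (Suc n) u"
      unfolding tQ by (induction n) simp_all
    have "norm (\<Sum>k\<le>n. t k (Q u)) \<le> norm u + norm u"
      unfolding tele using norm_triangle_ineq4[of "t 0 u" "t (Suc n) u"] nt[of 0 u] nt[of "Suc n" u] by linarith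
    then show ?thesis by (simp add: Mapp divide_simps del: of_nat_Suc)
  qed
  define K where "K = closure (range Q)"
  have "csubspace (range Q)"
    unfolding csubspace_def
  proof (intro conjI ballI allI)
    show "0 \<in> range Q" using blinfun.zero_right[of Q] by (metis rangeI)
    show "y + z \<in> range Q" if "y \<in> range Q" "z \<in> range Q" for y z
      using that by (auto simp: blinfun.add_right[symmetric])
    show "c *\<^sub>C y \<in> range Q" if "y \<in> range Q" for c y
      using that by (auto simp: clinear_opsD[OF clinear[OF Q(1)], symmetric])
  qed
  then have "csubspace K" "closed K" by (auto simp: K_def intro: csubspace_closure)
  then obtain P :: "'h \<Rightarrow>\<^sub>L 'h" where P: "\<And>u. P u \<in> K" "\<And>u z. z \<in> K \<Longrightarrow> cinner (u - P u) z = 0"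
    "\<And>u. u \<in> K \<Longrightarrow> P u = u" "\<And>c u. P (c *\<^sub>C u) = c *\<^sub>C P u"
    by (rule orthogonal_projection) blast
  have Pc: "P \<in> clinear_ops" by (simp add: clinear_ops_def P)
  have PP: "P (P u) = P u" for u by (rule P(3)) (rule P(1))
  have Pa: "adj P = P"
  proof (rule adj_eqI)
    fix u z
    have "cinner (P u) (z - P z) = 0" using P(2)[OF P(1)[of u], of z] by (metis cinner_commute complex_cnj_zero)
    moreover have "cinner (u - P u) (P z) = 0" using P(1,2) by blast
    ultimately show "cinner (P u) z = cinner u (P z)" by (simp add: cinner_simps)
  qed
  have QP: "Q (u - P u) = 0" for u
  proof (rule cinner_eq_zeroD)
    fix y
    have "Q y \<in> K" unfolding K_def by (meson closure_subset rangeI subsetD)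
    then show "cinner (Q (u - P u)) y = 0"
      using P(2) cinner_adj_right[OF clinear[OF Q(1)]] Q(2) by metis
  qed
  have Mker: "M n u = u" if "Q u = 0" for n u
  proof -
    have "t k u = u" for k
      by (induction k) (simp_all add: tS that, simp add: t_def s0 blinfun.bilinear_simps)
    then show ?thesis by (simp add: Mapp sum_constant_scaleR del: of_nat_Suc sum_constant)
  qed
  have MK: "(\<lambda>n. M n z) \<longlonglongrightarrow> 0" if z: "z \<in> K" for z
  proof (rule metric_LIMSEQ_I)
    fix e :: real assume e: "e > 0"
    have "\<exists>y\<in>range Q. dist y z < e/2" using z e unfolding K_def closure_approachable by (meson half_gt_zero)
    then obtain u where u: "dist (Q u) z < e/2" by auto
    have "(\<lambda>n. 2 * norm u * inverse (real (Suc n))) \<longlonglongrightarrow> 2 * norm u * 0"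
      by (intro tendsto_intros LIMSEQ_inverse_real_of_nat)
    then have "\<forall>\<^sub>F n in sequentially. 2 * norm u * inverse (real (Suc n)) < e/2"
      by (rule order_tendstoD(2)) (use e in simp)
    then obtain N where N: "\<And>n. n \<ge> N \<Longrightarrow> 2 * norm u * inverse (real (Suc n)) < e/2"
      by (auto simp: eventually_sequentially)
    have "dist (M n z) 0 < e" if "n \<ge> N" for n
    proof -
      have "norm (M n z) \<le> norm (M n (Q u)) + norm (M n (z - Q u))"
        using norm_triangle_ineq[of "M n (Q u)" "M n (z - Q u)"] by (simp add: blinfun.add_right[symmetric])
      also have "\<dots> < e/2 + e/2"
        using MQ[of n u] N[OF that] nM[of n "z - Q u"] u
        by (intro add_strict_mono) (auto simp: dist_norm norm_minus_commute)
      finally show ?thesis by simp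
    qed
    then show "\<exists>no. \<forall>n\<ge>no. dist (M n z) 0 < e" by blast
  qed
  have Mlim: "(\<lambda>n. M n u) \<longlonglongrightarrow> u - P u" for u
  proof -
    have "M n u = (u - P u) + M n (P u)" for n
      using Mker[OF QP, of n u] by (simp add: blinfun.diff_right algebra_simps)
    moreover have "(\<lambda>n. (u - P u) + M n (P u)) \<longlonglongrightarrow> (u - P u) + 0"
      by (intro tendsto_intros MK P)
    ultimately show ?thesis by simp
  qed
  have nxB: "norm (x (B n u)) = norm (u - M n u)" for n u
    by (simp add: nQ[symmetric] QB)
  obtain w where w: "w \<in> R" and wlim: "\<And>u. (\<lambda>n. (x o\<^sub>L B n) u) \<longlonglongrightarrow> w u"
  proof (rule strong_limit[where T = "\<lambda>n. x o\<^sub>L B n" and C = 2])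
    show "x o\<^sub>L B n \<in> R" for n using x B by auto
    show "norm ((x o\<^sub>L B n) u) \<le> 2 * norm u" for n u
      using norm_triangle_ineq4[of u "M n u"] nM[of n u] by (simp add: nxB)
    have d: "dist (x (B n u)) (x (B m u)) = dist (M n u) (M m u)" for n m u
      by (simp add: dist_norm blinfun.diff_right[symmetric] nQ[symmetric])
        (simp add: blinfun.diff_right QB norm_minus_commute)
    show "Cauchy (\<lambda>n. (x o\<^sub>L B n) u)" for u
      using LIMSEQ_imp_Cauchy[OF Mlim[of u]] by (simp add: Cauchy_def d)
  qed blast
  have nw: "norm (w u) = norm (P u)" for u
  proof -
    have "(\<lambda>n. norm (u - M n u)) \<longlonglongrightarrow> norm (u - (u - P u))" by (intro tendsto_intros Mlim)
    then show ?thesis using LIMSEQ_unique[OF tendsto_norm[OF wlim[of u]]] by (simp add: nxB)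
  qed
  have Pker: "P u = 0" if "Q u = 0" for u
  proof -
    have "(\<lambda>n. M n u) \<longlonglongrightarrow> u" by (simp add: Mker[OF that])
    then have "u = u - P u" using LIMSEQ_unique Mlim by blast
    then show ?thesis by (metis add_diff_cancel_left' diff_add_cancel diff_self)
  qed
  have ww: "adj w o\<^sub>L w = P"
  proof -
    have cw: "w \<in> clinear_ops" using w clinear by blast
    have "norm ((adj w o\<^sub>L w) - P) \<le> 0"
    proof (rule norm_selfadjoint_le)
      show "(adj w o\<^sub>L w) - P \<in> clinear_ops" using cw Pc adj_clinear[OF cw] by (simp add: clinear_ops_intros)
      show "adj ((adj w o\<^sub>L w) - P) = (adj w o\<^sub>L w) - P"
        using cw Pc adj_clinear[OF cw] by (simp add: clinear_ops_intros adj_diff adj_compose adj_adj Pa)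
      fix u
      have "Re (cinner (P u) u) = Re (cinner (P (P u)) u)" by (simp add: PP)
      also have "\<dots> = (norm (P u))\<^sup>2" using norm_adj_apply_sq[OF Pc, of u] Pa by simp
      finally show "\<bar>Re (cinner (((adj w o\<^sub>L w) - P) u) u)\<bar> \<le> 0 * (norm u)\<^sup>2"
        using norm_adj_apply_sq[OF cw, of u] by (simp add: blinfun.diff_left cinner_simps nw)
    qed simp
    then show ?thesis by simp
  qed
  have wP: "w (P u) = w u" for u
  proof -
    have "norm (w (P u) - w u) = 0"
      unfolding blinfun.diff_right[symmetric] nw by (simp add: blinfun.diff_right PP)
    then show ?thesis by simp
  qed
  show ?thesis
  proof (rule that[OF w Q(1,2,3)])
    show "Q o\<^sub>L Q = adj x o\<^sub>L x" using Q(4) by (simp add: X_def)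
    show "w o\<^sub>L Q = x"
    proof (rule blinfun_eqI)
      fix u
      have "B n (Q u) = Q (B n u)" for n
        by (simp add: Bapp blinfun.scaleR_right blinfun.sum_right Qs)
      then have "(\<lambda>n. x (u - M n u)) \<longlonglongrightarrow> w (Q u)" using wlim[of "Q u"] by (simp add: QB)
      moreover have "(\<lambda>n. x (u - M n u)) \<longlonglongrightarrow> x (u - (u - P u))"
        by (intro blinfun.tendsto tendsto_intros Mlim)
      ultimately have "w (Q u) = x (P u)" using LIMSEQ_unique by fastforce
      moreover have "norm (x (u - P u)) = 0" using nQ[of "u - P u"] QP by simp
      ultimately show "(w o\<^sub>L Q) u = x u" by (simp add: blinfun.diff_right)
    qed
    show "w o\<^sub>L (adj w o\<^sub>L w) = w" unfolding ww by (rule blinfun_eqI) (simp add: wP)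
    show "f o\<^sub>L w = w" if f: "f o\<^sub>L x = x" for f
    proof (rule blinfun_eqI)
      fix u
      have "(\<lambda>n. f ((x o\<^sub>L B n) u)) \<longlonglongrightarrow> f (w u)" by (intro blinfun.tendsto tendsto_const wlim)
      then have "(\<lambda>n. (x o\<^sub>L B n) u) \<longlonglongrightarrow> f (w u)" using blinfun_compose_eqD[OF f] by simp
      then show "(f o\<^sub>L w) u = w u" using wlim[of u] LIMSEQ_unique by auto
    qed
    show "w o\<^sub>L e = w" if e: "x o\<^sub>L e = x" for e
    proof (rule blinfun_eqI)
      fix u
      have "x (u - e u) = 0" using blinfun_compose_eqD[OF e, of u] by (simp add: blinfun.diff_right)
      then have "norm (Q (u - e u)) = 0" unfolding nQ by simp
      then have "norm (w (u - e u)) = 0" using Pker by (simp add: nw)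
      then show "(w o\<^sub>L e) u = w u" by (simp add: blinfun.diff_right)
    qed
    assume sa: "adj x = x"
    have "x o\<^sub>L Q = Q o\<^sub>L x" by (rule Qc) (simp add: X_def sa blinfun_compose_assoc)
    then have xB: "x (B n u) = B n (x u)" and xQ: "x (Q u) = Q (x u)" for n u
      by (simp_all add: Bapp blinfun.scaleR_right blinfun.sum_right comm) (metis blinfun_apply_blinfun_compose)
    show "adj w = w"
    proof (rule adj_eqI)
      fix u z
      have "(\<lambda>n. cinner ((x o\<^sub>L B n) u) z) \<longlonglongrightarrow> cinner (w u) z"
        by (intro tendsto_cinner wlim tendsto_const)
      moreover have "(\<lambda>n. cinner u ((x o\<^sub>L B n) z)) \<longlonglongrightarrow> cinner u (w z)"
        by (intro tendsto_cinner wlim tendsto_const)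
      moreover have "cinner ((x o\<^sub>L B n) u) z = cinner u ((x o\<^sub>L B n) z)" for n
      proof -
        have "cinner (x (B n u)) z = cinner (B n u) (x z)" using cinner_adj_left[OF cx] sa by metis
        also have "\<dots> = cinner u (B n (x z))" using cinner_adj_left[OF clinear[OF B(1)]] B(2) by metis
        finally show ?thesis by (simp add: xB)
      qed
      ultimately show "cinner (w u) z = cinner u (w z)" using LIMSEQ_unique by auto
    qed
    show "w o\<^sub>L Q = Q o\<^sub>L w"
    proof (rule blinfun_eqI)
      fix u
      have "(\<lambda>n. Q ((x o\<^sub>L B n) u)) \<longlonglongrightarrow> Q (w u)" by (intro blinfun.tendsto tendsto_const wlim)
      moreover have "Q ((x o\<^sub>L B n) u) = (x o\<^sub>L B n) (Q u)" for n
        by (simp add: xQ[symmetric] Bapp blinfun.scaleR_right blinfun.sum_right Qs)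
      ultimately have "(\<lambda>n. (x o\<^sub>L B n) (Q u)) \<longlonglongrightarrow> Q (w u)" by simp
      then show "(w o\<^sub>L Q) u = (Q o\<^sub>L w) u" using wlim[of "Q u"] LIMSEQ_unique by auto
    qed
  qed
qed

end

section \<open>Comparison of projections\<close>

context vN_algebra
begin

definition projection :: "('h \<Rightarrow>\<^sub>L 'h) \<Rightarrow> bool" where
  "projection e \<longleftrightarrow> e \<in> R \<and> adj e = e \<and> e o\<^sub>L e = e"

text \<open>Partial isometries that map a subspace of the range of \<open>e\<close> onto a subspace of the range of \<open>f\<close>.\<close>

definition partial_isometries :: "('h \<Rightarrow>\<^sub>L 'h) \<Rightarrow> ('h \<Rightarrow>\<^sub>L 'h) \<Rightarrow> ('h \<Rightarrow>\<^sub>L 'h) set" where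
  "partial_isometries e f = {d \<in> R. d o\<^sub>L (adj d o\<^sub>L d) = d \<and> d o\<^sub>L e = d \<and> f o\<^sub>L d = d}"

lemma projectionD:
  assumes "projection e"
  shows "e \<in> R" "adj e = e" "e (e x) = e x"
  using assms by (auto simp: projection_def dest: blinfun_compose_eqD)

lemma projection_norm: assumes e: "projection e" shows "norm (e x) \<le> norm x"
proof -
  have "(norm x)\<^sup>2 = (norm (e x + (x - e x)))\<^sup>2" by simp
  also have "\<dots> = (norm (e x))\<^sup>2 + (norm (x - e x))\<^sup>2"
    unfolding norm_add_sq using cinner_adj_right[OF clinear[OF projectionD(1)[OF e]], of x "x - e x"]
    by (simp add: projectionD[OF e] blinfun.diff_right cinner_adj_left[OF clinear[OF projectionD(1)[OF e]], symmetric])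
  finally have "(norm (e x))\<^sup>2 \<le> (norm x)\<^sup>2" by simp
  then show ?thesis by (rule power2_le_imp_le) simp
qed

lemma partial_isometriesD:
  assumes d: "d \<in> partial_isometries e f" and e: "projection e" and f: "projection f"
  shows "d \<in> R" "d (adj d (d x)) = d x" "d (e x) = d x" "f (d x) = d x"
    "adj d (d (adj d x)) = adj d x" "e (adj d x) = adj d x" "adj d (f x) = adj d x"
    "projection (adj d o\<^sub>L d)" "projection (d o\<^sub>L adj d)"
proof -
  have dR: "d \<in> R" and eq: "d o\<^sub>L (adj d o\<^sub>L d) = d" "d o\<^sub>L e = d" "f o\<^sub>L d = d"
    using d by (auto simp: partial_isometries_def)
  note c = clinear[OF dR] adj_clinear[OF clinear[OF dR]] clinear[OF projectionD(1)[OF e]] clinear[OF projectionD(1)[OF f]]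
  show "d \<in> R" by (rule dR)
  show 1: "d (adj d (d x)) = d x" for x using blinfun_compose_eqD[OF eq(1), of x] by simp
  show "d (e x) = d x" for x using blinfun_compose_eqD[OF eq(2)] .
  show "f (d x) = d x" for x using blinfun_compose_eqD[OF eq(3)] .
  have "adj d o\<^sub>L (d o\<^sub>L adj d) = adj d"
    using arg_cong[OF eq(1), of adj] c by (simp add: adj_compose clinear_ops_intros adj_adj blinfun_compose_assoc)
  then show 2: "adj d (d (adj d x)) = adj d x" for x by (metis blinfun_apply_blinfun_compose)
  have "e o\<^sub>L adj d = adj d" using arg_cong[OF eq(2), of adj] c projectionD(2)[OF e] by (simp add: adj_compose)
  then show "e (adj d x) = adj d x" for x by (rule blinfun_compose_eqD)
  have "adj d o\<^sub>L f = adj d" using arg_cong[OF eq(3), of adj] c projectionD(2)[OF f] by (simp add: adj_compose)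
  then show "adj d (f x) = adj d x" for x by (rule blinfun_compose_eqD)
  show "projection (adj d o\<^sub>L d)" "projection (d o\<^sub>L adj d)"
    using dR c by (auto simp: projection_def adj_compose adj_adj blinfun_eq_iff 1 2)
qed

lemma partial_isometry_norm:
  assumes d: "d \<in> partial_isometries e f" and e: "projection e" and f: "projection f"
  shows "norm (d x) \<le> norm x" "norm (adj d x) \<le> norm x"
proof -
  note D = partial_isometriesD[OF assms]
  note c = clinear[OF D(1)] adj_clinear[OF clinear[OF D(1)]]
  have "(norm (d x))\<^sup>2 = (norm ((adj d o\<^sub>L d) x))\<^sup>2"
    using norm_adj_apply_sq[OF c(1), of x] cinner_adj_left[OF c(1), of "d x" "adj d (d x)"]
      cinner_adj_right[OF c(1), of x "d x"] 
    by (simp add: Re_cinner_self[symmetric] D cinner_adj_left[OF c(1)])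
  then show "norm (d x) \<le> norm x" using projection_norm[OF D(8), of x] by simp
  have "(norm (adj d x))\<^sup>2 = (norm ((d o\<^sub>L adj d) x))\<^sup>2"
    using D(5)[of x] by (simp add: Re_cinner_self[symmetric] cinner_adj_right[OF c(1), symmetric])
  then show "norm (adj d x) \<le> norm x" using projection_norm[OF D(9), of x] by simp
qed

text \<open>If each operator extends its predecessors orthogonally, then by Pythagoras the squared distances of
  the images of a vector are the differences of a bounded increasing sequence.\<close>

lemma extending_sequence_converges:
  assumes W: "\<And>n. W n \<in> R" and n1: "\<And>n x. norm (W n x) \<le> norm x"
    and ext: "\<And>m n x. n \<le> m \<Longrightarrow> adj (W n) (W m x) = adj (W n) (W n x)"
  obtains w where "w \<in> R" "\<And>x. (\<lambda>n. blinfun_apply (W n) x) \<longlonglongrightarrow> blinfun_apply w x"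
proof (rule strong_limit[of W 1])
  fix x
  have pyth: "(norm (W m x - W n x))\<^sup>2 = (norm (W m x))\<^sup>2 - (norm (W n x))\<^sup>2" if "n \<le> m" for m n
  proof -
    have "cinner (W n x) (W m x) = cinner (W n x) (W n x)"
      using ext[OF that, of x] cinner_adj_right[OF clinear[OF W]] by metis
    then have "Re (cinner (W m x) (W n x)) = (norm (W n x))\<^sup>2"
      using Re_cinner_commute[of "W m x" "W n x"] by (simp add: Re_cinner_self)
    then show ?thesis by (simp add: norm_diff_sq)
  qed
  define y where "y n = (norm (W n x))\<^sup>2" for n
  have "incseq y"
  proof (rule incseq_SucI)
    fix n show "y n \<le> y (Suc n)"
      using pyth[of n "Suc n"] zero_le_power2[of "norm (W (Suc n) x - W n x)"] unfolding y_def by linarith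
  qed
  moreover have "y n \<le> (norm x)\<^sup>2" for n unfolding y_def using n1 by (intro power_mono) auto
  ultimately have "convergent y" using incseq_convergent[of y "(norm x)\<^sup>2"] by (metis convergentI)
  then have Cy: "Cauchy y" by (simp add: Cauchy_convergent_iff)
  show "Cauchy (\<lambda>n. blinfun_apply (W n) x)"
  proof (rule metric_CauchyI)
    fix e :: real assume e: "e > 0"
    then obtain M where M: "\<forall>m\<ge>M. \<forall>n\<ge>M. dist (y m) (y n) < e\<^sup>2" using metric_CauchyD[OF Cy, of "e\<^sup>2"] by auto
    have half: "dist (W m x) (W n x) < e" if "m \<ge> M" "n \<ge> M" "n \<le> m" for m n
    proof -
      have "(norm (W m x - W n x))\<^sup>2 \<le> dist (y m) (y n)"
        unfolding pyth[OF that(3)] y_def dist_real_def by simp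
      also have "\<dots> < e\<^sup>2" using M that by blast
      finally show ?thesis using e by (simp add: dist_norm power2_less_imp_less)
    qed
    have "dist (W m x) (W n x) < e" if "m \<ge> M" "n \<ge> M" for m n
      using half[OF that] half[OF that(2,1)] by (cases "n \<le> m") (auto simp: dist_commute)
    then show "\<exists>M. \<forall>m\<ge>M. \<forall>n\<ge>M. dist (W m x) (W n x) < e" by blast
  qed
qed (use W n1 in auto)

end

context spin_generated
begin

text \<open>Averaging \<open>f f\<^sup>*\<close> over conjugations by generators approximates a multiple of the identity;
  all these averages are annihilated by \<open>e\<close> when \<open>e r f = 0\<close> for every \<open>r\<close>.\<close>

lemma prime_algebra:
  assumes e: "e \<in> R" and f: "f \<in> R" and z: "\<And>r. r \<in> R \<Longrightarrow> e o\<^sub>L (r o\<^sub>L f) = 0"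
  shows "e = 0 \<or> f = 0"
proof -
  define W where "W = {X \<in> R. \<forall>r\<in>R. e o\<^sub>L (r o\<^sub>L X) = 0}"
  define c where "c = coef 0 (f o\<^sub>L adj f)"
  have c: "c = of_real ((n2 (adj f))\<^sup>2)"
    using n2_sq[of "adj f"] f by (auto simp: c_def coef_def adj_adj clinear)
  have FW: "f o\<^sub>L adj f \<in> W"
    using f z by (auto simp: W_def blinfun_compose_assoc[symmetric] bounded_bilinear.zero_left[OF bounded_bilinear_blinfun_compose])
  have small: "cmod c * n2 e \<le> norm e * \<epsilon>" if \<epsilon>: "\<epsilon> > 0" for \<epsilon>
  proof -
    have "\<exists>S\<in>W. n2 (S - (scalar_op (coef 0 (f o\<^sub>L adj f)) o\<^sub>L word v 0)) < \<epsilon>"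
    proof (rule extract_word[where I = UNIV, OF _ _ _ FW _ \<epsilon>])
      show "\<exists>i\<in>UNIV. pairing a (int i) p \<noteq> pairing a (int i) 0" if "p \<noteq> 0" for p
        using nondeg that by (auto simp: nondegenerate_def)
      show "project_sign 0 i S \<in> W" if S: "S \<in> W" for i S
      proof -
        have "e o\<^sub>L (r o\<^sub>L project_sign 0 i S) = 0" if r: "r \<in> R" for r
        proof -
          have "e (r (S x)) = 0" "e (r (v i (S x))) = 0" for x
            using S r blinfun_compose_eqD[of e "r o\<^sub>L S" 0 x] blinfun_compose_eqD[of e "(r o\<^sub>L v i) o\<^sub>L S" 0 x]
            by (auto simp: W_def mem_compose)
          then show ?thesis by (intro blinfun_eqI) (simp add: project_sign_def blinfun.bilinear_simps)
        qed
        then show ?thesis using S by (auto simp: W_def)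
      qed
    qed (use f in \<open>auto simp: W_def\<close>)
    then obtain S where S: "S \<in> W" "n2 (S - scalar_op c) < \<epsilon>" by (auto simp: c_def)
    have SR: "S \<in> R" "e o\<^sub>L S = 0" using S(1) by (auto simp: W_def dest!: bspec[of _ _ id_blinfun])
    have "e o\<^sub>L (S - scalar_op c) = - (scalar_op c o\<^sub>L e)"
      using SR(2) by (simp add: compose_bilinear scalar_op_commute[OF clinear[OF e]])
    then have "cmod c * n2 e = n2 (e o\<^sub>L (S - scalar_op c))"
      using e by (simp add: n2_minus n2_scalar mem_compose)
    also have "\<dots> \<le> norm e * n2 (S - scalar_op c)" using e SR by (intro n2_compose_left) auto
    also have "\<dots> \<le> norm e * \<epsilon>" using S by (intro mult_left_mono) auto
    finally show ?thesis .
  qed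
  have "cmod c * n2 e \<le> 0"
  proof (rule field_le_epsilon)
    fix \<epsilon> :: real assume "\<epsilon> > 0"
    then have "cmod c * n2 e \<le> norm e * (\<epsilon> / (norm e + 1))" by (intro small) (simp add: add_nonneg_pos)
    also have "\<dots> \<le> \<epsilon>" using \<open>\<epsilon> > 0\<close> by (simp add: divide_simps add_nonneg_pos mult.commute)
    finally show "cmod c * n2 e \<le> 0 + \<epsilon>" by simp
  qed
  then have "c = 0 \<or> n2 e = 0" using n2_nonneg[OF e] by (smt (verit) mult_pos_pos norm_ge_zero zero_less_norm_iff)
  then show ?thesis
    using n2_eq_0[OF e] n2_eq_0[of f] n2_adj[OF f] f c by auto
qed

text \<open>Take the polar part of a non-zero \<open>f r e\<close>.\<close>

lemma nonzero_partial_isometry: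
  assumes e: "projection e" and f: "projection f" and nz: "e \<noteq> 0" "f \<noteq> 0"
  shows "\<exists>d\<in>partial_isometries e f. d \<noteq> 0"
proof -
  obtain r where r: "r \<in> R" "f o\<^sub>L (r o\<^sub>L e) \<noteq> 0"
    using prime_algebra[of f e] projectionD(1)[OF e] projectionD(1)[OF f] nz by blast
  define y where "y = f o\<^sub>L (r o\<^sub>L e)"
  define x where "x = (1 / norm y) *\<^sub>R y"
  have y: "y \<in> R" "y \<noteq> 0" using r projectionD(1)[OF e] projectionD(1)[OF f] by (auto simp: y_def)
  have x: "x \<in> R" "norm x \<le> 1" using y by (auto simp: x_def)
  obtain w Q where w: "w \<in> R" "w o\<^sub>L Q = x" "w o\<^sub>L (adj w o\<^sub>L w) = w"
    "\<And>f. f o\<^sub>L x = x \<Longrightarrow> f o\<^sub>L w = w" "\<And>e. x o\<^sub>L e = x \<Longrightarrow> w o\<^sub>L e = w"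
    using polar_decomposition[OF x] by metis
  have "f o\<^sub>L w = w" by (rule w(4)) (rule blinfun_eqI, simp add: x_def y_def blinfun.bilinear_simps projectionD[OF f])
  moreover have "w o\<^sub>L e = w" by (rule w(5)) (rule blinfun_eqI, simp add: x_def y_def blinfun.bilinear_simps projectionD[OF e])
  moreover have "w \<noteq> 0"
  proof
    assume "w = 0"
    then have "x = 0" using w(2) by (simp add: compose_bilinear)
    then show False using y by (simp add: x_def)
  qed
  ultimately show ?thesis using w by (auto simp: partial_isometries_def)
qed

text \<open>A greedy construction: repeatedly adjoin an orthogonal partial isometry whose 2-norm is at least
  half of what is possible.  The squared 2-norms are summable, so nothing can be adjoined to the
  limit; then one of the two remaining projections vanishes.\<close>

theorem comparison:
  assumes e: "projection e" and f: "projection f"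
  shows "\<exists>w\<in>partial_isometries e f. adj w o\<^sub>L w = e \<or> w o\<^sub>L adj w = f"
proof -
  let ?PI = "partial_isometries e f"
  note D = partial_isometriesD[OF _ e f] and N = partial_isometry_norm[OF _ e f]
  define orth where "orth W = {d \<in> ?PI. d o\<^sub>L adj W = 0 \<and> adj W o\<^sub>L d = 0}" for W
  have n2b: "n2 d \<le> 1" if "d \<in> ?PI" for d
  proof -
    have "norm d \<le> 1" by (rule norm_blinfun_bound) (use N[OF that] in auto)
    then show ?thesis using n2_compose_left[OF D(1)[OF that] mem_id] by (simp add: n2_id)
  qed
  have zero: "0 \<in> ?PI" by (simp add: partial_isometries_def compose_bilinear)
  have near_sup: "\<exists>d\<in>orth W. \<forall>d'\<in>orth W. n2 d' \<le> 2 * n2 d" for W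
  proof -
    have o0: "0 \<in> orth W" using zero by (simp add: orth_def compose_bilinear)
    have bdd: "bdd_above (n2 ` orth W)" using n2b by (intro bdd_aboveI[of _ 1]) (auto simp: orth_def)
    define s where "s = (SUP d\<in>orth W. n2 d)"
    have le: "n2 d \<le> s" if "d \<in> orth W" for d unfolding s_def using bdd that by (rule cSUP_upper2[OF _ _ order_refl])
    show ?thesis
    proof (cases "s > 0")
      case True
      then have "s / 2 < s" by simp
      then obtain d where "d \<in> orth W" "s / 2 < n2 d"
        using less_cSUP_iff[OF _ bdd, of "s/2"] o0 unfolding s_def by blast
      then have "n2 d' \<le> 2 * n2 d" if "d' \<in> orth W" for d' using le[OF that] by linarith
      then show ?thesis using \<open>d \<in> orth W\<close> by blast
    next
      case False
      then have "n2 d' \<le> 2 * n2 0" if "d' \<in> orth W" for d' using le[OF that] n2_zero by linarith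
      then show ?thesis using o0 by blast
    qed
  qed
  then obtain pick where pick: "\<And>W. pick W \<in> orth W" "\<And>W d. d \<in> orth W \<Longrightarrow> n2 d \<le> 2 * n2 (pick W)"
    by metis
  define W where "W = rec_nat 0 (\<lambda>_ V. V + pick V)"
  define d where "d n = pick (W n)" for n
  have W0: "W 0 = 0" and WS: "\<And>n. W (Suc n) = W n + d n" by (simp_all add: W_def d_def)
  have orth_app: "x (adj V y) = 0" "adj V (x y) = 0" "V (adj x y) = 0" "adj x (V y) = 0"
    if x: "x \<in> orth V" and V: "V \<in> R" for x V y
  proof -
    have xR: "x \<in> R" using x D(1) by (auto simp: orth_def)
    have eq: "x o\<^sub>L adj V = 0" "adj V o\<^sub>L x = 0" using x by (auto simp: orth_def)
    note c = clinear[OF xR] clinear[OF V] adj_clinear[OF clinear[OF V]]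
    show "x (adj V y) = 0" "adj V (x y) = 0" using blinfun_compose_eqD[OF eq(1), of y] blinfun_compose_eqD[OF eq(2), of y] by auto
    have "V o\<^sub>L adj x = 0" "adj x o\<^sub>L V = 0"
      using arg_cong[OF eq(1), of adj] arg_cong[OF eq(2), of adj] c by (simp_all add: adj_compose adj_adj)
    then show "V (adj x y) = 0" "adj x (V y) = 0" by (auto dest!: blinfun_compose_eqD)
  qed
  have WPI: "W n \<in> ?PI" for n
  proof (induction n)
    case 0 show ?case by (simp add: W0 zero)
  next
    case (Suc n)
    have dP: "d n \<in> ?PI" "d n \<in> orth (W n)" using pick(1)[of "W n"] by (auto simp: d_def orth_def)
    note DW = D[OF Suc] and Dd = D[OF dP(1)] and O = orth_app[OF dP(2) D(1)[OF Suc]]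
    show ?case
      using DW(1) Dd(1) by (auto simp: partial_isometries_def WS blinfun_eq_iff blinfun.bilinear_simps
          adj_add clinear DW Dd O)
  qed
  have dP: "d n \<in> ?PI" "d n \<in> orth (W n)" for n using pick(1)[of "W n"] by (auto simp: d_def orth_def)
  note DW = D[OF WPI] and Dd = D[OF dP(1)] and O = orth_app[OF dP(2) D(1)[OF WPI]]
  \<comment> \<open>Initial and final projections only grow.\<close>
  have ext: "adj (W n) (W m x) = adj (W n) (W n x) \<and> W n (adj (W m) x) = W n (adj (W n) x)"
    if "n \<le> m" for m n x
    using that
  proof (induction arbitrary: x rule: dec_induct)
    case (step m)
    have "adj (W n) (d m x) = adj (W n) (W n (adj (W n) (d m x)))" by (simp add: DW)
    also have "W n (adj (W n) (d m x)) = W n (adj (W m) (d m x))" using step.IH by simp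
    finally have 1: "adj (W n) (d m x) = 0" by (simp add: O)
    have "W n (adj (d m) x) = W n (adj (W n) (W n (adj (d m) x)))" by (simp add: DW)
    also have "adj (W n) (W n (adj (d m) x)) = adj (W n) (W m (adj (d m) x))" using step.IH by simp
    finally have 2: "W n (adj (d m) x) = 0" by (simp add: O)
    show ?case using step.IH[of x] 1 2 DW(1)[of m] Dd(1)[of m]
      by (simp add: WS blinfun.bilinear_simps adj_add clinear)
  qed simp
  obtain w where w: "w \<in> R" and wl: "\<And>x. (\<lambda>n. blinfun_apply (W n) x) \<longlonglongrightarrow> blinfun_apply w x"
  proof (rule extending_sequence_converges[of W])
    show "W n \<in> R" for n by (rule DW(1))
    show "norm (W n x) \<le> norm x" for n x by (rule N(1)[OF WPI])
    show "adj (W n) (W m x) = adj (W n) (W n x)" if "n \<le> m" for m n x using ext[OF that] by blast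
  qed blast
  obtain w' where w': "w' \<in> R" and wl': "\<And>x. (\<lambda>n. blinfun_apply (adj (W n)) x) \<longlonglongrightarrow> blinfun_apply w' x"
  proof (rule extending_sequence_converges[of "\<lambda>n. adj (W n)"])
    show "adj (W n) \<in> R" for n using DW(1) by blast
    show "norm (adj (W n) x) \<le> norm x" for n x by (rule N(2)[OF WPI])
    show "adj (adj (W n)) (adj (W m) x) = adj (adj (W n)) (adj (W n) x)" if "n \<le> m" for m n x
      using ext[OF that] adj_adj[OF clinear[OF DW(1)]] by simp
  qed blast
  have aw: "adj w = w'"
  proof (rule adj_eqI)
    fix x y
    have "(\<lambda>n. cinner (adj (W n) x) y) \<longlonglongrightarrow> cinner (w' x) y" by (intro tendsto_cinner wl' tendsto_const)
    moreover have "(\<lambda>n. cinner x (W n y)) \<longlonglongrightarrow> cinner x (w y)" by (intro tendsto_cinner wl tendsto_const)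
    ultimately show "cinner (w' x) y = cinner x (w y)"
      using cinner_adj_left[OF clinear[OF DW(1)]] LIMSEQ_unique by auto
  qed
  have e1: "w' (W n x) = adj (W n) (W n x)" for n x
  proof -
    have "\<forall>\<^sub>F m in sequentially. adj (W m) (W n x) = adj (W n) (W n x)"
    proof (rule eventually_sequentiallyI)
      fix m assume nm: "n \<le> m"
      show "adj (W m) (W n x) = adj (W n) (W n x)"
      proof (rule cinner_extI_left)
        fix z
        have "cinner (adj (W m) (W n x)) z = cinner x (adj (W n) (W m z))"
          by (simp add: cinner_adj_left[OF clinear[OF DW(1)]] cinner_adj_right[OF clinear[OF DW(1)]])
        also have "\<dots> = cinner x (adj (W n) (W n z))" using ext[OF nm] by simp
        also have "\<dots> = cinner (adj (W n) (W n x)) z"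
          by (simp add: cinner_adj_left[OF clinear[OF DW(1)]] cinner_adj_right[OF clinear[OF DW(1)]])
        finally show "cinner (adj (W m) (W n x)) z = cinner (adj (W n) (W n x)) z" .
      qed
    qed
    then have "(\<lambda>m. adj (W m) (W n x)) \<longlonglongrightarrow> adj (W n) (W n x)" by (rule tendsto_eventually)
    then show ?thesis using LIMSEQ_unique[OF wl'] by blast
  qed
  have e2: "w (adj (W n) x) = W n (adj (W n) x)" for n x
  proof -
    have "\<forall>\<^sub>F m in sequentially. W m (adj (W n) x) = W n (adj (W n) x)"
    proof (rule eventually_sequentiallyI)
      fix m assume nm: "n \<le> m"
      show "W m (adj (W n) x) = W n (adj (W n) x)"
      proof (rule cinner_extI_left)
        fix z
        have "cinner (W m (adj (W n) x)) z = cinner x (W n (adj (W m) z))"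
          by (simp add: cinner_adj_left[OF clinear[OF DW(1)]] cinner_adj_right[OF clinear[OF DW(1)], symmetric])
        also have "\<dots> = cinner x (W n (adj (W n) z))" using ext[OF nm] by simp
        also have "\<dots> = cinner (W n (adj (W n) x)) z"
          by (simp add: cinner_adj_left[OF clinear[OF DW(1)]] cinner_adj_right[OF clinear[OF DW(1)], symmetric])
        finally show "cinner (W m (adj (W n) x)) z = cinner (W n (adj (W n) x)) z" .
      qed
    qed
    then have "(\<lambda>m. W m (adj (W n) x)) \<longlonglongrightarrow> W n (adj (W n) x)" by (rule tendsto_eventually)
    then show ?thesis using LIMSEQ_unique[OF wl] by blast
  qed
  have wPI: "w \<in> ?PI"
  proof -
    have "w (adj w (w x)) = w x" for x
    proof -
      have "w (w' (W n x)) = W n x" for n by (simp add: e1 e2 DW)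
      moreover have "(\<lambda>n. w (w' (W n x))) \<longlonglongrightarrow> w (w' (w x))" by (intro blinfun.tendsto tendsto_const wl)
      ultimately have "(\<lambda>n. W n x) \<longlonglongrightarrow> w (w' (w x))" by simp
      then show ?thesis unfolding aw using LIMSEQ_unique wl by blast
    qed
    moreover have "w (e x) = w x" for x
      using wl[of "e x"] wl[of x] LIMSEQ_unique by (auto simp: DW)
    moreover have "f (w x) = w x" for x
    proof -
      have "(\<lambda>n. f (W n x)) \<longlonglongrightarrow> f (w x)" by (intro blinfun.tendsto tendsto_const wl)
      then show ?thesis using wl[of x] LIMSEQ_unique by (auto simp: DW)
    qed
    ultimately show ?thesis using w by (auto simp: partial_isometries_def blinfun_eq_iff)
  qed
  note Dw = D[OF wPI]
  have gain: "(n2 (W (Suc n)))\<^sup>2 = (n2 (W n))\<^sup>2 + (n2 (d n))\<^sup>2" for n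
  proof -
    have "adj (W (Suc n)) o\<^sub>L W (Suc n) = (adj (W n) o\<^sub>L W n) + (adj (d n) o\<^sub>L d n)"
      using DW(1)[of n] Dd(1)[of n]
      by (intro blinfun_eqI) (simp add: WS adj_add clinear blinfun.bilinear_simps O)
    then have "complex_of_real ((n2 (W (Suc n)))\<^sup>2) = of_real ((n2 (W n))\<^sup>2 + (n2 (d n))\<^sup>2)"
      using n2_sq[OF DW(1), of "Suc n"] n2_sq[OF DW(1), of n] n2_sq[OF Dd(1), of n] DW(1)[of n] Dd(1)[of n]
      by (simp add: t_add mem_compose mem_adj)
    then show ?thesis by (simp only: of_real_eq_iff)
  qed
  have d0: "(\<lambda>n. 2 * n2 (d n)) \<longlonglongrightarrow> 0"
  proof -
    define y where "y n = (n2 (W n))\<^sup>2" for n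
    have "incseq y" by (rule incseq_SucI) (simp add: y_def gain)
    moreover have "y n \<le> 1" for n
      unfolding y_def using n2b[OF WPI, of n] n2_nonneg[OF DW(1), of n] by (simp add: power_le_one)
    ultimately obtain L where "y \<longlonglongrightarrow> L" using incseq_convergent[of y 1] by metis
    then have "(\<lambda>n. sqrt (y (Suc n) - y n)) \<longlonglongrightarrow> sqrt (L - L)" by (intro tendsto_intros LIMSEQ_Suc)
    moreover have "sqrt (y (Suc n) - y n) = n2 (d n)" for n
      using n2_nonneg[OF Dd(1), of n] by (simp add: y_def gain)
    ultimately have "(\<lambda>n. n2 (d n)) \<longlonglongrightarrow> 0" by simp
    then show ?thesis using tendsto_mult_left[of _ 0 sequentially 2] by simp
  qed
  \<comment> \<open>What is orthogonal to the limit is a competitor at every stage.\<close>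
  have orth_w: "x = 0" if x: "x \<in> orth w" for x
  proof (rule n2_eq_0)
    show xR: "x \<in> R" using x D(1) by (auto simp: orth_def)
    note Ow = orth_app[OF x w]
    have "x \<in> orth (W n)" for n
    proof -
      have "x (adj (W n) y) = 0" for y
      proof -
        have "adj (W n) y = w' (w (adj (W n) y))" by (simp add: e2 e1 DW)
        then show ?thesis using Ow(1) aw by metis
      qed
      moreover have "adj (W n) (x y) = 0" for y
      proof (rule cinner_extI)
        fix z
        have "W n z = w (w' (W n z))" by (simp add: e1 e2 DW)
        then have "cinner (W n z) (x y) = cinner (w' (W n z)) (adj w (x y))"
          using cinner_adj_right[OF clinear[OF w]] by metis
        then show "cinner z (adj (W n) (x y)) = cinner z 0"
          by (simp add: cinner_adj_right[OF clinear[OF DW(1)]] Ow(2))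
      qed
      ultimately show ?thesis using x by (auto simp: orth_def blinfun_eq_iff)
    qed
    then have "n2 x \<le> 2 * n2 (d n)" for n using pick(2) by (simp add: d_def)
    then have "n2 x \<le> 0" by (intro LIMSEQ_le_const[OF d0]) auto
    then show "n2 x = 0" using n2_nonneg[OF xR] by simp
  qed
  define e' where "e' = e - (adj w o\<^sub>L w)"
  define f' where "f' = f - (w o\<^sub>L adj w)"
  have pe: "projection e'" and pf: "projection f'"
    using projectionD[OF e] projectionD[OF f] projectionD(1,2)[OF Dw(8)] projectionD(1,2)[OF Dw(9)]
    by (auto simp: projection_def e'_def f'_def adj_diff clinear blinfun_eq_iff blinfun.bilinear_simps Dw)
  have "partial_isometries e' f' \<subseteq> orth w"
  proof
    fix x assume x: "x \<in> partial_isometries e' f'"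
    note X = partial_isometriesD[OF x pe pf]
    have 1: "x (adj w y) = 0" for y
      using X(3)[of "adj w y"] by (simp add: e'_def blinfun.bilinear_simps Dw)
    have 2: "adj w (x y) = 0" for y
      using arg_cong[OF X(4)[of y], of "blinfun_apply (adj w)"] by (simp add: f'_def blinfun.bilinear_simps Dw)
    have "x (e y) = x y" for y using X(3)[of y] X(3)[of "e y"]
      by (simp add: e'_def blinfun.bilinear_simps projectionD[OF e] Dw 1)
    moreover have "f (x y) = x y" for y
      using X(4)[of y] by (simp add: f'_def blinfun.bilinear_simps 2)
    ultimately show "x \<in> orth w"
      using X(1,2) 1 2 by (auto simp: orth_def partial_isometries_def blinfun_eq_iff)
  qed
  then have "e' = 0 \<or> f' = 0" using nonzero_partial_isometry[OF pe pf] orth_w by blast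
  then show ?thesis using wPI by (intro bexI[of _ w]) (auto simp: e'_def f'_def)
qed

end

lemma norm_contraction: "norm T \<le> 1 \<Longrightarrow> norm (blinfun_apply T x) \<le> norm x"
  using norm_blinfun[of T x] by (meson dual_order.trans mult_left_le_one_le norm_ge_zero)

section \<open>Uniqueness of the tracial state\<close>

context vN_algebra
begin

lemma partial_isometries_adj:
  assumes "d \<in> partial_isometries e f" "projection e" "projection f"
  shows "adj d \<in> partial_isometries f e"
  using partial_isometriesD[OF assms] clinear
  by (auto simp: partial_isometries_def blinfun_eq_iff adj_adj)

lemma projection_complement: "projection p \<Longrightarrow> projection (id_blinfun - p)"
  by (auto simp: projection_def adj_diff clinear clinear_ops_intros blinfun_eq_iff blinfun.bilinear_simps)

text \<open>The self-adjoint unitary \<open>u\<close> exchanges the range of \<open>p\<close> with a subspace of its complement, so the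
  mean of \<open>T\<close> and \<open>u T u\<close> has spectrum in \<open>[-1, 1/2]\<close>, while each tracial state takes the same value
  on it as on \<open>T\<close>.  The operator \<open>S\<close> is this mean, shifted to centre the interval at \<open>0\<close>.\<close>

lemma trace_contraction_step:
  assumes T: "T \<in> R" "adj T = T" "norm T \<le> 1" and p: "projection p"
    and w: "w \<in> partial_isometries p (id_blinfun - p)" "adj w o\<^sub>L w = p"
    and form: "\<And>x. Re (cinner (T x) x) \<le> (norm (p x))\<^sup>2"
  obtains S where "S \<in> R" "adj S = S" "norm S \<le> 3/4" "\<And>\<phi>. tracial_state R \<phi> \<Longrightarrow> \<phi> T = \<phi> S - 1/4"
proof -
  note pD = projectionD[OF p] and cp = projection_complement[OF p]
  note D = partial_isometriesD[OF w(1) p cp]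
  note c = clinear[OF D(1)] adj_clinear[OF clinear[OF D(1)]] clinear[OF pD(1)] clinear[OF T(1)]
  have wap: "adj w (w x) = p x" for x using blinfun_compose_eqD[OF w(2)] .
  have pw: "p (w x) = 0" for x using D(4)[of x] by (simp add: blinfun.diff_left)
  have wp: "adj w (p x) = 0" for x using D(7)[of x] by (simp add: blinfun.diff_right blinfun.diff_left)
  have ww: "w (w x) = 0" for x using D(3)[of "w x"] by (simp add: pw)
  have ww': "adj w (adj w x) = 0" for x
    using D(7)[of "adj w x"] by (simp add: blinfun.diff_right blinfun.diff_left D(6))
  define q where "q = w o\<^sub>L adj w"
  have q: "q x = w (adj w x)" for x by (simp add: q_def)
  define u where "u = w + adj w + (id_blinfun - p - q)"
  have uR: "u \<in> R" "q \<in> R" using D(1) pD by (auto simp: u_def q_def)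
  have ua: "adj u = u"
    using c uR clinear[OF uR(2)] projectionD(2)[OF D(9)]
    by (simp add: u_def adj_add adj_diff clinear_ops_intros adj_adj pD q_def add.commute)
  have uu: "u (u x) = x" for x
    by (simp add: u_def q blinfun.bilinear_simps wap pw wp ww ww' D pD algebra_simps)
  have pu: "p (u x) = adj w x" for x
    by (simp add: u_def q blinfun.bilinear_simps pw D pD)
  have nu: "norm (u x) = norm x" for x
  proof -
    have "(norm (u x))\<^sup>2 = (norm x)\<^sup>2"
      using norm_adj_apply_sq[OF clinear[OF uR(1)], of x] by (simp add: ua uu Re_cinner_self)
    then show ?thesis by simp
  qed
  have Tb: "\<bar>Re (cinner (T x) x)\<bar> \<le> (norm x)\<^sup>2" for x
  proof -
    have "\<bar>Re (cinner (T x) x)\<bar> \<le> norm (T x) * norm x"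
      using abs_Re_le_cmod cinner_Cauchy_Schwarz order_trans by blast
    also have "\<dots> \<le> (1 * norm x) * norm x"
      using norm_contraction[OF T(3)] by (intro mult_right_mono) auto
    finally show ?thesis by (simp add: power2_eq_square)
  qed
  have pq: "(norm (p x))\<^sup>2 + (norm (adj w x))\<^sup>2 \<le> (norm x)\<^sup>2" for x
  proof -
    have n1: "(norm (p x))\<^sup>2 = Re (cinner (p x) x)"
      using norm_adj_apply_sq[OF c(3), of x] by (simp add: pD)
    have n2: "(norm (adj w x))\<^sup>2 = Re (cinner (q x) x)"
      using norm_adj_apply_sq[OF c(2), of x] by (simp add: adj_adj[OF c(1)] q)
    have "p (q x) = 0" "q (q x) = q x" by (simp_all add: q pw D)
    then have n3: "Re (cinner (q x) (p x)) = 0"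
      using cinner_adj_left[OF c(3), of "q x" x] pD(2) by simp
    have "norm (q x) = norm (adj w x)"
    proof -
      have "(norm (q x))\<^sup>2 = (norm (adj w x))\<^sup>2"
        using norm_adj_apply_sq[OF c(1), of "adj w x"] norm_adj_apply_sq[OF c(1), of "adj w x"] D(5)[of x]
        by (simp add: q Re_cinner_self)
      then show ?thesis by simp
    qed
    have "0 \<le> (norm (x - (p x + q x)))\<^sup>2" by simp
    also have "\<dots> = (norm x)\<^sup>2 - 2 * (Re (cinner x (p x)) + Re (cinner x (q x))) + (norm (p x + q x))\<^sup>2"
      by (simp add: norm_diff_sq cinner_add_right)
    also have "(norm (p x + q x))\<^sup>2 = (norm (p x))\<^sup>2 + (norm (adj w x))\<^sup>2"
      using n3 Re_cinner_commute[of "q x" "p x"] \<open>norm (q x) = norm (adj w x)\<close> by (simp add: norm_add_sq)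
    also have "Re (cinner x (p x)) + Re (cinner x (q x)) = (norm (p x))\<^sup>2 + (norm (adj w x))\<^sup>2"
      using n1 n2 Re_cinner_commute[of x "p x"] Re_cinner_commute[of x "q x"] by simp
    finally show ?thesis by simp
  qed
  define S where "S = (1/2) *\<^sub>R (T + (u o\<^sub>L (T o\<^sub>L u))) + (1/4) *\<^sub>R id_blinfun"
  have SR: "S \<in> R"
    unfolding S_def using T(1) uR(1) by (intro mem_add mem_scaleR mem_compose mem_id)
  have Sa: "adj S = S"
    using c(4) clinear[OF uR(1)]
    by (simp add: S_def adj_add adj_scaleR adj_compose clinear_ops_intros T(2) ua blinfun_compose_assoc)
  show ?thesis
  proof (rule that[OF SR Sa])
    show "norm S \<le> 3/4"
    proof (rule norm_selfadjoint_le[OF clinear[OF SR] Sa])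
      fix x
      have "Re (cinner (S x) x) = (1/2) * Re (cinner (T x) x) + (1/2) * Re (cinner (T (u x)) (u x)) + (1/4) * (norm x)\<^sup>2"
        using cinner_adj_left[OF clinear[OF uR(1)], of "T (u x)" x]
        by (simp add: S_def blinfun.bilinear_simps cinner_simps ua Re_cinner_self)
      moreover have "Re (cinner (T x) x) + Re (cinner (T (u x)) (u x)) \<le> (norm x)\<^sup>2"
        using form[of x] form[of "u x"] pq[of x] by (simp add: pu)
      moreover have "\<bar>Re (cinner (T x) x)\<bar> \<le> (norm x)\<^sup>2" "\<bar>Re (cinner (T (u x)) (u x))\<bar> \<le> (norm x)\<^sup>2"
        using Tb[of x] Tb[of "u x"] by (simp_all add: nu)
      ultimately show "\<bar>Re (cinner (S x) x)\<bar> \<le> 3/4 * (norm x)\<^sup>2" by linarith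
    qed simp
    fix \<phi> assume \<phi>: "tracial_state R \<phi>"
    have "\<phi> (u o\<^sub>L (T o\<^sub>L u)) = \<phi> ((T o\<^sub>L u) o\<^sub>L u)" using T uR by (intro tau_commute[OF \<phi>]) auto
    also have "(T o\<^sub>L u) o\<^sub>L u = T" by (rule blinfun_eqI) (simp add: uu)
    finally have "\<phi> S = (1/2) * (\<phi> T + \<phi> T) + 1/4"
      using T uR by (simp add: S_def tau_add[OF \<phi>] tau_scaleR[OF \<phi>] tau_id[OF \<phi>] mem_add mem_scaleR mem_compose)
    then show "\<phi> T = \<phi> S - 1/4" by simp
  qed
qed

text \<open>The partial isometry \<open>w\<close> of the polar decomposition \<open>T = w|T|\<close> is self-adjoint, and \<open>p = (w\<^sup>2 + w)/2\<close>
  is the spectral projection of \<open>T\<close> for the positive half-line.\<close>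

lemma sign_projection:
  assumes T: "T \<in> R" "adj T = T" "norm T \<le> 1"
  obtains p where "projection p" "\<And>x. Re (cinner (T x) x) \<le> (norm (p x))\<^sup>2"
    "\<And>x. - Re (cinner (T x) x) \<le> (norm (x - p x))\<^sup>2"
proof -
  obtain w Q where w: "w \<in> R" "Q \<in> R" "adj Q = Q" "norm (id_blinfun - Q) \<le> 1" "Q o\<^sub>L Q = adj T o\<^sub>L T"
    "w o\<^sub>L Q = T" "w o\<^sub>L (adj w o\<^sub>L w) = w" and sa: "adj w = w" "w o\<^sub>L Q = Q o\<^sub>L w"
    by (rule polar_decomposition[OF T(1,3)]) (use T(2) in blast)
  have www: "w (w (w x)) = w x" for x using blinfun_compose_eqD[OF w(7), of x] sa(1) by simp
  have wQ: "w (Q x) = T x" "Q (w x) = T x" for x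
    using blinfun_compose_eqD[OF w(6), of x] blinfun_compose_eqD[OF sa(2)[symmetric], of x] by auto
  define p where "p = (1/2) *\<^sub>R ((w o\<^sub>L w) + w)"
  define m where "m = (1/2) *\<^sub>R ((w o\<^sub>L w) - w)"
  note cw = clinear[OF w(1)]
  have half: "(1/2) *\<^sub>R a + (1/2) *\<^sub>R a = a" for a :: 'h by (simp add: scaleR_left_distrib[symmetric])
  have quarter: "(1/4) *\<^sub>R a + (1/4) *\<^sub>R a = (1/2) *\<^sub>R a" for a :: 'h
    by (simp add: scaleR_left_distrib[symmetric])
  have quarter': "(1/4) *\<^sub>R a + ((1/4) *\<^sub>R a + b) = (1/2) *\<^sub>R a + b" for a b :: 'h
    by (simp add: add.assoc[symmetric] quarter)
  have pp: "projection p" and mm: "projection m"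
    using w(1) cw by (auto simp: projection_def p_def m_def adj_scaleR adj_add adj_diff adj_compose
        clinear_ops_intros sa(1) blinfun_eq_iff blinfun.bilinear_simps www algebra_simps half quarter quarter')
  have Qb: "0 \<le> Re (cinner (Q x) x)" "Re (cinner (Q x) x) \<le> (norm x)\<^sup>2" for x
  proof -
    have "Re (cinner ((id_blinfun - Q) x) x) \<le> norm ((id_blinfun - Q) x) * norm x"
      using complex_Re_le_cmod cinner_Cauchy_Schwarz order_trans by blast
    also have "\<dots> \<le> (1 * norm x) * norm x"
      using norm_contraction[OF w(4)] by (intro mult_right_mono) auto
    finally show "0 \<le> Re (cinner (Q x) x)"
      by (simp add: blinfun.diff_left cinner_diff_left Re_cinner_self power2_eq_square)
    have "(norm (Q x))\<^sup>2 = (norm (T x))\<^sup>2"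
      using norm_adj_apply_sq[OF clinear[OF w(2)], of x] norm_adj_apply_sq[OF clinear[OF T(1)], of x]
        blinfun_compose_eqD[OF w(5), of x] w(3) by simp
    then have nQ: "norm (Q x) = norm (T x)" by simp
    have "Re (cinner (Q x) x) \<le> norm (Q x) * norm x"
      using complex_Re_le_cmod cinner_Cauchy_Schwarz order_trans by blast
    also have "\<dots> \<le> (1 * norm x) * norm x"
      unfolding nQ using norm_contraction[OF T(3)] by (intro mult_right_mono) auto
    finally show "Re (cinner (Q x) x) \<le> (norm x)\<^sup>2" by (simp add: power2_eq_square)
  qed
  have split: "Re (cinner (T x) x) = Re (cinner (Q (p x)) (p x)) - Re (cinner (Q (m x)) (m x))" for x
  proof -
    have wT: "T (w y) = w (T y)" for y using wQ[of "w y"] wQ[of y] by metis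
    have Qp: "Q (p y) = p (Q y)" "Q (m y) = m (Q y)" for y
      by (simp_all add: p_def m_def blinfun.bilinear_simps wQ wT)
    have wpm: "w x = p x - m x"
      by (simp add: p_def m_def blinfun.bilinear_simps algebra_simps half)
    have "cinner (Q (p x)) x = cinner (Q (p x)) (p x)"
      using cinner_adj_left[OF clinear[OF projectionD(1)[OF pp]], of "Q x" "p x"] 
        cinner_adj_left[OF clinear[OF projectionD(1)[OF pp]], of "Q x" x] projectionD[OF pp] by (simp add: Qp)
    moreover have "cinner (Q (m x)) x = cinner (Q (m x)) (m x)"
      using cinner_adj_left[OF clinear[OF projectionD(1)[OF mm]], of "Q x" "m x"] 
        cinner_adj_left[OF clinear[OF projectionD(1)[OF mm]], of "Q x" x] projectionD[OF mm] by (simp add: Qp)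
    moreover have "T x = Q (p x) - Q (m x)" by (simp add: wQ(2)[symmetric] wpm blinfun.diff_right)
    ultimately show ?thesis by (simp add: cinner_diff_left)
  qed
  show ?thesis
  proof (rule that[OF pp])
    fix x
    show "Re (cinner (T x) x) \<le> (norm (p x))\<^sup>2"
      using split[of x] Qb(1)[of "m x"] Qb(2)[of "p x"] by linarith
    have "m (p x) = 0"
      by (simp add: p_def m_def blinfun.bilinear_simps www algebra_simps)
    then have "m x = m (x - p x)" by (simp add: blinfun.diff_right)
    then have "norm (m x) \<le> norm (x - p x)" using projection_norm[OF mm, of "x - p x"] by simp
    then have "(norm (m x))\<^sup>2 \<le> (norm (x - p x))\<^sup>2" by (rule power_mono) simp
    then show "- Re (cinner (T x) x) \<le> (norm (x - p x))\<^sup>2"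
      using split[of x] Qb(2)[of "m x"] Qb(1)[of "p x"] by linarith
  qed
qed

text \<open>The operators \<open>1 - T\<close> and \<open>1 + T\<close> are squares, so their traces are non-negative.\<close>

lemma tracial_state_bound:
  assumes \<phi>: "tracial_state R \<phi>" and T: "T \<in> R" "adj T = T" "norm T \<le> 1"
  shows "cmod (\<phi> T) \<le> 1"
proof -
  have "\<exists>r\<ge>0. \<phi> (id_blinfun - U) = of_real r" if U: "U \<in> R" "adj U = U" "norm U \<le> 1" for U
  proof -
    have "id_blinfun - U \<in> R" "adj (id_blinfun - U) = id_blinfun - U"
      "norm (id_blinfun - (id_blinfun - U)) \<le> 1"
      using U by (auto simp: adj_diff clinear clinear_ops_intros)
    from square_root[OF this] obtain Q where "Q \<in> R" "adj Q = Q" "Q o\<^sub>L Q = id_blinfun - U" by blast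
    then show ?thesis using tau_pos_real[OF \<phi>, of Q] by simp
  qed
  from this[OF T] this[of "- T"] obtain r s
    where "r \<ge> 0" "s \<ge> 0" "1 - \<phi> T = of_real r" "1 + \<phi> T = of_real s"
    using T by (auto simp: adj_minus clinear mem_minus tau_diff[OF \<phi>] tau_id[OF \<phi>] tau_minus[OF \<phi>] tau_add[OF \<phi>])
  then have eq: "\<phi> T = of_real (1 - r)" and rs: "r + s = 2"
    by (auto simp: complex_eq_iff)
  have "cmod (\<phi> T) = \<bar>1 - r\<bar>" unfolding eq by (rule norm_of_real)
  then show ?thesis using rs \<open>r \<ge> 0\<close> \<open>s \<ge> 0\<close> by linarith
qed

end

context spin_generated
begin

text \<open>Either \<open>p\<close> is equivalent to a part of its complement, or the complement is equivalent to a part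
  of \<open>p\<close>; in the second case the contraction step applies to \<open>-T\<close>.\<close>

lemma trace_contraction:
  assumes T: "T \<in> R" "adj T = T" "norm T \<le> 1"
  shows "\<exists>S\<in>R. adj S = S \<and> norm S \<le> 3/4 \<and>
    (\<forall>\<phi>. tracial_state R \<phi> \<longrightarrow> cmod (\<phi> T - \<tau> T) = cmod (\<phi> S - \<tau> S))"
proof -
  obtain p where p: "projection p" "\<And>x. Re (cinner (T x) x) \<le> (norm (p x))\<^sup>2"
    "\<And>x. - Re (cinner (T x) x) \<le> (norm (x - p x))\<^sup>2"
    using sign_projection[OF T] by metis
  note cp = projection_complement[OF p(1)]
  obtain w where w: "w \<in> partial_isometries p (id_blinfun - p)"
    "adj w o\<^sub>L w = p \<or> w o\<^sub>L adj w = id_blinfun - p"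
    using comparison[OF p(1) cp] by blast
  from w(2) show ?thesis
  proof
    assume "adj w o\<^sub>L w = p"
    from trace_contraction_step[OF T p(1) w(1) this p(2)] obtain S where
      S: "S \<in> R" "adj S = S" "norm S \<le> 3/4" "\<And>\<phi>. tracial_state R \<phi> \<Longrightarrow> \<phi> T = \<phi> S - 1/4" by blast
    have "\<phi> T - \<tau> T = \<phi> S - \<tau> S" if "tracial_state R \<phi>" for \<phi>
      using S(4)[OF that] S(4)[OF tracial] by simp
    then show ?thesis using S(1-3) by auto
  next
    assume a: "w o\<^sub>L adj w = id_blinfun - p"
    have "w \<in> R" using partial_isometriesD(1)[OF w(1) p(1) cp] .
    have w': "adj w \<in> partial_isometries (id_blinfun - p) (id_blinfun - (id_blinfun - p))"
      using partial_isometries_adj[OF w(1) p(1) cp] by simp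
    have a': "adj (adj w) o\<^sub>L adj w = id_blinfun - p" using a \<open>w \<in> R\<close> by (simp add: adj_adj clinear)
    have T': "- T \<in> R" "adj (- T) = - T" "norm (- T) \<le> 1" using T by (auto simp: adj_minus clinear)
    have form: "Re (cinner ((- T) x) x) \<le> (norm ((id_blinfun - p) x))\<^sup>2" for x
      using p(3)[of x] by (simp add: blinfun.bilinear_simps)
    from trace_contraction_step[OF T' cp w' a' form] obtain S where
      S: "S \<in> R" "adj S = S" "norm S \<le> 3/4" "\<And>\<phi>. tracial_state R \<phi> \<Longrightarrow> \<phi> (- T) = \<phi> S - 1/4" by blast
    have "\<phi> T - \<tau> T = - (\<phi> S - \<tau> S)" if \<phi>: "tracial_state R \<phi>" for \<phi>
    proof -
      have neg: "\<psi> T = 1/4 - \<psi> S" if "tracial_state R \<psi>" for \<psi>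
        using S(4)[OF that] tau_minus[OF that T(1)] by (metis minus_diff_eq minus_equation_iff)
      show ?thesis by (simp add: neg[OF \<phi>] neg[OF tracial])
    qed
    then have "cmod (\<phi> T - \<tau> T) = cmod (\<phi> S - \<tau> S)" if "tracial_state R \<phi>" for \<phi>
      using that by (metis norm_minus_cancel)
    then show ?thesis using S by blast
  qed
qed

text \<open>Rescaling after each contraction step shrinks the possible discrepancy between \<open>\<phi>\<close> and \<open>\<tau>\<close> on
  self-adjoint contractions by the factor 3/4.\<close>

theorem tracial_state_unique:
  assumes \<phi>: "tracial_state R \<phi>" and T: "T \<in> R"
  shows "\<phi> T = \<tau> T"
proof -
  have bnd: "cmod (\<phi> T - \<tau> T) \<le> 2 * (3/4) ^ n" if "T \<in> R" "adj T = T" "norm T \<le> 1" for T n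
    using that
  proof (induction n arbitrary: T)
    case 0
    then show ?case
      using tracial_state_bound[OF \<phi> 0] tracial_state_bound[OF tracial 0] norm_triangle_ineq4[of "\<phi> T" "\<tau> T"] by simp
  next
    case (Suc n)
    obtain S where S: "S \<in> R" "adj S = S" "norm S \<le> 3/4" "cmod (\<phi> T - \<tau> T) = cmod (\<phi> S - \<tau> S)"
      using trace_contraction[OF Suc.prems] \<phi> by blast
    have "cmod (\<phi> ((4/3) *\<^sub>R S) - \<tau> ((4/3) *\<^sub>R S)) \<le> 2 * (3/4) ^ n"
      using S by (intro Suc.IH) (auto simp: adj_scaleR clinear)
    moreover have "\<phi> ((4/3) *\<^sub>R S) - \<tau> ((4/3) *\<^sub>R S) = (4/3) * (\<phi> S - \<tau> S)"
      using S by (simp add: tau_scaleR[OF \<phi>] t_scaleR algebra_simps)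
    moreover have "cmod ((4/3) * z) = 4/3 * cmod z" for z by (simp add: norm_mult)
    ultimately have "4/3 * cmod (\<phi> S - \<tau> S) \<le> 2 * (3/4) ^ n" by metis
    then show ?case using S(4) by simp
  qed
  have sa1: "\<phi> T = \<tau> T" if "T \<in> R" "adj T = T" "norm T \<le> 1" for T
  proof -
    have "(\<lambda>n. 2 * (3/4::real) ^ n) \<longlonglongrightarrow> 2 * 0" by (intro tendsto_intros LIMSEQ_power_zero) simp
    then have "cmod (\<phi> T - \<tau> T) \<le> 2 * 0" by (rule LIMSEQ_le_const) (use bnd[OF that] in auto)
    then show ?thesis by simp
  qed
  have sa: "\<phi> T = \<tau> T" if "T \<in> R" "adj T = T" for T
  proof (cases "norm T = 0")
    case True then show ?thesis by (simp add: tau_zero[OF \<phi>] t_zero)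
  next
    case False
    have "\<phi> ((1 / norm T) *\<^sub>R T) = \<tau> ((1 / norm T) *\<^sub>R T)"
      using that False by (intro sa1) (auto simp: adj_scaleR clinear)
    then show ?thesis using that False by (simp add: tau_scaleR[OF \<phi>] t_scaleR)
  qed
  define A where "A = (1/2) *\<^sub>R (T + adj T)"
  define B where "B = scalar_op (- \<i> / 2) o\<^sub>L (T - adj T)"
  have AB: "A \<in> R" "B \<in> R" "adj A = A" using T clinear[OF T] adj_clinear[OF clinear[OF T]]
    by (auto simp: A_def B_def adj_scaleR adj_add clinear_ops_intros adj_adj add.commute)
  have aB: "adj B = B"
    using clinear[OF T] adj_clinear[OF clinear[OF T]]
    by (intro blinfun_eqI) (simp add: B_def adj_compose adj_diff clinear_ops_intros adj_adj adj_scalar_op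
        blinfun.bilinear_simps clinear_opsD scaleC_diff_right)
  have "T = A + (scalar_op \<i> o\<^sub>L B)"
  proof (rule blinfun_eqI)
    fix x
    have "(1/2) *\<^sub>R y + (1/2::complex) *\<^sub>C z = (1/2) *\<^sub>R (y + z)" for y z :: 'h
      by (simp add: scaleR_eq_scaleC scaleC_add_right)
    moreover have "(1/2) *\<^sub>R (y + y) = y" for y :: 'h by (simp add: scaleR_2[symmetric])
    ultimately show "T x = (A + (scalar_op \<i> o\<^sub>L B)) x"
      by (simp add: A_def B_def blinfun.bilinear_simps scaleC_scaleC scaleC_diff_right algebra_simps)
  qed
  then show ?thesis using sa AB aB by (metis mem_compose mem_scalar tau_add[OF \<phi>] tau_scalar[OF \<phi>] t_add t_scalar)
qed

end

section \<open>The symplectic form over the two-element field\<close>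

lemma conv_smult: "conv s i (smult c p) = c * conv s i p"
  by (induction p arbitrary: i) (auto simp: algebra_simps)

lemma conv_mult: "conv s i (p * q) = conv (\<lambda>j. conv s j q) i p"
  by (induction p arbitrary: i) (auto simp: conv_add conv_smult)

lemma conv_monom: "conv s i (monom 1 k) = s (i - int k)"
  by (induction k arbitrary: i) (auto simp: monom_0 monom_Suc algebra_simps)

lemma conv_eq_sum: "degree p \<le> n \<Longrightarrow> conv s i p = (\<Sum>j\<le>n. coeff p j * s (i - int j))"
proof (induction n arbitrary: p i)
  case 0
  then obtain c where "p = [:c:]" using degree_eq_zeroE by blast
  then show ?case by simp
next
  case (Suc n)
  obtain c q where p: "p = pCons c q" by (rule pCons_cases)
  have "degree q \<le> n" using Suc.prems by (auto simp: p split: if_splits)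
  from Suc.IH[OF this, of "i - 1"] show ?case
    by (simp add: p sum.atMost_Suc_shift algebra_simps del: sum.atMost_Suc)
qed

lemma conv_vanish: "(\<And>j. j \<le> degree p \<Longrightarrow> s (i - int j) = 0) \<Longrightarrow> conv s i p = 0"
  by (subst conv_eq_sum[OF order_refl]) (auto intro: sum.neutral)

text \<open>Reversing a polynomial reflects its pairings, because the mirror sequence is symmetric.\<close>

lemma pairing_reflect: "pairing a i (reflect_poly p) = pairing a (int (degree p) - i) p"
proof -
  let ?d = "degree p"
  have "pairing a i (reflect_poly p) = (\<Sum>j\<le>?d. coeff (reflect_poly p) j * mirror a (i - int j))"
    by (rule conv_eq_sum) (rule degree_reflect_poly_le)
  also have "\<dots> = (\<Sum>j\<le>?d. coeff p (?d - j) * mirror a (i - int j))"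
    by (rule sum.cong) (auto simp: coeff_reflect_poly)
  also have "\<dots> = (\<Sum>j\<le>?d. coeff p j * mirror a (int ?d - i - int j))"
  proof (rule sum.reindex_bij_witness[of _ "\<lambda>j. ?d - j" "\<lambda>j. ?d - j"])
    fix j assume "j \<in> {..?d}"
    then have "int ?d - i - int (?d - j) = - (i - int j)" by simp
    then show "coeff p (?d - j) * mirror a (int ?d - i - int (?d - j)) = coeff p (?d - j) * mirror a (i - int j)"
      by (simp only: mirror_uminus)
  qed auto
  also have "\<dots> = pairing a (int ?d - i) p" by (rule conv_eq_sum[symmetric]) simp
  finally show ?thesis .
qed

lemma finite_bit_polys: "finite {p :: bit poly. degree p \<le> n}"
proof (induction n)
  case 0
  have "{p :: bit poly. degree p \<le> 0} \<subseteq> range (\<lambda>c. [:c:])" by (auto elim: degree_eq_zeroE)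
  moreover have "finite (range (\<lambda>c::bit. [:c:]))"
  proof (rule finite_subset)
    show "range (\<lambda>c::bit. [:c:]) \<subseteq> {[:0:], [:1:]}"
    proof
      fix p assume "p \<in> range (\<lambda>c::bit. [:c:])"
      then obtain c :: bit where "p = [:c:]" by blast
      then show "p \<in> {[:0:], [:1:]}" by (cases c) simp_all
    qed
  qed simp
  ultimately show ?case by (rule finite_subset)
next
  case (Suc n)
  have "{p :: bit poly. degree p \<le> Suc n} \<subseteq> (\<lambda>(c, q). pCons c q) ` ({0, 1} \<times> {q. degree q \<le> n})"
  proof
    fix p :: "bit poly" assume p: "p \<in> {p. degree p \<le> Suc n}"
    obtain c q where pc: "p = pCons c q" by (rule pCons_cases)
    have "degree q \<le> n" using p by (auto simp: pc split: if_splits)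
    moreover have "c \<in> {0, 1}" by (cases c) auto
    ultimately show "p \<in> (\<lambda>(c, q). pCons c q) ` ({0, 1} \<times> {q. degree q \<le> n})" using pc by force
  qed
  then show ?case by (rule finite_subset) (use Suc in auto)
qed

text \<open>If \<open>p\<close> is orthogonal to everything, then \<open>p\<close> times its reversal annihilates the whole mirror
  sequence.  Two powers of the indeterminate agree modulo this product, so the sequence is periodic.\<close>

lemma nonperiodic_imp_nondegenerate:
  assumes np: "\<not> periodic (mirror a)"
  shows "nondegenerate a"
  unfolding nondegenerate_def
proof (intro allI impI, rule ccontr)
  fix p :: "bit poly" assume p: "p \<noteq> 0" and "\<not> (\<exists>i. pairing a (int i) p = 1)"
  then have z: "pairing a i p = 0" if "i \<ge> 0" for i
    using that by (metis bit_not_one_iff nonneg_int_cases)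
  define q where "q = reflect_poly p * p"
  have q0: "q \<noteq> 0" using p by (simp add: q_def)
  have annih: "pairing a i q = 0" for i
  proof (cases "i \<ge> int (degree p)")
    case True
    show ?thesis unfolding q_def conv_mult
    proof (rule conv_vanish)
      fix j assume "j \<le> degree (reflect_poly p)"
      then show "pairing a (i - int j) p = 0"
        using True degree_reflect_poly_le[of p] by (intro z) linarith
    qed
  next
    case False
    show ?thesis unfolding q_def mult.commute[of _ p] conv_mult
    proof (rule conv_vanish)
      fix j assume "j \<le> degree p"
      then show "pairing a (i - int j) (reflect_poly p) = 0"
        unfolding pairing_reflect using False by (intro z) linarith
    qed
  qed
  have "range (\<lambda>i. monom 1 i mod q) \<subseteq> {r. degree r \<le> degree q}"
  proof
    fix r assume "r \<in> range (\<lambda>i. monom 1 i mod q)"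
    then obtain i where r: "r = monom 1 i mod q" by blast
    show "r \<in> {r. degree r \<le> degree q}"
      using degree_mod_less[OF q0, of "monom 1 i"] unfolding r[symmetric] by auto
  qed
  then have "finite (range (\<lambda>i::nat. monom 1 i mod q))"
    using finite_bit_polys finite_subset by blast
  then have "\<not> inj (\<lambda>i::nat. monom 1 i mod q)" using finite_imageD infinite_UNIV_nat by blast
  then obtain i j :: nat where ij: "i < j" "monom 1 i mod q = monom 1 j mod q"
  proof -
    obtain i' j' :: nat where "i' \<noteq> j'" "monom 1 i' mod q = monom 1 j' mod q"
      using \<open>\<not> inj (\<lambda>i::nat. monom 1 i mod q)\<close> by (auto simp: inj_def)
    then show thesis using that[of i' j'] that[of j' i'] by (cases "i' < j'") auto
  qed
  then have "q dvd monom 1 i - monom 1 j" by (simp add: mod_eq_dvd_iff)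
  then obtain h where h: "monom 1 i + monom 1 j = h * q" by (auto simp: dvd_def mult.commute)
  have "mirror a (n - int i) + mirror a (n - int j) = 0" for n
  proof -
    have "mirror a (n - int i) + mirror a (n - int j) = pairing a n (h * q)"
      by (simp add: h[symmetric] conv_add conv_monom)
    also have "\<dots> = 0" unfolding conv_mult by (rule conv_vanish) (rule annih)
    finally show ?thesis .
  qed
  then have eq: "mirror a (n - int i) = mirror a (n - int j)" for n
    by (cases "mirror a (n - int i)"; cases "mirror a (n - int j)") (metis add_0_left add_0_right zero_neq_one)+
  have "mirror a (n + int (j - i)) = mirror a n" for n
    using eq[of "n + int j"] ij(1) by (simp add: of_nat_diff algebra_simps)
  then have "periodic (mirror a)" unfolding periodic_def using ij(1) by (intro exI[of _ "int (j - i)"]) auto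
  with np show False by contradiction
qed

lemma alternating_sum:
  fixes f :: "nat \<Rightarrow> nat \<Rightarrow> bit"
  assumes "\<And>i j. f i j = f j i" "\<And>i. f i i = 0"
  shows "(\<Sum>i\<le>n. \<Sum>j\<le>n. f i j) = 0"
proof (induction n)
  case (Suc n)
  have "(\<Sum>i\<le>Suc n. \<Sum>j\<le>Suc n. f i j)
    = (\<Sum>i\<le>n. \<Sum>j\<le>n. f i j) + ((\<Sum>i\<le>n. f i (Suc n)) + (\<Sum>j\<le>n. f (Suc n) j)) + f (Suc n) (Suc n)"
    by (simp only: sum.atMost_Suc sum.distrib ac_simps)
  also have "(\<Sum>j\<le>n. f (Suc n) j) = (\<Sum>i\<le>n. f i (Suc n))" by (rule sum.cong) (auto simp: assms(1))
  finally show ?case by (simp only: Suc assms(2) bit_add_self add_0_left)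
qed (simp add: assms)

text \<open>The index 0 is superfluous for detecting non-zero words.  A word orthogonal to all other
  generators pairs with \<open>v\<^sub>0\<close> non-trivially; as the form is alternating, the word cannot contain
  \<open>v\<^sub>0\<close>, so it is a shifted word, orthogonal to everything after shifting back.\<close>

lemma nondegenerate_positive:
  assumes nd: "nondegenerate a" and a0: "a 0 = 0" and p: "p \<noteq> 0"
  shows "\<exists>i\<ge>1. pairing a (int i) p = 1"
proof (rule ccontr)
  assume "\<not> ?thesis"
  then have z: "pairing a (int i) p = 0" if "i \<ge> 1" for i using that by auto
  have "pairing a (int 0) p = 1"
    using nd p z unfolding nondegenerate_def by (metis One_nat_def Suc_leI bit_not_one_iff neq0_conv)
  moreover have "coeff p 0 * pairing a (int 0) p = 0"
  proof -
    let ?f = "\<lambda>i j. coeff p i * coeff p j * mirror a (int i - int j)"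
    have "coeff p 0 * pairing a (int 0) p = (\<Sum>i\<in>{0}. coeff p i * pairing a (int i) p)"
      by (simp only: sum.insert finite.emptyI empty_iff not_False_eq_True sum.empty add_0_right)
    also have "\<dots> = (\<Sum>i\<le>degree p. coeff p i * pairing a (int i) p)"
      by (rule sum.mono_neutral_left) (use z in auto)
    also have "\<dots> = (\<Sum>i\<le>degree p. \<Sum>j\<le>degree p. ?f i j)"
      by (simp only: conv_eq_sum[OF order_refl] sum_distrib_left mult.assoc)
    also have "\<dots> = 0"
    proof (rule alternating_sum)
      show "?f i j = ?f j i" for i j
        by (simp only: mirror_minus_commute[of a "int i" "int j"] mult.commute[of "coeff p i"])
      show "?f i i = 0" for i by (simp add: mirror_def a0)
    qed
    finally show ?thesis .
  qed
  ultimately have c0: "coeff p 0 = 0" by simp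
  obtain c q where pc: "p = pCons c q" by (rule pCons_cases)
  then have pq: "p = pCons 0 q" using c0 by simp
  have "pairing a (int i) q = 0" for i using z[of "Suc i"] by (simp add: pq)
  moreover have "q \<noteq> 0" using p pq by auto
  ultimately show False using nd unfolding nondegenerate_def by (metis zero_neq_one)
qed

text \<open>Pigeonhole: there are more words in the generators \<open>v\<^sub>0, \<dots>, v\<^sub>n\<close> than sign patterns on \<open>n\<close>
  generators, so two words have the same pattern, and their product commutes with these generators.\<close>

lemma exists_orthogonal_word:
  "\<exists>p::bit poly. p \<noteq> 0 \<and> degree p \<le> n \<and> (\<forall>i<n. pairing a (int i) p = 0)"
proof -
  define P where "P A = (\<Sum>j\<in>A. monom (1::bit) j)" for A :: "nat set"
  define \<phi> where "\<phi> A = {i. i < n \<and> pairing a (int i) (P A) = 1}" for A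
  have "\<phi> ` Pow {..n} \<subseteq> Pow {..<n}" by (auto simp: \<phi>_def)
  then have "card (\<phi> ` Pow {..n}) \<le> card (Pow {..<n})" by (intro card_mono) auto
  also have "\<dots> < card (Pow {..n})" by (simp add: card_Pow)
  finally have "\<not> inj_on \<phi> (Pow {..n})" by (rule pigeonhole)
  then obtain A B where AB: "A \<subseteq> {..n}" "B \<subseteq> {..n}" "\<phi> A = \<phi> B" "A \<noteq> B" by (auto simp: inj_on_def)
  have fin: "finite A" "finite B" using AB finite_subset by blast+
  have cP: "coeff (P A) j = (if j \<in> A then 1 else 0)" if "finite A" for A j
    using that by (simp add: P_def coeff_sum sum.delta)
  have "P A + P B \<noteq> 0"
  proof
    assume "P A + P B = 0"
    then have "P A = P B" by (simp add: bit_poly_add_eq_0)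
    then have "(if j \<in> A then 1 else 0::bit) = (if j \<in> B then 1 else 0)" for j
      using cP[OF fin(1)] cP[OF fin(2)] by metis
    then have "A = B" by (metis subsetI subset_antisym zero_neq_one)
    with AB show False by blast
  qed
  moreover have "degree (P A + P B) \<le> n"
    by (rule degree_le) (use AB fin in \<open>auto simp: cP\<close>)
  moreover have "pairing a (int i) (P A + P B) = 0" if "i < n" for i
  proof -
    have "pairing a (int i) (P A) = 1 \<longleftrightarrow> pairing a (int i) (P B) = 1"
      using AB(3) that unfolding \<phi>_def by blast
    then have "pairing a (int i) (P A) = pairing a (int i) (P B)" by (metis bit_not_one_iff)
    then show ?thesis by (simp add: conv_add)
  qed
  ultimately show ?thesis by blast
qed

text \<open>The words used for the perturbations.  A word supported on \<open>0..n\<close> that is orthogonal to the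
  generators below \<open>n\<close> but not to \<open>v\<^sub>n\<close> turns, after reversal, into one that pairs only with \<open>v\<^sub>0\<close>
  among the first generators; \<open>Suc m\<close> is the next generator with which it pairs.\<close>

lemma exists_perturbing_word:
  assumes nd: "nondegenerate a" and a0: "a 0 = 0"
  shows "\<exists>m\<ge>N. \<exists>z. degree z \<le> m \<and> pairing a 0 z = 1 \<and> (\<forall>i. 1 \<le> i \<and> i \<le> m \<longrightarrow> pairing a (int i) z = 0) \<and>
    pairing a (int (Suc m)) z = 1"
proof -
  obtain p where p: "p \<noteq> 0" "degree p \<le> N" "\<And>i. i < N \<Longrightarrow> pairing a (int i) p = 0"
    using exists_orthogonal_word[of N a] by blast
  define n where "n = (LEAST n. pairing a (int n) p = 1)"
  have ex: "\<exists>n. pairing a (int n) p = 1" using nd p(1) by (auto simp: nondegenerate_def)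
  have n1: "pairing a (int n) p = 1" unfolding n_def using ex by (rule LeastI_ex)
  have n0: "pairing a (int i) p = 0" if "i < n" for i
    using not_less_Least[of i "\<lambda>n. pairing a (int n) p = 1"] that unfolding n_def by simp
  have nN: "N \<le> n" using p(3)[of n] n1 by (metis not_le zero_neq_one)
  define z where "z = monom 1 (n - degree p) * reflect_poly p"
  have zp: "pairing a i z = pairing a (int n - i) p" for i
    unfolding z_def conv_mult conv_monom pairing_reflect using nN p(2) by (simp add: of_nat_diff algebra_simps)
  have z0: "z \<noteq> 0" using p(1) by (simp add: z_def)
  have dz: "degree z \<le> n"
  proof -
    have "degree z \<le> (n - degree p) + degree p"
      unfolding z_def using degree_mult_le[of "monom 1 (n - degree p)" "reflect_poly p"]
        degree_monom_le[of "1::bit" "n - degree p"] degree_reflect_poly_le[of p] by linarith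
    then show ?thesis using nN p(2) by simp
  qed
  have low: "pairing a (int i) z = 0" if "1 \<le> i" "i \<le> n" for i
  proof -
    have "int n - int i = int (n - i)" using that by simp
    then show ?thesis unfolding zp using n0[of "n - i"] that by simp
  qed
  define k where "k = (LEAST k. 1 \<le> k \<and> pairing a (int k) z = 1)"
  have exk: "\<exists>k. 1 \<le> k \<and> pairing a (int k) z = 1" using nondegenerate_positive[OF nd a0 z0] by auto
  have k: "1 \<le> k" "pairing a (int k) z = 1" using LeastI_ex[OF exk] unfolding k_def by auto
  have kl: "pairing a (int i) z = 0" if "1 \<le> i" "i < k" for i
    using not_less_Least[of i "\<lambda>k. 1 \<le> k \<and> pairing a (int k) z = 1"] that unfolding k_def by auto
  have "n < k" using low[of k] k by (metis not_le zero_neq_one)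
  then obtain m where m: "k = Suc m" "n \<le> m" by (metis Suc_le_eq less_Suc_eq_le not0_implies_Suc not_less0)
  show ?thesis
    using nN m dz k kl n1 zp[of 0] by (intro exI[of _ m] conjI exI[of _ z]) auto
qed

text \<open>Elimination of leading terms: adding the member \<open>r i\<close> of the same degree lowers the degree.\<close>

lemma triangular_span:
  fixes G :: "bit poly set"
  assumes 0: "0 \<in> G" and add: "\<And>p q. p \<in> G \<Longrightarrow> q \<in> G \<Longrightarrow> p + q \<in> G"
    and r: "\<And>i. r i \<in> G" "\<And>i. r i \<noteq> 0" "\<And>i. degree (r i) = i"
  shows "p \<in> G"
proof (induction "degree p" arbitrary: p rule: less_induct)
  case less
  show ?case
  proof (cases "p = 0")
    case False
    define q where "q = p + r (degree p)"
    have lead: "coeff (r (degree p)) (degree p) = 1"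
      using r(2)[of "degree p"] r(3)[of "degree p"] by (metis bit_not_zero_iff leading_coeff_neq_0)
    have leadp: "coeff p (degree p) = 1" using False by (metis bit_not_zero_iff leading_coeff_neq_0)
    have "q \<in> G"
    proof (cases "q = 0")
      case False
      have "degree q \<le> degree p" unfolding q_def by (rule degree_add_le) (auto simp: r)
      moreover have "coeff q (degree p) = 0" by (simp add: q_def lead leadp)
      ultimately have "degree q < degree p"
        using False by (metis le_neq_implies_less leading_coeff_neq_0)
      then show ?thesis by (rule less)
    qed (simp add: 0)
    then have "q + r (degree p) \<in> G" by (rule add) (rule r)
    then show ?thesis by (simp add: q_def add.assoc)
  qed (simp add: 0)
qed

section \<open>Rigidity: the bitstream is a conjugacy invariant\<close>

lemma unital_star_endoD:
  assumes "unital_star_endo M \<alpha>"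
  shows "T \<in> M \<Longrightarrow> \<alpha> T \<in> M" "\<alpha> id_blinfun = id_blinfun"
    "S \<in> M \<Longrightarrow> T \<in> M \<Longrightarrow> \<alpha> (S + T) = \<alpha> S + \<alpha> T"
    "T \<in> M \<Longrightarrow> \<alpha> (scalar_op c o\<^sub>L T) = scalar_op c o\<^sub>L \<alpha> T"
    "S \<in> M \<Longrightarrow> T \<in> M \<Longrightarrow> \<alpha> (S o\<^sub>L T) = \<alpha> S o\<^sub>L \<alpha> T"
    "T \<in> M \<Longrightarrow> \<alpha> (adj T) = adj (\<alpha> T)"
  using assms by (auto simp: unital_star_endo_def)

lemma (in vN_algebra) endo_scaleR:
  "unital_star_endo R \<alpha> \<Longrightarrow> T \<in> R \<Longrightarrow> \<alpha> (r *\<^sub>R T) = r *\<^sub>R \<alpha> T"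
  using unital_star_endoD(4)[of R \<alpha> T "of_real r"] by (simp add: scalar_op_of_real)

lemma (in vN_algebra) endo_minus:
  "unital_star_endo R \<alpha> \<Longrightarrow> T \<in> R \<Longrightarrow> \<alpha> (- T) = - \<alpha> T"
  using endo_scaleR[of \<alpha> T "-1"] by simp

lemma (in vN_algebra) endo_diff:
  "unital_star_endo R \<alpha> \<Longrightarrow> S \<in> R \<Longrightarrow> T \<in> R \<Longrightarrow> \<alpha> (S - T) = \<alpha> S - \<alpha> T"
  using unital_star_endoD(3)[of R \<alpha> S "- T"] endo_minus[of \<alpha> T] by (simp add: mem_minus)

lemma (in vN_algebra) endo_zero: "unital_star_endo R \<alpha> \<Longrightarrow> \<alpha> 0 = 0"
  using endo_scaleR[of \<alpha> id_blinfun 0] by simp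

lemma (in vN_algebra) endo_sum:
  assumes "unital_star_endo R \<alpha>" "\<And>i. i \<in> F \<Longrightarrow> f i \<in> R"
  shows "\<alpha> (\<Sum>i\<in>F. f i) = (\<Sum>i\<in>F. \<alpha> (f i))"
  using assms(2)
proof (induction F rule: infinite_finite_induct)
  case (insert i F)
  then show ?case using unital_star_endoD(3)[OF assms(1), of "f i" "\<Sum>i\<in>F. f i"] by (simp add: mem_sum)
qed (simp_all add: endo_zero[OF assms(1)])

lemma (in vN_algebra) word_in: "(\<And>i. v i \<in> R) \<Longrightarrow> word v p \<in> R"
proof -
  have "list_word v cs \<in> R" if "\<And>i. v i \<in> R" for v :: "nat \<Rightarrow> 'h \<Rightarrow>\<^sub>L 'h" and cs
    using that by (induction v cs rule: list_word.induct) auto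
  then show "(\<And>i. v i \<in> R) \<Longrightarrow> word v p \<in> R" by (simp add: word_def)
qed

lemma (in vN_algebra) endo_word:
  assumes \<alpha>: "unital_star_endo R \<alpha>" and v: "\<And>i. v i \<in> R"
  shows "\<alpha> (word v p) = word (\<lambda>i. \<alpha> (v i)) p"
  using v
proof (induction p arbitrary: v)
  case 0 show ?case by (simp add: unital_star_endoD(2)[OF \<alpha>])
next
  case (pCons c p)
  have "word (\<lambda>n. v (Suc n)) p \<in> R" by (rule word_in) (rule pCons.prems)
  then show ?case
    using pCons.prems pCons.IH[of "\<lambda>n. v (Suc n)"]
    by (simp add: word_pCons unital_star_endoD(2,5)[OF \<alpha>])
qed

lemma (in vN_algebra) endo_comb:
  assumes \<alpha>: "unital_star_endo R \<alpha>" and v: "\<And>i. v i \<in> R"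
  shows "\<alpha> (comb v F c) = comb (\<lambda>i. \<alpha> (v i)) F c"
  unfolding comb_def using word_in[OF v] v
  by (subst endo_sum[OF \<alpha>]) (auto simp: unital_star_endoD(4)[OF \<alpha>] endo_word[OF \<alpha>])

lemma (in vN_algebra) endo_power: "unital_star_endo R \<alpha> \<Longrightarrow> unital_star_endo R (\<alpha> ^^ k)"
proof (induction k)
  case 0 then show ?case by (simp add: unital_star_endo_def)
next
  case (Suc k)
  note A = unital_star_endoD[OF Suc.prems] and B = unital_star_endoD[OF Suc.IH[OF Suc.prems]]
  show ?case
    unfolding unital_star_endo_def
  proof (intro conjI ballI allI)
    show "(\<alpha> ^^ Suc k) ` R \<subseteq> R" by (auto simp: A(1) B(1))
    show "(\<alpha> ^^ Suc k) id_blinfun = id_blinfun" by (simp add: A(2) B(2))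
    fix S assume S: "S \<in> R"
    show "(\<alpha> ^^ Suc k) (adj S) = adj ((\<alpha> ^^ Suc k) S)" using S by (simp add: A(6) B(1,6))
    show "(\<alpha> ^^ Suc k) (scalar_op c o\<^sub>L S) = scalar_op c o\<^sub>L (\<alpha> ^^ Suc k) S" for c
      using S by (simp add: A(4) B(1,4))
    fix T assume T: "T \<in> R"
    show "(\<alpha> ^^ Suc k) (S + T) = (\<alpha> ^^ Suc k) S + (\<alpha> ^^ Suc k) T" using S T by (simp add: A(3) B(1,3))
    show "(\<alpha> ^^ Suc k) (S o\<^sub>L T) = (\<alpha> ^^ Suc k) S o\<^sub>L (\<alpha> ^^ Suc k) T" using S T by (simp add: A(5) B(1,5))
  qed
qed

lemma spin_system_endo:
  assumes vN: "vN_algebra R" and \<alpha>: "unital_star_endo R \<alpha>" and v: "\<And>i. v i \<in> R" and sp: "spin_system a v"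
  shows "spin_system a (\<lambda>i. \<alpha> (v i))"
proof -
  interpret vN_algebra R by fact
  show ?thesis
    unfolding spin_system_def
  proof (intro conjI allI)
    show "a 0 = 0" using spin_systemD(1)[OF sp] .
    fix i j
    show "\<alpha> (v i) \<in> clinear_ops" using unital_star_endoD(1)[OF \<alpha> v] clinear by blast
    show "adj (\<alpha> (v i)) = \<alpha> (v i)" using unital_star_endoD(6)[OF \<alpha> v, of i] spin_systemD(3)[OF sp] by simp
    show "\<alpha> (v i) o\<^sub>L \<alpha> (v i) = id_blinfun"
      using unital_star_endoD(5)[OF \<alpha> v v, of i i] spin_systemD(4)[OF sp] unital_star_endoD(2)[OF \<alpha>] by simp
    show "\<alpha> (v i) o\<^sub>L \<alpha> (v (i + j)) = sg (a j) *\<^sub>R (\<alpha> (v (i + j)) o\<^sub>L \<alpha> (v i))"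
      using v arg_cong[OF spin_systemD(5)[OF sp, of i j], of \<alpha>]
      by (simp add: unital_star_endoD(5)[OF \<alpha>] endo_scaleR[OF \<alpha>] mem_compose)
  qed
qed

context spin_generated
begin

text \<open>The composition of the trace with an endomorphism is a tracial state, hence the trace.  So
  endomorphisms are isometric for the 2-norm.\<close>

lemma endo_trace:
  assumes \<alpha>: "unital_star_endo R \<alpha>" and T: "T \<in> R"
  shows "\<tau> (\<alpha> T) = \<tau> T"
proof -
  note D = unital_star_endoD[OF \<alpha>]
  have "tracial_state R (\<lambda>T. \<tau> (\<alpha> T))"
    unfolding tracial_state_def
  proof (intro conjI ballI allI)
    show "\<tau> (\<alpha> id_blinfun) = 1" by (simp add: D t_id)
    fix S assume S: "S \<in> R"
    show "\<tau> (\<alpha> (scalar_op c o\<^sub>L S)) = c * \<tau> (\<alpha> S)" for c using S by (simp add: D(1,4) t_scalar)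
    show "\<tau> (\<alpha> (adj S o\<^sub>L S)) \<in> \<real>\<^sub>\<ge>\<^sub>0"
      using tau_pos[OF tracial, of "\<alpha> S"] S by (simp add: D mem_adj)
    fix T assume T: "T \<in> R"
    show "\<tau> (\<alpha> (S + T)) = \<tau> (\<alpha> S) + \<tau> (\<alpha> T)" using S T by (simp add: D t_add)
    show "\<tau> (\<alpha> (S o\<^sub>L T)) = \<tau> (\<alpha> (T o\<^sub>L S))" using S T t_commute[of "\<alpha> S" "\<alpha> T"] by (simp add: D)
  qed
  then show ?thesis using tracial_state_unique T by blast
qed

lemma endo_n2: "unital_star_endo R \<alpha> \<Longrightarrow> T \<in> R \<Longrightarrow> n2 (\<alpha> T) = n2 T"
  using endo_trace[of \<alpha> "adj T o\<^sub>L T"] unital_star_endoD(5,6)[of R \<alpha>]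
  by (simp add: n2_def mem_compose mem_adj)

lemma automorphism_spin_generated:
  assumes \<gamma>: "star_automorphism R \<gamma>"
  shows "spin_generated R \<tau> a (\<lambda>i. \<gamma> (v i))"
proof
  have e: "unital_star_endo R \<gamma>" and b: "bij_betw \<gamma> R R" using \<gamma> by (auto simp: star_automorphism_def)
  show "spin_system a (\<lambda>i. \<gamma> (v i))"
    by (rule spin_system_endo[OF vN_algebra_axioms e v_mem spin])
  show "nondegenerate a" by (rule nondeg)
  show "\<gamma> (v i) \<in> R" for i using unital_star_endoD(1)[OF e] by simp
  fix T and \<epsilon> :: real assume T: "T \<in> R" "\<epsilon> > 0"
  then obtain S where S: "S \<in> R" "T = \<gamma> S" using b by (auto simp: bij_betw_def)
  obtain F c where F: "finite F" "n2 (S - comb v F c) < \<epsilon>" using comb_dense[OF S(1) T(2)] by blast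
  have "T - comb (\<lambda>i. \<gamma> (v i)) F c = \<gamma> (S - comb v F c)"
    using S by (simp add: endo_diff[OF e] endo_comb[OF e])
  then have "n2 (T - comb (\<lambda>i. \<gamma> (v i)) F c) < \<epsilon>" using F S by (simp add: endo_n2[OF e] mem_diff)
  then show "\<exists>F c. finite F \<and> n2 (T - comb (\<lambda>i. \<gamma> (v i)) F c) < \<epsilon>" using F by blast
qed

end

text \<open>Passing to the 2-norm closure turns statements about the range into statements about approximation
  by words.\<close>

definition (in traced_algebra) range_closure :: "(('h \<Rightarrow>\<^sub>L 'h) \<Rightarrow> 'h \<Rightarrow>\<^sub>L 'h) \<Rightarrow> ('h \<Rightarrow>\<^sub>L 'h) set" where
  "range_closure \<alpha> = {T \<in> R. \<forall>e>0. \<exists>S\<in>R. n2 (T - \<alpha> S) < e}"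

context traced_algebra
begin

lemma range_closureD:
  assumes "T \<in> range_closure \<alpha>"
  shows "T \<in> R" "e > 0 \<Longrightarrow> \<exists>S\<in>R. n2 (T - \<alpha> S) < e"
  using assms by (auto simp: range_closure_def)

context
  fixes \<alpha> assumes \<alpha>: "unital_star_endo R \<alpha>"
begin

lemma range_closure_image: "S \<in> R \<Longrightarrow> \<alpha> S \<in> range_closure \<alpha>"
  unfolding range_closure_def
  by (intro CollectI conjI allI impI bexI[of _ S]) (simp_all add: n2_zero unital_star_endoD(1)[OF \<alpha>])

lemma range_closure_add:
  assumes S: "S \<in> range_closure \<alpha>" and T: "T \<in> range_closure \<alpha>"
  shows "S + T \<in> range_closure \<alpha>"
  unfolding range_closure_def
proof (intro CollectI conjI allI impI)
  show "S + T \<in> R" using S T by (auto simp: range_closure_def)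
  fix e :: real assume "e > 0"
  then have e2: "e / 2 > 0" by simp
  obtain S' T' where R: "S \<in> R" "T \<in> R" "S' \<in> R" "T' \<in> R" "n2 (S - \<alpha> S') < e/2" "n2 (T - \<alpha> T') < e/2"
    using range_closureD(1)[OF S] range_closureD(1)[OF T] range_closureD(2)[OF S e2] range_closureD(2)[OF T e2] by blast
  have eq: "(S + T) - \<alpha> (S' + T') = (S - \<alpha> S') + (T - \<alpha> T')"
    using R by (simp add: unital_star_endoD(3)[OF \<alpha>])
  have "n2 ((S + T) - \<alpha> (S' + T')) \<le> n2 (S - \<alpha> S') + n2 (T - \<alpha> T')"
    unfolding eq using R unital_star_endoD(1)[OF \<alpha>] by (intro n2_add mem_diff) auto
  then show "\<exists>U\<in>R. n2 (S + T - \<alpha> U) < e" using R by (intro bexI[of _ "S' + T'"]) auto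
qed

lemma range_closure_compose:
  assumes S: "S \<in> range_closure \<alpha>" and T: "T \<in> range_closure \<alpha>"
  shows "S o\<^sub>L T \<in> range_closure \<alpha>"
  unfolding range_closure_def
proof (intro CollectI conjI allI impI)
  have R: "S \<in> R" "T \<in> R" using S T by (auto simp: range_closure_def)
  then show "S o\<^sub>L T \<in> R" by auto
  fix e :: real assume e: "e > 0"
  have "e / (2 * (norm S + 1)) > 0" using e by (intro divide_pos_pos) (auto simp: add_nonneg_pos)
  then obtain T' where T': "T' \<in> R" "n2 (T - \<alpha> T') < e / (2 * (norm S + 1))"
    using T unfolding range_closure_def by blast
  have "e / (2 * (norm (\<alpha> T') + 1)) > 0" using e by (intro divide_pos_pos) (auto simp: add_nonneg_pos)
  then obtain S' where S': "S' \<in> R" "n2 (S - \<alpha> S') < e / (2 * (norm (\<alpha> T') + 1))"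
    using S unfolding range_closure_def by blast
  note \<alpha>R = unital_star_endoD(1)[OF \<alpha> S'(1)] unital_star_endoD(1)[OF \<alpha> T'(1)]
  have scale: "c * (e / (2 * (c + 1))) < e/2" if "c \<ge> 0" for c
    using that e by (simp add: divide_simps add_nonneg_pos)
  have "(S o\<^sub>L T) - \<alpha> (S' o\<^sub>L T') = (S o\<^sub>L (T - \<alpha> T')) + ((S - \<alpha> S') o\<^sub>L \<alpha> T')"
    using S' T' by (simp add: unital_star_endoD(5)[OF \<alpha>] compose_bilinear)
  then have "n2 ((S o\<^sub>L T) - \<alpha> (S' o\<^sub>L T')) \<le> n2 (S o\<^sub>L (T - \<alpha> T')) + n2 ((S - \<alpha> S') o\<^sub>L \<alpha> T')"
    using R \<alpha>R by (simp add: n2_add mem_compose mem_diff)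
  also have "\<dots> \<le> norm S * n2 (T - \<alpha> T') + n2 (S - \<alpha> S') * norm (\<alpha> T')"
    using R \<alpha>R by (intro add_mono n2_compose_left n2_compose_right mem_diff)
  also have "\<dots> \<le> norm S * (e / (2 * (norm S + 1))) + norm (\<alpha> T') * (e / (2 * (norm (\<alpha> T') + 1)))"
  proof (intro add_mono)
    show "norm S * n2 (T - \<alpha> T') \<le> norm S * (e / (2 * (norm S + 1)))"
      by (intro mult_left_mono less_imp_le[OF T'(2)]) simp
    show "n2 (S - \<alpha> S') * norm (\<alpha> T') \<le> norm (\<alpha> T') * (e / (2 * (norm (\<alpha> T') + 1)))"
      unfolding mult.commute[of "n2 (S - \<alpha> S')"] by (intro mult_left_mono less_imp_le[OF S'(2)]) simp
  qed
  also have "\<dots> < e/2 + e/2" by (intro add_strict_mono scale) auto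
  finally show "\<exists>U\<in>R. n2 ((S o\<^sub>L T) - \<alpha> U) < e" using S' T' by (intro bexI[of _ "S' o\<^sub>L T'"]) auto
qed

lemma range_closure_adj:
  assumes T: "T \<in> range_closure \<alpha>" shows "adj T \<in> range_closure \<alpha>"
  unfolding range_closure_def
proof (intro CollectI conjI allI impI)
  show "adj T \<in> R" using T by (auto simp: range_closure_def)
  fix e :: real assume "e > 0"
  then obtain S where S: "T \<in> R" "S \<in> R" "n2 (T - \<alpha> S) < e" using T unfolding range_closure_def by blast
  have "adj T - \<alpha> (adj S) = adj (T - \<alpha> S)"
    using S unital_star_endoD(1,6)[OF \<alpha>] by (simp add: adj_diff clinear)
  then have "n2 (adj T - \<alpha> (adj S)) < e" using S unital_star_endoD(1)[OF \<alpha>] by (simp add: n2_adj mem_diff)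
  then show "\<exists>U\<in>R. n2 (adj T - \<alpha> U) < e" using S by blast
qed

lemma range_closure_closed:
  assumes T: "T \<in> R" and a: "\<And>e. e > 0 \<Longrightarrow> \<exists>S\<in>range_closure \<alpha>. n2 (T - S) < e"
  shows "T \<in> range_closure \<alpha>"
  unfolding range_closure_def
proof (intro CollectI conjI allI impI T)
  fix e :: real assume "e > 0"
  then obtain S where S: "S \<in> range_closure \<alpha>" "n2 (T - S) < e/2" using a[of "e/2"] by auto
  then obtain U where U: "S \<in> R" "U \<in> R" "n2 (S - \<alpha> U) < e/2"
    using \<open>e > 0\<close> range_closureD(1)[OF S(1)] range_closureD(2)[OF S(1), of "e/2"] by auto
  have "n2 ((T - S) + (S - \<alpha> U)) \<le> n2 (T - S) + n2 (S - \<alpha> U)"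
    using T U unital_star_endoD(1)[OF \<alpha>] by (intro n2_add) auto
  then show "\<exists>U\<in>R. n2 (T - \<alpha> U) < e" using U S by (intro bexI[of _ U]) auto
qed

lemma range_closure_scalar: "scalar_op c \<in> range_closure \<alpha>"
proof -
  have "\<alpha> (scalar_op c o\<^sub>L id_blinfun) = scalar_op c"
    unfolding unital_star_endoD(4)[OF \<alpha> mem_id] unital_star_endoD(2)[OF \<alpha>] by simp
  then show ?thesis using range_closure_image[of "scalar_op c o\<^sub>L id_blinfun"] by auto
qed

lemma range_closure_scaleR: "T \<in> range_closure \<alpha> \<Longrightarrow> r *\<^sub>R T \<in> range_closure \<alpha>"
  using range_closure_compose[OF range_closure_scalar[of "of_real r"]] by (metis scalar_op_of_real)

lemma range_closure_pm: "pm S T \<Longrightarrow> S \<in> range_closure \<alpha> \<Longrightarrow> T \<in> range_closure \<alpha>"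
  using range_closure_scaleR[of S "-1"] by (auto simp: pm_def)

end

end

lemma iterate_shift: "(\<And>i. \<alpha> (v i) = v (Suc i)) \<Longrightarrow> (\<alpha> ^^ k) (v i) = v (i + k)"
  by (induction k arbitrary: i) (simp_all add: funpow_swap1)

lemma word_shift: "word (\<lambda>n. v (n + k)) p = word v (monom 1 k * p)"
proof (induction k arbitrary: v)
  case (Suc k)
  have "monom 1 (Suc k) * p = pCons 0 (monom (1::bit) k * p)" by (simp add: monom_Suc)
  then show ?case using Suc[of "\<lambda>n. v (Suc n)"] by simp
qed (simp add: monom_0 one_pCons[symmetric])

text \<open>A conjugacy between two binary shifts turns the generators of one of them into a second generating
  sequence \<open>u\<close> for the other.\<close>

locale two_generators = v: spin_generated R \<tau> a v + u: spin_generated R \<tau> b u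
  for R :: "('h::complex_hilbert_space \<Rightarrow>\<^sub>L 'h) set" and \<tau> a v b u +
  fixes \<alpha> assumes endo: "unital_star_endo R \<alpha>"
    and \<alpha>v: "\<And>i. \<alpha> (v i) = v (Suc i)" and \<alpha>u: "\<And>i. \<alpha> (u i) = u (Suc i)"
begin

abbreviation H :: "nat \<Rightarrow> ('h \<Rightarrow>\<^sub>L 'h) set" where "H k \<equiv> v.range_closure (\<alpha> ^^ k)"

lemma endo_k: "unital_star_endo R (\<alpha> ^^ k)"
  by (rule v.endo_power[OF endo])

lemma v_shift: "(\<alpha> ^^ k) (v i) = v (i + k)"
  by (rule iterate_shift[of \<alpha> v]) (rule \<alpha>v)

lemma u_shift: "(\<alpha> ^^ k) (u i) = u (i + k)"
  by (rule iterate_shift[of \<alpha> u]) (rule \<alpha>u)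

text \<open>In the 2-norm, an element of \<open>H k\<close> is a limit of combinations of words in the generators from
  \<open>v\<^sub>k\<close> on, and coefficients are continuous.\<close>

lemma H_coef:
  assumes T: "T \<in> H k" and p: "v.coef p T \<noteq> 0"
  shows "\<exists>q. p = monom 1 k * q"
proof (rule ccontr)
  assume np: "\<not> ?thesis"
  have "cmod (v.coef p T) \<le> 0 + e" if e: "e > 0" for e
  proof -
    obtain S where S: "S \<in> R" "T \<in> R" "v.n2 (T - (\<alpha> ^^ k) S) < e/2"
      using e v.range_closureD(1)[OF T] v.range_closureD(2)[OF T, of "e/2"] by auto
    obtain F c where F: "finite F" "v.n2 (S - comb v F c) < e/2" using v.comb_dense[OF S(1), of "e/2"] e by auto
    have img: "(\<alpha> ^^ k) (comb v F c) = (\<Sum>q\<in>F. scalar_op (c q) o\<^sub>L word v (monom 1 k * q))"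
      unfolding v.endo_comb[OF endo_k v.v_mem] unfolding v_shift comb_def word_shift ..
    have "v.coef p ((\<alpha> ^^ k) (comb v F c)) = 0"
      unfolding img using np
      by (subst v.coef_sum) (auto simp: v.coef_scalar v.coef_word intro!: sum.neutral)
    moreover have aR: "(\<alpha> ^^ k) (comb v F c) \<in> R" "(\<alpha> ^^ k) S \<in> R"
      using unital_star_endoD(1)[OF endo_k] S by auto
    ultimately have "v.coef p T = v.coef p (T - (\<alpha> ^^ k) (comb v F c))" using S by (simp add: v.coef_diff)
    then have "cmod (v.coef p T) \<le> v.n2 (T - (\<alpha> ^^ k) (comb v F c))" using v.coef_le S aR by (simp add: v.mem_diff)
    also have "T - (\<alpha> ^^ k) (comb v F c) = (T - (\<alpha> ^^ k) S) + (\<alpha> ^^ k) (S - comb v F c)"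
      using S by (simp add: v.endo_diff[OF endo_k])
    also have "v.n2 \<dots> \<le> v.n2 (T - (\<alpha> ^^ k) S) + v.n2 ((\<alpha> ^^ k) (S - comb v F c))"
      using S(2) aR(2) unital_star_endoD(1)[OF endo_k v.mem_diff[OF S(1) v.comb_mem]]
      by (intro v.n2_add v.mem_diff)
    also have "\<dots> \<le> e/2 + e/2"
      using S F v.endo_n2[OF endo_k, of "S - comb v F c"] by (intro add_mono) (auto simp: v.mem_diff)
    finally show ?thesis by simp
  qed
  then have "cmod (v.coef p T) \<le> 0" by (rule field_le_epsilon)
  with p show False by simp
qed

text \<open>\<open>H k\<close> is also the closed span of the words in \<open>u\<^sub>i\<close>, \<open>i \<ge> k\<close>, and conjugation by \<open>u\<^sub>0\<close> changes these
  only by signs.\<close>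

lemma H_conjugate:
  assumes S: "S \<in> R"
  shows "u 0 o\<^sub>L ((\<alpha> ^^ k) S o\<^sub>L u 0) \<in> H k"
proof (rule v.range_closure_closed[OF endo_k])
  have aR: "(\<alpha> ^^ k) S \<in> R" using unital_star_endoD(1)[OF endo_k] S by auto
  show "u 0 o\<^sub>L ((\<alpha> ^^ k) S o\<^sub>L u 0) \<in> R" using aR by (intro v.mem_compose u.v_mem)
  fix e :: real assume "e > 0"
  then obtain F c where F: "finite F" "v.n2 (S - comb u F c) < e" using u.comb_dense[OF S] by blast
  define c' where "c' q = c q * of_real (sg (pairing b (int 0) (monom 1 k * q)))" for q
  have img: "(\<alpha> ^^ k) (comb u F d) = (\<Sum>q\<in>F. scalar_op (d q) o\<^sub>L word u (monom 1 k * q))" for d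
    unfolding v.endo_comb[OF endo_k u.v_mem] unfolding u_shift comb_def word_shift ..
  have "u 0 o\<^sub>L ((\<alpha> ^^ k) (comb u F c) o\<^sub>L u 0) = (\<alpha> ^^ k) (comb u F c')"
  proof (rule blinfun_eqI)
    fix x
    have "u 0 (scalar_op (c q) (word u (monom 1 k * q) (u 0 x))) = scalar_op (c' q) (word u (monom 1 k * q) x)" for q
      by (simp add: clinear_opsD[OF spin_systemD(2)[OF u.spin]] c'_def spin_square_apply[OF u.spin]
          spin_commute_word_apply[OF u.spin, of 0, simplified] scaleR_eq_scaleC scaleC_scaleC)
    then show "(u 0 o\<^sub>L ((\<alpha> ^^ k) (comb u F c) o\<^sub>L u 0)) x = (\<alpha> ^^ k) (comb u F c') x"
      by (simp add: img blinfun.sum_left blinfun.sum_right)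
  qed
  then have "(u 0 o\<^sub>L ((\<alpha> ^^ k) S o\<^sub>L u 0)) - (\<alpha> ^^ k) (comb u F c')
    = u 0 o\<^sub>L ((\<alpha> ^^ k) (S - comb u F c) o\<^sub>L u 0)"
    using S by (simp add: v.endo_diff[OF endo_k] compose_bilinear)
  moreover have "v.n2 (u 0 o\<^sub>L ((\<alpha> ^^ k) (S - comb u F c) o\<^sub>L u 0)) < e"
  proof -
    define X where "X = (\<alpha> ^^ k) (S - comb u F c)"
    have X: "X \<in> R" "v.n2 X < e"
      using unital_star_endoD(1)[OF endo_k] v.endo_n2[OF endo_k] S F by (auto simp: X_def v.mem_diff)
    have "v.n2 (u 0 o\<^sub>L (X o\<^sub>L u 0)) \<le> norm (u 0) * v.n2 (X o\<^sub>L u 0)"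
      using X by (intro v.n2_compose_left) auto
    also have "\<dots> \<le> 1 * (v.n2 X * norm (u 0))"
      using X spin_norm_le[OF u.spin, of 0] by (intro mult_mono v.n2_compose_right v.n2_nonneg) auto
    also have "\<dots> \<le> 1 * (v.n2 X * 1)"
      using X spin_norm_le[OF u.spin, of 0] by (intro mult_left_mono v.n2_nonneg) auto
    finally show ?thesis using X by (simp add: X_def)
  qed
  ultimately show "\<exists>V\<in>H k. v.n2 ((u 0 o\<^sub>L ((\<alpha> ^^ k) S o\<^sub>L u 0)) - V) < e"
    using v.range_closure_image[OF endo_k, of "comb u F c'"] by (intro bexI[of _ "(\<alpha> ^^ k) (comb u F c')"]) auto
qed

lemma H_generator: "k \<le> i \<Longrightarrow> v i \<in> H k"
  using v.range_closure_image[OF endo_k, of "v (i - k)" k] by (simp add: v_shift)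

lemma H_conjugate_generator: "k \<le> i \<Longrightarrow> u 0 o\<^sub>L (v i o\<^sub>L u 0) \<in> H k"
  using H_conjugate[of "v (i - k)" k] by (simp add: v_shift)

text \<open>By induction \<open>y = v\<^sub>p\<^sup>* u\<^sub>0\<close> lies in \<open>H k\<close>, so only words in the generators from \<open>v\<^sub>k\<close> on occur in it;
  conjugation by the \<open>v\<^sub>i\<close> with \<open>i > k\<close> separates these from the empty word.  Averaging over such
  conjugations isolates the constant term of \<open>y\<close>, which is non-zero, and does not leave
  \<open>y H (k+1)\<close>, because conjugation by \<open>u\<^sub>0\<close> preserves \<open>H (k+1)\<close>.  Hence \<open>y\<^sup>*\<close> lies in \<open>H (k+1)\<close>.\<close>

lemma occurring_words:
  assumes "v.coef p (u 0) \<noteq> 0"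
  shows "u 0 o\<^sub>L word v p \<in> H k"
  using assms
proof (induction k arbitrary: p)
  case 0
  have "u 0 o\<^sub>L word v p \<in> R" by auto
  then have "(\<alpha> ^^ 0) (u 0 o\<^sub>L word v p) \<in> H 0" by (rule v.range_closure_image[OF endo_k])
  then show ?case unfolding funpow_0 .
next
  case (Suc k)
  define y where "y = adj (word v p) o\<^sub>L u 0"
  have yR: "y \<in> R" by (auto simp: y_def)
  have u0: "adj (u 0) = u 0" "u 0 o\<^sub>L u 0 = id_blinfun" using spin_systemD[OF u.spin] by auto
  note cu = spin_systemD(2)[OF u.spin] and cw = word_clinear[OF v.spin] adj_clinear[OF word_clinear[OF v.spin]]
  have ay: "adj y = u 0 o\<^sub>L word v p" using cu cw by (simp add: y_def adj_compose adj_adj u0)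
  have yH: "y \<in> H k"
    using v.range_closure_adj[OF endo_k Suc.IH[OF Suc.prems]] cu cw by (simp add: y_def adj_compose u0)
  have c0: "v.coef 0 y = v.coef p (u 0)" by (simp add: v.coef_def y_def)
  have sep: "\<exists>i\<in>{Suc k..}. pairing a (int i) q \<noteq> pairing a (int i) 0" if q: "v.coef q y \<noteq> 0" "q \<noteq> 0" for q
  proof -
    obtain r where r: "q = monom 1 k * r" using H_coef[OF yH q(1)] by blast
    then have "r \<noteq> 0" using q by auto
    then obtain j where j: "j \<ge> 1" "pairing a (int j) r = 1"
      using nondegenerate_positive[OF v.nondeg] spin_systemD(1)[OF v.spin] by blast
    have "pairing a (int (j + k)) q = 1" by (simp add: r conv_mult conv_monom j)
    then show ?thesis using j by (intro bexI[of _ "j + k"]) auto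
  qed
  define W where "W = {X \<in> R. adj y o\<^sub>L X \<in> H (Suc k)}"
  have yy: "adj y o\<^sub>L y = id_blinfun"
  proof (rule blinfun_eqI)
    fix x
    show "(adj y o\<^sub>L y) x = id_blinfun x"
      using blinfun_compose_eqD[OF word_unitary(2)[OF v.spin, of p]] blinfun_compose_eqD[OF u0(2)]
      by (simp add: ay) (simp add: y_def)
  qed
  have yW: "y \<in> W"
    using yR v.range_closure_scalar[OF endo_k, of 1 "Suc k"] by (simp add: W_def yy)
  have W_step: "v.project_sign 0 i X \<in> W" if i: "i \<in> {Suc k..}" and X: "X \<in> W" for i X
  proof -
    have XR: "X \<in> R" and XH: "adj y o\<^sub>L X \<in> H (Suc k)" using X by (auto simp: W_def)
    have pmy: "pm (adj y o\<^sub>L (v i o\<^sub>L y)) (u 0 o\<^sub>L (v i o\<^sub>L u 0))"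
    proof -
      have "word v p o\<^sub>L (v i o\<^sub>L adj (word v p)) = sg (pairing a (int i) p) *\<^sub>R v i"
      proof (rule blinfun_eqI)
        fix x
        have "sg (pairing a (int i) p) *\<^sub>R v i x = sg (pairing a (int i) p) *\<^sub>R v i (word v p (adj (word v p) x))"
          using blinfun_compose_eqD[OF word_unitary(2)[OF v.spin, of p], of x] by simp
        also have "\<dots> = word v p (v i (adj (word v p) x))"
          by (simp add: spin_commute_word_apply[OF v.spin])
        finally show "(word v p o\<^sub>L (v i o\<^sub>L adj (word v p))) x = (sg (pairing a (int i) p) *\<^sub>R v i) x"
          by (simp add: blinfun.scaleR_left)
      qed
      then have "adj y o\<^sub>L (v i o\<^sub>L y) = sg (pairing a (int i) p) *\<^sub>R (u 0 o\<^sub>L (v i o\<^sub>L u 0))"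
        unfolding ay unfolding y_def blinfun_eq_iff
        by (auto simp: blinfun.bilinear_simps)
      then show ?thesis using pm_scaleR by metis
    qed
    have "u 0 o\<^sub>L (v i o\<^sub>L u 0) \<in> H (Suc k)" using i by (intro H_conjugate_generator) auto
    then have 1: "adj y o\<^sub>L (v i o\<^sub>L y) \<in> H (Suc k)"
      using v.range_closure_pm[OF endo_k pm_sym[OF pmy]] by blast
    have 2: "v i \<in> H (Suc k)" using i by (intro H_generator) auto
    have "y o\<^sub>L adj y = id_blinfun"
    proof (rule blinfun_eqI)
      fix x
      show "(y o\<^sub>L adj y) x = id_blinfun x"
        using blinfun_compose_eqD[OF word_unitary(1)[OF v.spin, of p]] blinfun_compose_eqD[OF u0(2)]
        by (simp add: ay) (simp add: y_def)
    qed
    note yy' = blinfun_compose_eqD[OF this]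
    have "(adj y o\<^sub>L (v i o\<^sub>L y)) o\<^sub>L ((adj y o\<^sub>L X) o\<^sub>L v i) \<in> H (Suc k)"
      by (intro v.range_closure_compose[OF endo_k] 1 2 XH)
    also have "(adj y o\<^sub>L (v i o\<^sub>L y)) o\<^sub>L ((adj y o\<^sub>L X) o\<^sub>L v i) = adj y o\<^sub>L (v i o\<^sub>L (X o\<^sub>L v i))"
      by (rule blinfun_eqI) (simp add: yy')
    finally have 3: "adj y o\<^sub>L (v i o\<^sub>L (X o\<^sub>L v i)) \<in> H (Suc k)" .
    have "adj y o\<^sub>L v.project_sign 0 i X = (1/2) *\<^sub>R ((adj y o\<^sub>L X) + (adj y o\<^sub>L (v i o\<^sub>L (X o\<^sub>L v i))))"
      by (simp add: v.project_sign_def compose_bilinear)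
    also have "\<dots> \<in> H (Suc k)"
      by (intro v.range_closure_scaleR[OF endo_k] v.range_closure_add[OF endo_k] XH 3)
    finally show ?thesis using XR by (auto simp: W_def)
  qed
  let ?c = "v.coef p (u 0)"
  have "scalar_op ?c o\<^sub>L adj y \<in> H (Suc k)"
  proof (rule v.range_closure_closed[OF endo_k])
    show "scalar_op ?c o\<^sub>L adj y \<in> R" using yR by auto
    fix e :: real assume "e > 0"
    then obtain X where X: "X \<in> W" "v.n2 (X - (scalar_op (v.coef 0 y) o\<^sub>L word v 0)) < e"
      using v.extract_word[OF yR sep _ yW W_step] unfolding W_def by blast
    have XR: "X \<in> R" and XH: "adj y o\<^sub>L X \<in> H (Suc k)" using X by (auto simp: W_def)
    have ny: "norm (adj y) \<le> 1"
    proof -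
      have "norm (adj y) \<le> norm (u 0) * norm (word v p)" unfolding ay by (rule norm_blinfun_compose)
      also have "\<dots> \<le> 1 * 1" by (intro mult_mono spin_norm_le[OF u.spin] word_norm_le[OF v.spin]) auto
      finally show ?thesis by simp
    qed
    have "(scalar_op ?c o\<^sub>L adj y) - (adj y o\<^sub>L X) = - (adj y o\<^sub>L (X - scalar_op ?c))"
      using scalar_op_commute[OF adj_clinear[OF v.clinear[OF yR]]] by (simp add: compose_bilinear)
    then have "v.n2 ((scalar_op ?c o\<^sub>L adj y) - (adj y o\<^sub>L X)) = v.n2 (adj y o\<^sub>L (X - scalar_op ?c))"
      using XR yR by (simp add: v.n2_minus v.mem_compose v.mem_diff v.mem_adj)
    also have "\<dots> \<le> norm (adj y) * v.n2 (X - scalar_op ?c)"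
      using XR yR by (intro v.n2_compose_left) auto
    also have "\<dots> \<le> 1 * v.n2 (X - scalar_op ?c)"
      using XR ny by (intro mult_right_mono v.n2_nonneg) auto
    also have "\<dots> < e" using X(2) by (simp add: c0)
    finally show "\<exists>S\<in>H (Suc k). v.n2 ((scalar_op ?c o\<^sub>L adj y) - S) < e" using XH by blast
  qed
  from v.range_closure_compose[OF endo_k v.range_closure_scalar[OF endo_k, of "1 / ?c"] this]
  show ?case using Suc.prems by (simp add: blinfun_compose_assoc[symmetric] scalar_op_mult ay del: funpow.simps)
qed

text \<open>A non-empty word has finite degree, so it occurs in no element of \<open>H k\<close> for large \<open>k\<close>.  An element of
  all \<open>H k\<close>, such as the product of \<open>u\<^sub>0\<close> with a word that occurs in it, is therefore scalar.\<close>

lemma generator_is_word: "\<exists>p c. c \<noteq> 0 \<and> u 0 = scalar_op c o\<^sub>L word v p"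
proof -
  have u0: "u 0 o\<^sub>L u 0 = id_blinfun" using spin_systemD[OF u.spin] by auto
  have "u 0 \<noteq> 0"
  proof
    assume "u 0 = 0"
    then have "v.n2 id_blinfun = v.n2 0" using u0 by (simp add: compose_bilinear)
    then show False by (simp add: v.n2_id v.n2_zero)
  qed
  then obtain p where p: "v.coef p (u 0) \<noteq> 0" using v.coef_eq_0D[of "u 0"] by auto
  define T where "T = u 0 o\<^sub>L word v p"
  define c where "c = v.coef 0 T"
  have TR: "T \<in> R" by (auto simp: T_def)
  have coef0: "v.coef q T = 0" if "q \<noteq> 0" for q
  proof (rule ccontr)
    assume "v.coef q T \<noteq> 0"
    then obtain r where r: "q = monom 1 (Suc (degree q)) * r"
      using H_coef[of T "Suc (degree q)" q] occurring_words[OF p] unfolding T_def by blast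
    then have "r \<noteq> 0" using that by auto
    then have "degree q = Suc (degree q) + degree r"
      by (subst r) (simp add: degree_mult_eq degree_monom_eq)
    then show False by simp
  qed
  have "v.coef q (T - (scalar_op c o\<^sub>L word v 0)) = 0" for q
    using TR coef0[of q] by (simp add: v.coef_diff v.mem_compose v.coef_scalar v.coef_word c_def del: word_0)
  then have "T - (scalar_op c o\<^sub>L word v 0) = 0" using TR by (intro v.coef_eq_0D) auto
  then have Tc: "T = scalar_op c" by simp
  have w: "word v p = scalar_op c o\<^sub>L u 0"
  proof (rule blinfun_eqI)
    fix x
    have "word v p x = u 0 (T x)" using blinfun_compose_eqD[OF u0] by (simp add: T_def)
    then show "word v p x = (scalar_op c o\<^sub>L u 0) x"
      by (simp add: Tc clinear_opsD[OF spin_systemD(2)[OF u.spin]])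
  qed
  have "c \<noteq> 0"
  proof
    assume "c = 0"
    then have "v.n2 (word v p) = 0" using w by (simp add: compose_bilinear v.n2_zero)
    then show False by (simp add: v.n2_word)
  qed
  moreover from this have "u 0 = scalar_op (1 / c) o\<^sub>L word v p"
    by (simp add: w blinfun_compose_assoc[symmetric] scalar_op_mult)
  ultimately show ?thesis by (intro exI[of _ p] exI[of _ "1 / c"]) simp
qed

text \<open>Since the shift is multiplication by the indeterminate, the \<open>u\<close>-word of \<open>q\<close> is a multiple of the
  \<open>v\<close>-word of \<open>q p\<close>.\<close>

lemma words_are_words:
  assumes u0: "u 0 = scalar_op c o\<^sub>L word v p" and c: "c \<noteq> 0"
  shows "\<exists>d. d \<noteq> 0 \<and> word u q = scalar_op d o\<^sub>L word v (q * p)"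
proof (induction q)
  case 0 show ?case by (rule exI[of _ 1]) simp
next
  case (pCons e q)
  then obtain d where d: "d \<noteq> 0" "word u q = scalar_op d o\<^sub>L word v (q * p)" by blast
  have "word (\<lambda>n. u (Suc n)) q = \<alpha> (word u q)" using v.endo_word[OF endo u.v_mem] \<alpha>u by simp
  also have "\<dots> = scalar_op d o\<^sub>L word v (pCons 0 (q * p))"
    unfolding d(2) using v.endo_word[OF endo v.v_mem] \<alpha>v by (simp add: unital_star_endoD(4)[OF endo])
  finally have W: "word (\<lambda>n. u (Suc n)) q = scalar_op d o\<^sub>L word v (pCons 0 (q * p))" .
  show ?case
  proof (cases "e = 0")
    case True
    then show ?thesis using d(1) W by (intro exI[of _ d]) simp
  next
    case False
    then have 1: "e = 1" by simp
    have m: "pCons e q * p = p + pCons 0 (q * p)" using 1 by simp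
    have "pm (word v p o\<^sub>L word v (pCons 0 (q * p))) (word v (pCons e q * p))"
      unfolding m by (rule word_mult[OF v.spin])
    then obtain s :: complex where s: "s \<noteq> 0"
      "word v p o\<^sub>L word v (pCons 0 (q * p)) = scalar_op s o\<^sub>L word v (pCons e q * p)"
      unfolding pm_def
    proof
      assume "word v p o\<^sub>L word v (pCons 0 (q * p)) = word v (pCons e q * p)"
      then show thesis by (intro that[of 1]) simp_all
    next
      assume "word v p o\<^sub>L word v (pCons 0 (q * p)) = - word v (pCons e q * p)"
      then show thesis by (intro that[of "-1"]) (simp_all add: scalar_op_minus compose_bilinear)
    qed
    have "word u (pCons e q) = scalar_op (c * d * s) o\<^sub>L word v (pCons e q * p)"
    proof (rule blinfun_eqI)
      fix x
      have "word u (pCons e q) x = scalar_op c (word v p (scalar_op d (word v (pCons 0 (q * p)) x)))"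
        using 1 by (simp add: word_pCons[of u] W u0)
      also have "\<dots> = scalar_op (c * d) (word v p (word v (pCons 0 (q * p)) x))"
        by (simp add: clinear_opsD[OF word_clinear[OF v.spin]] scaleC_scaleC)
      also have "\<dots> = scalar_op (c * d * s) (word v (pCons e q * p) x)"
        unfolding blinfun_compose_eqD[OF s(2)] by (simp add: scaleC_scaleC)
      finally show "word u (pCons e q) x = (scalar_op (c * d * s) o\<^sub>L word v (pCons e q * p)) x" by simp
    qed
    then show ?thesis using c d(1) s(1) by (intro exI[of _ "c * d * s"]) simp
  qed
qed

end

context two_generators
begin

text \<open>\<open>u\<^sub>0\<close> is a multiple of the word of some \<open>p\<close>, and \<open>v\<^sub>0\<close> of the \<open>u\<close>-word of some \<open>q\<close>.  As the shift
  is multiplication by the indeterminate, \<open>q p = 1\<close>, hence \<open>p = 1\<close>.\<close>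

theorem bitstreams_agree: "a = b"
proof -
  interpret flip: two_generators R \<tau> b u a v \<alpha>
    by unfold_locales (rule endo, rule \<alpha>u, rule \<alpha>v)
  obtain p c where p: "c \<noteq> 0" "u 0 = scalar_op c o\<^sub>L word v p" using generator_is_word by blast
  obtain q d where q: "d \<noteq> 0" "v 0 = scalar_op d o\<^sub>L word u q" using flip.generator_is_word by blast
  obtain e where e: "e \<noteq> 0" "word u q = scalar_op e o\<^sub>L word v (q * p)" using words_are_words[OF p(2,1)] by blast
  have "word v 1 = scalar_op (d * e) o\<^sub>L word v (q * p)"
    using q(2) e(2) by (simp add: blinfun_compose_assoc[symmetric] scalar_op_mult)
  then have "v.coef 1 (word v 1) = d * e * v.coef 1 (word v (q * p))"
    by (metis v.coef_scalar v.word_mem)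
  then have "q * p = 1" unfolding v.coef_word by (auto split: if_splits)
  then have "degree p = 0" "p \<noteq> 0"
    by (metis add_is_0 degree_1 degree_mult_eq mult_zero_left mult_zero_right zero_neq_one) (use \<open>q * p = 1\<close> in auto)
  then obtain f where "p = [:f:]" "f \<noteq> 0" using degree_eq_zeroE by (metis pCons_0_0)
  then have "p = 1" by (simp add: one_pCons)
  then have u0: "u 0 = scalar_op c o\<^sub>L v 0" using p by simp
  have uj: "u j = scalar_op c o\<^sub>L v j" for j
  proof -
    have "u j = (\<alpha> ^^ j) (scalar_op c o\<^sub>L v 0)" using u_shift[of j 0] u0 by simp
    also have "\<dots> = scalar_op c o\<^sub>L v j" using v_shift[of j 0] by (simp add: unital_star_endoD(4)[OF endo_k])
    finally show ?thesis .
  qed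
  show "a = b"
  proof
    fix j
    have cv: "v i (scalar_op c x) = scalar_op c (v i x)" for i x
      by (simp add: clinear_opsD[OF spin_systemD(2)[OF v.spin]])
    define X where "X = v j o\<^sub>L v 0"
    have "scalar_op (c * c) o\<^sub>L (sg (a j) *\<^sub>R X) = scalar_op (c * c) o\<^sub>L (sg (b j) *\<^sub>R X)"
    proof -
      have "scalar_op (c * c) o\<^sub>L (sg (a j) *\<^sub>R X) = scalar_op (c * c) o\<^sub>L (v 0 o\<^sub>L v j)"
        using spin_systemD(5)[OF v.spin, of 0 j] by (simp add: X_def)
      also have "\<dots> = u 0 o\<^sub>L u j" unfolding uj
        by (rule blinfun_eqI) (simp add: scaleC_scaleC clinear_opsD[OF spin_systemD(2)[OF v.spin]])
      also have "\<dots> = sg (b j) *\<^sub>R (u j o\<^sub>L u 0)" using spin_systemD(5)[OF u.spin, of 0 j] by simp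
      also have "\<dots> = scalar_op (c * c) o\<^sub>L (sg (b j) *\<^sub>R X)" unfolding uj X_def
        by (rule blinfun_eqI) (simp add: scaleC_scaleC blinfun.bilinear_simps scaleC_scaleR clinear_opsD[OF spin_systemD(2)[OF v.spin]])
      finally show ?thesis .
    qed
    then have "scalar_op (1 / (c * c)) o\<^sub>L (scalar_op (c * c) o\<^sub>L (sg (a j) *\<^sub>R X))
      = scalar_op (1 / (c * c)) o\<^sub>L (scalar_op (c * c) o\<^sub>L (sg (b j) *\<^sub>R X))" by simp
    then have "sg (a j) *\<^sub>R X = sg (b j) *\<^sub>R X"
      using p(1) by (simp add: blinfun_compose_assoc[symmetric] scalar_op_mult)
    moreover have "X \<noteq> 0"
    proof
      assume "X = 0"
      then have "v j (X (v 0 y)) = 0" for y by (simp add: blinfun.bilinear_simps)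
      then have "y = 0" for y :: 'h by (simp add: X_def spin_square_apply[OF v.spin])
      then have "id_blinfun = (0 :: 'h \<Rightarrow>\<^sub>L 'h)" by (intro blinfun_eqI) simp
      then have "v.n2 id_blinfun = v.n2 0" by simp
      then show False by (simp add: v.n2_id v.n2_zero)
    qed
    ultimately have "sg (a j) = sg (b j)" by simp
    then show "a j = b j" by (simp add: sg_inject)
  qed
qed

end

section \<open>Cocycle perturbations of a binary shift\<close>

lemma (in vN_algebra) Ad_endo:
  assumes u: "u \<in> R" "unitary_op u"
  shows "unital_star_endo R (Ad u)"
proof -
  have uu: "adj u (u x) = x" "u (adj u x) = x" for x
    using u(2) by (auto simp: unitary_op_def dest: blinfun_compose_eqD)
  note cu = clinear[OF u(1)] adj_clinear[OF clinear[OF u(1)]]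
  show ?thesis
    unfolding unital_star_endo_def
  proof (intro conjI ballI allI)
    show "Ad u ` R \<subseteq> R" using u by (auto simp: Ad_def)
    show "Ad u id_blinfun = id_blinfun" using u(2) by (simp add: Ad_def unitary_op_def)
    fix S assume S: "S \<in> R"
    show "Ad u (adj S) = adj (Ad u S)"
      using cu clinear[OF S] adj_clinear[OF clinear[OF S]]
      by (simp add: Ad_def adj_compose clinear_ops_intros adj_adj blinfun_compose_assoc)
    show "Ad u (scalar_op c o\<^sub>L S) = scalar_op c o\<^sub>L Ad u S" for c
      by (rule blinfun_eqI) (simp add: Ad_def clinear_opsD[OF cu(1)])
    fix T assume T: "T \<in> R"
    show "Ad u (S + T) = Ad u S + Ad u T" by (simp add: Ad_def compose_bilinear)
    show "Ad u (S o\<^sub>L T) = Ad u S o\<^sub>L Ad u T"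
      by (rule blinfun_eqI) (simp add: Ad_def uu)
  qed
qed

lemma (in vN_algebra) endo_compose:
  assumes \<alpha>: "unital_star_endo R \<alpha>" and \<beta>: "unital_star_endo R \<beta>"
  shows "unital_star_endo R (\<beta> \<circ> \<alpha>)"
proof -
  note A = unital_star_endoD[OF \<alpha>] and B = unital_star_endoD[OF \<beta>]
  show ?thesis
    unfolding unital_star_endo_def
  proof (intro conjI ballI allI)
    show "(\<beta> \<circ> \<alpha>) ` R \<subseteq> R" by (auto simp: A(1) B(1))
    show "(\<beta> \<circ> \<alpha>) id_blinfun = id_blinfun" by (simp add: A(2) B(2))
    fix S assume S: "S \<in> R"
    show "(\<beta> \<circ> \<alpha>) (adj S) = adj ((\<beta> \<circ> \<alpha>) S)" using S by (simp add: A(1,6) B(6))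
    show "(\<beta> \<circ> \<alpha>) (scalar_op c o\<^sub>L S) = scalar_op c o\<^sub>L (\<beta> \<circ> \<alpha>) S" for c
      using S by (simp add: A(1,4) B(4))
    fix T assume T: "T \<in> R"
    show "(\<beta> \<circ> \<alpha>) (S + T) = (\<beta> \<circ> \<alpha>) S + (\<beta> \<circ> \<alpha>) T" using S T by (simp add: A(1,3) B(3))
    show "(\<beta> \<circ> \<alpha>) (S o\<^sub>L T) = (\<beta> \<circ> \<alpha>) S o\<^sub>L (\<beta> \<circ> \<alpha>) T" using S T by (simp add: A(1,5) B(5))
  qed
qed

lemma (in vN_algebra) cocycle_conjugate_Ad:
  assumes \<alpha>: "unital_star_endo R \<alpha>" and u: "u \<in> R" "unitary_op u"
  shows "cocycle_conjugate R (Ad u \<circ> \<alpha>) \<alpha>"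
  unfolding cocycle_conjugate_def
proof (intro bexI conjI)
  show "adj u \<in> R" using u by auto
  have uu: "adj u (u x) = x" "u (adj u x) = x" for x
    using u(2) by (auto simp: unitary_op_def dest: blinfun_compose_eqD)
  show "unitary_op (adj u)"
    using u by (auto simp: unitary_op_def adj_adj adj_clinear)
  show "conjugate R (Ad (adj u) \<circ> (Ad u \<circ> \<alpha>)) \<alpha>"
    unfolding conjugate_def
  proof (intro exI[of _ "\<lambda>T. T"] conjI ballI)
    show "star_automorphism R (\<lambda>T. T)"
      by (auto simp: star_automorphism_def unital_star_endo_def bij_betw_def inj_on_def)
    fix T assume "T \<in> R"
    then have "inv_into R (\<lambda>T. T) T = T" using inv_into_f_f[of "\<lambda>T. T" R T] by (simp add: inj_on_def)
    moreover have "Ad (adj u) (Ad u X) = X" for X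
      by (rule blinfun_eqI) (simp add: Ad_def adj_adj[OF clinear[OF u(1)]] uu)
    ultimately show "(Ad (adj u) \<circ> (Ad u \<circ> \<alpha>)) T = \<alpha> (inv_into R (\<lambda>T. T) T)" by simp
  qed
qed

lemma word_commute_pm:
  assumes "spin_system a v"
  shows "pm (word v p o\<^sub>L word v q) (word v q o\<^sub>L word v p)"
  using word_mult[OF assms, of p q] pm_sym[OF word_mult[OF assms, of q p]]
  by (metis add.commute pm_trans)

text \<open>A word is self-adjoint or skew-adjoint, so \<open>k\<close> is \<open>1\<close> or the imaginary unit.\<close>

lemma self_adjoint_word:
  assumes sp: "spin_system a v"
  obtains k where "k \<noteq> 0" "adj (scalar_op k o\<^sub>L word v z) = scalar_op k o\<^sub>L word v z"
    "(scalar_op k o\<^sub>L word v z) o\<^sub>L (scalar_op k o\<^sub>L word v z) = id_blinfun"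
proof -
  let ?W = "word v z"
  have cW: "?W \<in> clinear_ops" "adj ?W \<in> clinear_ops" using word_clinear[OF sp] adj_clinear by auto
  have un: "adj ?W (?W x) = x" for x using blinfun_compose_eqD[OF word_unitary(1)[OF sp]] by simp
  from word_adj[OF sp, of z] consider "adj ?W = ?W" | "adj ?W = - ?W" by (auto simp: pm_def)
  then show thesis
  proof cases
    case 1
    then show thesis using word_unitary(1)[OF sp, of z] by (intro that[of 1]) simp_all
  next
    case 2
    show thesis
    proof (rule that[of \<i>])
      show "adj (scalar_op \<i> o\<^sub>L ?W) = scalar_op \<i> o\<^sub>L ?W"
        using cW by (intro blinfun_eqI)
          (simp add: adj_compose clinear_ops_intros adj_scalar_op 2 blinfun.bilinear_simps clinear_opsD)
      show "(scalar_op \<i> o\<^sub>L ?W) o\<^sub>L (scalar_op \<i> o\<^sub>L ?W) = id_blinfun"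
      proof (rule blinfun_eqI)
        fix x
        have "?W (?W x) = - x" using un[of x] unfolding 2 by (simp add: blinfun.minus_left minus_equation_iff)
        then show "((scalar_op \<i> o\<^sub>L ?W) o\<^sub>L (scalar_op \<i> o\<^sub>L ?W)) x = id_blinfun x"
          using cW by (simp add: clinear_opsD scaleC_scaleC)
      qed
    qed simp
  qed
qed

text \<open>Generation as a von Neumann algebra is kept alongside density of the words, because the perturbed
  shifts inherit it directly: their generators and the \<open>v\<^sub>i\<close> are in the same von Neumann algebras.\<close>

locale shift_generated = spin_generated R \<tau> a v
  for R :: "('h::complex_hilbert_space \<Rightarrow>\<^sub>L 'h) set" and \<tau> a v +
  fixes \<alpha> assumes endo: "unital_star_endo R \<alpha>" and shift: "\<And>i. \<alpha> (v i) = v (Suc i)"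
    and generates: "von_neumann_algebra hull (range v) = R"
begin

lemma endo_word_shift: "\<alpha> (word v p) = word v (pCons 0 p)"
  using endo_word[OF endo v_mem] shift by simp

text \<open>Conjugation by \<open>u = (1 + iZ)/\<surd>2\<close>, for a self-adjoint unitary word \<open>Z\<close>, fixes the words that commute
  with \<open>Z\<close> and multiplies the others by \<open>iZ\<close>: on words it acts as a symplectic transvection.  For a
  perturbing word \<open>z\<close> of degree at most \<open>m\<close>, the perturbed shift follows \<open>\<alpha>\<close> up to \<open>v\<^sub>m\<close>, then
  replaces \<open>v\<^sub>m\<^sub>+\<^sub>1\<close> by the product with \<open>Z\<close>, and the orbit of \<open>v\<^sub>0\<close> still has one word of each degree.\<close>

lemma perturbed_shift:
  assumes z: "degree z \<le> m" "pairing a 0 z = 1" "\<And>i. 1 \<le> i \<Longrightarrow> i \<le> m \<Longrightarrow> pairing a (int i) z = 0"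
    "pairing a (int (Suc m)) z = 1"
  shows "\<exists>\<beta> b w. shift_generated R \<tau> b w \<beta> \<and> \<not> periodic (mirror b) \<and> cocycle_conjugate R \<beta> \<alpha> \<and>
    (\<forall>j\<le>m. b j = a j) \<and> b (Suc m) \<noteq> a (Suc m)"
proof -
  obtain k where k: "k \<noteq> 0" "adj (scalar_op k o\<^sub>L word v z) = scalar_op k o\<^sub>L word v z"
    "(scalar_op k o\<^sub>L word v z) o\<^sub>L (scalar_op k o\<^sub>L word v z) = id_blinfun"
    using self_adjoint_word[OF spin] .
  define Z where "Z = scalar_op k o\<^sub>L word v z"
  have Z: "Z \<in> R" "adj Z = Z" "Z o\<^sub>L Z = id_blinfun" using k by (auto simp: Z_def)
  note cZ = clinear[OF Z(1)]
  have ZZ: "Z (Z x) = x" for x using blinfun_compose_eqD[OF Z(3)] by simp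
  define u where "u = (1 / sqrt 2) *\<^sub>R (id_blinfun + (scalar_op \<i> o\<^sub>L Z))"
  have uR: "u \<in> R" unfolding u_def using Z(1) by (intro mem_scaleR mem_add mem_compose mem_id mem_scalar)
  have au: "adj u = (1 / sqrt 2) *\<^sub>R (id_blinfun - (scalar_op \<i> o\<^sub>L Z))"
    using cZ by (intro blinfun_eqI)
      (simp add: u_def adj_scaleR adj_add clinear_ops_intros adj_compose adj_scalar_op Z(2) blinfun.bilinear_simps clinear_opsD)
  have ss: "(1 / sqrt 2) *\<^sub>R (1 / sqrt 2) *\<^sub>R (y + y) = y" for y :: 'h
    by (simp add: scaleR_2[symmetric])
  have uapp: "u x = (1 / sqrt 2) *\<^sub>R (x + \<i> *\<^sub>C Z x)" "adj u x = (1 / sqrt 2) *\<^sub>R (x - \<i> *\<^sub>C Z x)" for x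
    by (simp_all add: au, simp_all add: u_def blinfun.bilinear_simps)
  have iZ: "Z (\<i> *\<^sub>C x) = \<i> *\<^sub>C Z x" for x by (rule clinear_opsD[OF cZ])
  have uu: "adj u (u x) = x" "u (adj u x) = x" for x
    unfolding uapp using ss[of x]
    by (simp_all add: blinfun.bilinear_simps iZ ZZ scaleC_scaleR scaleC_add_right scaleC_diff_right scaleC_scaleC
        scaleR_diff_right[symmetric] scaleR_add_right[symmetric] del: scaleR_scaleR)
  have unitary: "unitary_op u" using uu clinear[OF uR] by (auto simp: unitary_op_def blinfun_eq_iff)
  have Ad_comm: "Ad u T = T" if "T o\<^sub>L Z = Z o\<^sub>L T" "T \<in> R" for T
  proof (rule blinfun_eqI)
    fix x
    have TZ: "T (Z y) = Z (T y)" for y using that(1) by (metis blinfun_apply_blinfun_compose)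
    have "T (adj u x) = adj u (T x)"
      by (simp add: uapp blinfun.bilinear_simps clinear_opsD[OF clinear[OF that(2)]] TZ)
    then show "Ad u T x = T x" by (simp add: Ad_def uu)
  qed
  have Ad_anti: "Ad u T = scalar_op \<i> o\<^sub>L (Z o\<^sub>L T)" if "T o\<^sub>L Z = - (Z o\<^sub>L T)" "T \<in> R" for T
  proof (rule blinfun_eqI)
    fix x
    have TZ: "T (Z y) = - Z (T y)" for y
      using that(1) by (metis blinfun_apply_blinfun_compose blinfun.minus_left)
    have "T (adj u x) = u (T x)"
      by (simp add: uapp blinfun.bilinear_simps clinear_opsD[OF clinear[OF that(2)]] TZ)
    then have "Ad u T x = u (u (T x))" by (simp add: Ad_def)
    also have "\<dots> = (1 / sqrt 2) *\<^sub>R (1 / sqrt 2) *\<^sub>R (\<i> *\<^sub>C Z (T x) + \<i> *\<^sub>C Z (T x))"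
      unfolding uapp by (simp add: blinfun.bilinear_simps iZ ZZ scaleC_scaleR scaleC_add_right scaleC_scaleC
        scaleR_add_right[symmetric] del: scaleR_scaleR)
    also have "\<dots> = \<i> *\<^sub>C Z (T x)" by (rule ss)
    finally show "Ad u T x = (scalar_op \<i> o\<^sub>L (Z o\<^sub>L T)) x" by simp
  qed
  have dich: "word v p o\<^sub>L Z = Z o\<^sub>L word v p \<or> word v p o\<^sub>L Z = - (Z o\<^sub>L word v p)" for p
  proof -
    have "word v p o\<^sub>L Z = scalar_op k o\<^sub>L (word v p o\<^sub>L word v z)"
      unfolding Z_def by (rule blinfun_eqI) (simp add: clinear_opsD[OF word_clinear[OF spin]])
    moreover have "Z o\<^sub>L word v p = scalar_op k o\<^sub>L (word v z o\<^sub>L word v p)"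
      by (simp add: Z_def blinfun_compose_assoc)
    ultimately show ?thesis using word_commute_pm[OF spin, of p z] by (auto simp: pm_def compose_bilinear)
  qed
  have vZ: "v i o\<^sub>L Z = sg (pairing a (int i) z) *\<^sub>R (Z o\<^sub>L v i)" for i
    by (rule blinfun_eqI) (simp add: Z_def clinear_opsD[OF spin_systemD(2)[OF spin]]
        spin_commute_word_apply[OF spin] blinfun.bilinear_simps scaleC_scaleR)
  define \<beta> where "\<beta> = Ad u \<circ> \<alpha>"
  have \<beta>: "unital_star_endo R \<beta>" unfolding \<beta>_def by (rule endo_compose[OF endo Ad_endo[OF uR unitary]])
  define r where "r = rec_nat (1::bit poly) (\<lambda>_ p. pCons 0 p +
    (if word v (pCons 0 p) o\<^sub>L Z = Z o\<^sub>L word v (pCons 0 p) then 0 else z))"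
  have r0: "r 0 = 1" and rS: "\<And>i. r (Suc i) = pCons 0 (r i) +
    (if word v (pCons 0 (r i)) o\<^sub>L Z = Z o\<^sub>L word v (pCons 0 (r i)) then 0 else z)"
    by (simp_all add: r_def)
  define w where "w i = (\<beta> ^^ i) (v 0)" for i
  have w0: "w 0 = v 0" and wS: "\<And>i. w (Suc i) = \<beta> (w i)" by (simp_all add: w_def)
  have w_word: "\<exists>c. c \<noteq> 0 \<and> w i = scalar_op c o\<^sub>L word v (r i)" for i
  proof (induction i)
    case 0 show ?case by (rule exI[of _ 1]) (simp add: w0 r0)
  next
    case (Suc i)
    then obtain c where c: "c \<noteq> 0" "w i = scalar_op c o\<^sub>L word v (r i)" by blast
    let ?T = "word v (pCons 0 (r i))"
    have wi: "w (Suc i) = scalar_op c o\<^sub>L Ad u ?T"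
      unfolding wS c(2) \<beta>_def using endo_word_shift[of "r i"] unital_star_endoD(4)[OF Ad_endo[OF uR unitary], of ?T c]
      by (simp add: unital_star_endoD(4)[OF endo] del: word_pCons_0)
    show ?case
    proof (cases "?T o\<^sub>L Z = Z o\<^sub>L ?T")
      case True
      then show ?thesis using c(1) wi Ad_comm[OF True word_mem] rS[of i]
        by (intro exI[of _ c]) (simp del: word_pCons_0)
    next
      case False
      then have anti: "?T o\<^sub>L Z = - (Z o\<^sub>L ?T)" using dich by blast
      have "pm (word v z o\<^sub>L ?T) (word v (r (Suc i)))"
        using word_mult[OF spin, of z "pCons 0 (r i)"] False rS[of i] by (simp add: add.commute del: word_pCons_0)
      then obtain s :: complex where s: "s \<noteq> 0" "word v z o\<^sub>L ?T = scalar_op s o\<^sub>L word v (r (Suc i))"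
        unfolding pm_def
      proof
        assume "word v z o\<^sub>L ?T = word v (r (Suc i))"
        then show thesis by (intro that[of 1]) simp_all
      next
        assume "word v z o\<^sub>L ?T = - word v (r (Suc i))"
        then show thesis by (intro that[of "-1"]) (simp_all add: scalar_op_minus compose_bilinear)
      qed
      have "w (Suc i) = scalar_op c o\<^sub>L (scalar_op \<i> o\<^sub>L (scalar_op k o\<^sub>L (word v z o\<^sub>L ?T)))"
        unfolding wi Ad_anti[OF anti word_mem] Z_def by (simp add: blinfun_compose_assoc)
      also have "\<dots> = scalar_op (c * \<i> * k * s) o\<^sub>L word v (r (Suc i))"
        unfolding s(2) by (rule blinfun_eqI) (simp add: scaleC_scaleC mult.assoc)
      finally show ?thesis using c(1) k(1) s(1) by (intro exI[of _ "c * \<i> * k * s"]) simp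
    qed
  qed
  have r_low: "r i = monom 1 i" if "i \<le> m" for i
    using that
  proof (induction i)
    case 0 show ?case by (simp add: r0 monom_0 one_pCons)
  next
    case (Suc i)
    have p: "pCons 0 (r i) = monom 1 (Suc i)" using Suc by (simp add: monom_Suc)
    show ?case unfolding rS p using vZ[of "Suc i"] z(3)[of "Suc i"] Suc.prems by (simp add: word_monom)
  qed
  have r_m: "r (Suc m) = monom 1 (Suc m) + z"
  proof -
    have p: "pCons 0 (r m) = monom 1 (Suc m)" using r_low[of m] by (simp add: monom_Suc)
    have "v (Suc m) o\<^sub>L Z \<noteq> Z o\<^sub>L v (Suc m)"
    proof
      assume "v (Suc m) o\<^sub>L Z = Z o\<^sub>L v (Suc m)"
      then have 0: "Z o\<^sub>L v (Suc m) = - (Z o\<^sub>L v (Suc m))" using vZ[of "Suc m"] z(4) by simp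
      then have "(2::real) *\<^sub>R (Z o\<^sub>L v (Suc m)) = 0" by (simp add: scaleR_2 eq_neg_iff_add_eq_0)
      then have zv: "Z o\<^sub>L v (Suc m) = 0" by simp
      have "id_blinfun = (0 :: 'h \<Rightarrow>\<^sub>L 'h)"
      proof (rule blinfun_eqI)
        fix x
        have "Z (v (Suc m) (v (Suc m) x)) = 0" using blinfun_compose_eqD[OF zv] by simp
        then have "Z (Z x) = 0" by (simp add: spin_square_apply[OF spin] blinfun.zero_right)
        then show "id_blinfun x = (0 :: 'h \<Rightarrow>\<^sub>L 'h) x" by (simp add: ZZ)
      qed
      then show False using n2_id n2_zero by simp
    qed
    then show ?thesis unfolding rS p by (simp add: word_monom)
  qed
  have r_deg: "degree (r i) = i" "r i \<noteq> 0" for i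
  proof -
    have "degree (r i) = i \<and> r i \<noteq> 0"
    proof (induction i)
      case (Suc i)
      show ?case
      proof (cases "Suc i \<le> m")
        case True then show ?thesis using r_low by (simp add: degree_monom_eq)
      next
        case False
        have d: "degree (pCons 0 (r i)) = Suc i" using Suc by simp
        have "degree (r (Suc i)) = Suc i"
          unfolding rS using degree_add_eq_left[of z "pCons 0 (r i)"] z(1) False d by (simp del: degree_pCons_eq_if)
        then show ?thesis by auto
      qed
    qed (simp add: r0)
    then show "degree (r i) = i" "r i \<noteq> 0" by auto
  qed
  define b where "b j = pairing a 0 (r j)" for j
  have b_low: "b j = a j" if "j \<le> m" for j
    unfolding b_def r_low[OF that] conv_monom by (metis diff_0 mirror_of_nat mirror_uminus)
  have b_m: "b (Suc m) \<noteq> a (Suc m)"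
  proof -
    have "b (Suc m) = mirror a (0 - int (Suc m)) + 1" unfolding b_def r_m conv_add conv_monom z(2) ..
    also have "mirror a (0 - int (Suc m)) = a (Suc m)" by (metis diff_0 mirror_of_nat mirror_uminus)
    finally show ?thesis by (cases "a (Suc m)") simp_all
  qed
  have wR: "w i \<in> R" for i using unital_star_endoD(1)[OF endo_power[OF \<beta>] v_mem] by (simp add: w_def)
  have w_0j: "w 0 o\<^sub>L w j = sg (b j) *\<^sub>R (w j o\<^sub>L w 0)" for j
  proof -
    obtain c where c: "w j = scalar_op c o\<^sub>L word v (r j)" using w_word by blast
    show ?thesis unfolding c w0 b_def
      using spin_commute_word_apply[OF spin, of 0 "r j"]
      by (intro blinfun_eqI) (simp add: clinear_opsD[OF spin_systemD(2)[OF spin]] blinfun.bilinear_simps scaleC_scaleR)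
  qed
  have spin_w: "spin_system b w"
    unfolding spin_system_def
  proof (intro conjI allI)
    show "b 0 = 0" using b_low[of 0] spin_systemD(1)[OF spin] by simp
    fix i j
    note B = unital_star_endoD[OF endo_power[OF \<beta>, of i]]
    show "w i \<in> clinear_ops" using wR clinear by blast
    show "adj (w i) = w i" using B(6)[OF v_mem, of 0] spin_systemD(3)[OF spin] by (simp add: w_def)
    show "w i o\<^sub>L w i = id_blinfun" using B(5)[OF v_mem v_mem, of 0 0] B(2) spin_systemD(4)[OF spin] by (simp add: w_def)
    have wij: "(\<beta> ^^ i) (w j) = w (i + j)" by (simp add: w_def funpow_add)
    show "w i o\<^sub>L w (i + j) = sg (b j) *\<^sub>R (w (i + j) o\<^sub>L w i)"
      using arg_cong[OF w_0j[of j], of "\<beta> ^^ i"] B(5)[OF wR[of 0] wR[of j]] B(5)[OF wR[of j] wR[of 0]]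
        endo_scaleR[OF endo_power[OF \<beta>] mem_compose[OF wR[of j] wR[of 0]], of i "sg (b j)"] wij
      by (simp add: w0) (simp add: w_def)
  qed
  \<comment> \<open>The words of the \<open>r i\<close> have every degree, so the \<open>w\<^sub>i\<close> generate all words.\<close>
  have span: "word v p \<in> N"
    if N: "\<And>S T. S \<in> N \<Longrightarrow> T \<in> N \<Longrightarrow> S o\<^sub>L T \<in> N" "\<And>c. scalar_op c \<in> N" "range w \<subseteq> N" for N p
  proof -
    have sc: "scalar_op c o\<^sub>L T \<in> N" if "T \<in> N" for c T using N(1,2) that by blast
    have neg: "- T \<in> N" if "T \<in> N" for T
      using sc[OF that, of "-1"] by (simp add: scalar_op_minus compose_bilinear)
    have "p \<in> {p. word v p \<in> N}"
    proof (rule triangular_span[of _ r])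
      show "0 \<in> {p. word v p \<in> N}" using N(2)[of 1] by simp
      show "p + q \<in> {p. word v p \<in> N}" if "p \<in> {p. word v p \<in> N}" "q \<in> {p. word v p \<in> N}" for p q
      proof -
        have "word v p o\<^sub>L word v q \<in> N" using that N(1) by simp
        then show ?thesis using word_mult[OF spin, of p q] neg unfolding pm_def by (metis mem_Collect_eq minus_minus)
      qed
      show "r i \<in> {p. word v p \<in> N}" for i
      proof -
        obtain c where c: "c \<noteq> 0" "w i = scalar_op c o\<^sub>L word v (r i)" using w_word by blast
        have "scalar_op (1 / c) o\<^sub>L w i = word v (r i)"
          using c by (simp add: blinfun_compose_assoc[symmetric] scalar_op_mult)
        moreover have "scalar_op (1 / c) o\<^sub>L w i \<in> N" using sc N(3) by blast
        ultimately show ?thesis by simp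
      qed
    qed (use r_deg in auto)
    then show ?thesis by simp
  qed
  have hull_w: "von_neumann_algebra hull (range w) = R"
  proof
    show "von_neumann_algebra hull range w \<subseteq> R" by (rule hull_minimal) (use wR vN in auto)
    have "R \<subseteq> N" if N: "von_neumann_algebra N" "range w \<subseteq> N" for N
    proof -
      have "v i \<in> N" for i
        using span[of N "monom 1 i"] N unfolding word_monom von_neumann_algebra_def unital_star_subalgebra_def by blast
      then have "von_neumann_algebra hull range v \<subseteq> N" using N(1) by (intro hull_minimal) auto
      then show ?thesis using generates by simp
    qed
    then show "R \<subseteq> von_neumann_algebra hull range w" unfolding hull_def by blast
  qed
  \<comment> \<open>A period of the mirror sequence would make \<open>w\<^sub>0 w\<^sub>p\<close> commute with every generator.\<close>
  have np: "\<not> periodic (mirror b)"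
  proof
    assume "periodic (mirror b)"
    then obtain P where P: "P > 0" "\<And>j. mirror b (j + P) = mirror b j" by (auto simp: periodic_def)
    define p where "p = nat P"
    have p: "p > 0" "int p = P" using P(1) by (auto simp: p_def)
    define t where "t = 1 + r p"
    have "t \<noteq> 0"
    proof
      assume "t = 0"
      then have "r p = 1" by (metis bit_poly_add_eq_0 t_def)
      then show False using r_deg(1)[of p] p(1) by simp
    qed
    then obtain i where i: "pairing a (int i) t = 1" using nondeg by (auto simp: nondegenerate_def)
    define Y where "Y = w 0 o\<^sub>L w p"
    have comm: "w j o\<^sub>L Y = Y o\<^sub>L w j" for j
    proof (rule blinfun_eqI)
      fix x
      have ap: "w j (w l y) = sg (mirror b (int j - int l)) *\<^sub>R w l (w j y)" for l y
        using spin_commute[OF spin_w, of j l] by (metis blinfun_apply_blinfun_compose blinfun.scaleR_left)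
      have "mirror b (int j - int p) = mirror b (int j - int 0)" using P(2)[of "int j - int p"] p(2) by simp
      then show "(w j o\<^sub>L Y) x = (Y o\<^sub>L w j) x"
        by (simp add: Y_def ap[of 0] ap[of p] blinfun.scaleR_right del: of_nat_0)
    qed
    define N where "N = commutant {Y}"
    have "word v (monom 1 i) \<in> N"
    proof (rule span)
      show "S o\<^sub>L T \<in> N" if "S \<in> N" "T \<in> N" for S T
        using that unfolding N_def commutant_def by (auto simp: clinear_ops_intros) (metis blinfun_compose_assoc)
      have "Y \<in> R" using wR by (auto simp: Y_def)
      then show "scalar_op c \<in> N" for c
        using scalar_op_commute[OF clinear, of Y c] by (simp add: N_def commutant_def clinear_ops_intros)
      show "range w \<subseteq> N" using comm wR clinear by (auto simp: N_def commutant_def)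
    qed
    then have vY: "v i o\<^sub>L Y = Y o\<^sub>L v i" by (simp add: word_monom N_def commutant_def)
    obtain c where c: "c \<noteq> 0" "w p = scalar_op c o\<^sub>L word v (r p)" using w_word by blast
    have "Y = scalar_op c o\<^sub>L (word v 1 o\<^sub>L word v (r p))"
      unfolding Y_def c w0 by (rule blinfun_eqI) (simp add: clinear_opsD[OF spin_systemD(2)[OF spin]])
    moreover have "pm (word v 1 o\<^sub>L word v (r p)) (word v t)" unfolding t_def by (rule word_mult[OF spin])
    ultimately have "Y = scalar_op c o\<^sub>L word v t \<or> Y = scalar_op (- c) o\<^sub>L word v t"
      by (auto simp: pm_def compose_bilinear scalar_op_minus)
    then obtain d where d: "d \<noteq> 0" "Y = scalar_op d o\<^sub>L word v t" using c(1) by (metis neg_equal_0_iff_equal)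
    have "word v t = 0"
    proof (rule blinfun_eqI)
      fix x
      have "v i (Y (v i x)) = - Y x"
        using i by (simp add: d clinear_opsD[OF spin_systemD(2)[OF spin]] spin_commute_word_apply[OF spin]
            spin_square_apply[OF spin])
      moreover have "v i (Y (v i x)) = Y x"
        using vY by (metis blinfun_apply_blinfun_compose spin_square_apply[OF spin])
      ultimately have "2 *\<^sub>R Y x = 0" by (simp add: scaleR_2 eq_neg_iff_add_eq_0)
      then have "d *\<^sub>C word v t x = 0" by (simp add: d)
      then have "(1 / d) *\<^sub>C d *\<^sub>C word v t x = 0" by simp
      then show "word v t x = blinfun_apply 0 x" using d(1) by (simp add: scaleC_scaleC)
    qed
    then show False using n2_word[of t] n2_zero by simp
  qed
  have "spin_generated R \<tau> b w"
  proof
    show "spin_system b w" by (rule spin_w)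
    show "nondegenerate b" by (rule nonperiodic_imp_nondegenerate[OF np])
    show "w i \<in> R" for i by (rule wR)
    show "\<exists>F c. finite F \<and> n2 (T - comb w F c) < e" if "T \<in> R" "e > 0" for T e
      by (rule words_dense[OF spin_w hull_w that])
  qed
  then have "shift_generated R \<tau> b w \<beta>"
    by (rule shift_generated.intro) (unfold_locales, rule \<beta>, rule wS[symmetric], rule hull_w)
  then show ?thesis
    using np b_low b_m cocycle_conjugate_Ad[OF endo uR unitary] unfolding \<beta>_def by blast
qed

lemma binary_shift:
  assumes np: "\<not> periodic (mirror a)" shows "binary_shift R \<alpha>"
  unfolding binary_shift_def
proof (intro conjI exI[of _ a] exI[of _ v] allI)
  show "unital_star_endo R \<alpha>" by (rule endo)
  show "bitstream a" using spin_systemD(1)[OF spin] by (simp add: bitstream_def)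
  show "\<not> periodic (mirror a)" by (rule np)
  fix i j
  show "v i \<in> R" by simp
  show "unitary_op (v i)" using spin_systemD(2-4)[OF spin, of i] by (simp add: unitary_op_def)
  show "adj (v i) = v i" by (rule spin_systemD(3)[OF spin])
  show "v i o\<^sub>L v (i + j) = (if a j = 1 then - 1 else 1) *\<^sub>R (v (i + j) o\<^sub>L v i)"
    using spin_systemD(5)[OF spin, of i j] unfolding sg_def .
  show "von_neumann_algebra hull range v = R" by (rule generates)
  show "\<alpha> (v i) = v (Suc i)" by (rule shift)
qed

end

section \<open>Infinitely many shifts in the cocycle conjugacy class\<close>

lemma conjugate_bitstreams_agree:
  assumes A: "shift_generated R \<tau> a v \<alpha>" and B: "shift_generated R \<tau> b w \<beta>" and c: "conjugate R \<alpha> \<beta>"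
  shows "a = b"
proof -
  interpret A: shift_generated R \<tau> a v \<alpha> by fact
  interpret B: shift_generated R \<tau> b w \<beta> by fact
  obtain \<gamma> where \<gamma>: "star_automorphism R \<gamma>" "\<And>T. T \<in> R \<Longrightarrow> \<alpha> T = \<gamma> (\<beta> (inv_into R \<gamma> T))"
    using c by (auto simp: conjugate_def)
  have e: "unital_star_endo R \<gamma>" and inj: "inj_on \<gamma> R" using \<gamma>(1) by (auto simp: star_automorphism_def bij_betw_def)
  interpret C: spin_generated R \<tau> b "\<lambda>i. \<gamma> (w i)" by (rule B.automorphism_spin_generated[OF \<gamma>(1)])
  have "\<alpha> (\<gamma> (w i)) = \<gamma> (w (Suc i))" for i
    using \<gamma>(2)[of "\<gamma> (w i)"] unital_star_endoD(1)[OF e B.v_mem] inv_into_f_f[OF inj B.v_mem]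
    by (simp add: B.shift)
  then interpret two_generators R \<tau> a v b "\<lambda>i. \<gamma> (w i)" \<alpha>
    by unfold_locales (auto simp: A.endo A.shift)
  show ?thesis by (rule bitstreams_agree)
qed

theorem theorem5:
  fixes R :: "('h::complex_hilbert_space \<Rightarrow>\<^sub>L 'h) set"
    and \<alpha> :: "('h \<Rightarrow>\<^sub>L 'h) \<Rightarrow> 'h \<Rightarrow>\<^sub>L 'h"
  assumes "hyperfinite_II1_factor R"
    and "binary_shift R \<alpha>"
  shows "\<exists>\<beta> :: nat \<Rightarrow> ('h \<Rightarrow>\<^sub>L 'h) \<Rightarrow> 'h \<Rightarrow>\<^sub>L 'h.
           (\<forall>k. binary_shift R (\<beta> k) \<and> cocycle_conjugate R (\<beta> k) \<alpha> \<and> \<not> conjugate R (\<beta> k) \<alpha>) \<and>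
           (\<forall>j k. j \<noteq> k \<longrightarrow> \<not> conjugate R (\<beta> j) (\<beta> k))"
proof -
  obtain \<tau> where "von_neumann_algebra R" "faithful_normal_trace R \<tau>"
    using assms(1) by (auto simp: hyperfinite_II1_factor_def II1_factor_def factor_def)
  then interpret traced_algebra R \<tau> by unfold_locales
  obtain a v where \<alpha>: "unital_star_endo R \<alpha>" and a: "bitstream a" "\<not> periodic (mirror a)"
    and v: "\<And>i. v i \<in> R" "\<And>i. unitary_op (v i)" "\<And>i. adj (v i) = v i"
      "\<And>i j. v i o\<^sub>L v (i + j) = (if a j = 1 then -1 else 1) *\<^sub>R (v (i + j) o\<^sub>L v i)"
      "von_neumann_algebra hull (range v) = R" "\<And>i. \<alpha> (v i) = v (Suc i)"
    using assms(2) unfolding binary_shift_def by blast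
  have sp: "spin_system a v"
    unfolding spin_system_def
  proof (intro conjI allI)
    show "a 0 = 0" using a(1) by (simp add: bitstream_def)
    fix i j
    show "v i \<in> clinear_ops" "adj (v i) = v i" "v i o\<^sub>L v i = id_blinfun"
      using v(2)[of i] v(3)[of i] by (auto simp: unitary_op_def)
    show "v i o\<^sub>L v (i + j) = sg (a j) *\<^sub>R (v (i + j) o\<^sub>L v i)" unfolding sg_def by (rule v(4))
  qed
  interpret A: shift_generated R \<tau> a v \<alpha>
  proof
    show "spin_system a v" by (rule sp)
    show "nondegenerate a" by (rule nonperiodic_imp_nondegenerate[OF a(2)])
    show "\<exists>F c. finite F \<and> n2 (T - comb v F c) < e" if "T \<in> R" "e > 0" for T e
      by (rule words_dense[OF sp v(5) that])
  qed (use v \<alpha> in auto)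
  have "\<exists>m\<ge>N. \<exists>\<beta> b w. shift_generated R \<tau> b w \<beta> \<and> \<not> periodic (mirror b) \<and> cocycle_conjugate R \<beta> \<alpha> \<and>
    (\<forall>j\<le>m. b j = a j) \<and> b (Suc m) \<noteq> a (Suc m)" for N
  proof -
    obtain m z where "m \<ge> N" "degree z \<le> m" "pairing a 0 z = 1"
      "\<forall>i. 1 \<le> i \<and> i \<le> m \<longrightarrow> pairing a (int i) z = 0" "pairing a (int (Suc m)) z = 1"
      using exists_perturbing_word[OF A.nondeg spin_systemD(1)[OF sp], of N] by blast
    then show ?thesis using A.perturbed_shift[of z m] by blast
  qed
  then obtain m \<beta> b w where m: "\<And>N. m N \<ge> N" and gen: "\<And>N. shift_generated R \<tau> (b N) (w N) (\<beta> N)"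
    and np: "\<And>N. \<not> periodic (mirror (b N))" and cc: "\<And>N. cocycle_conjugate R (\<beta> N) \<alpha>"
    and low: "\<And>N j. j \<le> m N \<Longrightarrow> b N j = a j" and top: "\<And>N. b N (Suc (m N)) \<noteq> a (Suc (m N))"
    by metis
  \<comment> \<open>Along this subsequence the positions of first disagreement with \<open>a\<close> increase strictly.\<close>
  define n where "n = rec_nat 0 (\<lambda>_ N. Suc (m N))"
  have nS: "n (Suc k) = Suc (m (n k))" for k by (simp add: n_def)
  have "m (n k) < m (n (Suc k))" for k using m[of "n (Suc k)"] by (simp add: nS)
  then have mono: "m (n j) < m (n k)" if "j < k" for j k
    using that strict_mono_less[of "\<lambda>k. m (n k)"] by (simp add: strict_mono_Suc_iff)
  have differ: "b (n j) \<noteq> b (n k)" if "j < k" for j k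
    using low[of "Suc (m (n j))" "n k"] top[of "n j"] mono[OF that] by (metis Suc_leI)
  show ?thesis
  proof (intro exI[of _ "\<lambda>k. \<beta> (n k)"] conjI allI impI)
    fix k
    show "binary_shift R (\<beta> (n k))" by (rule shift_generated.binary_shift[OF gen np])
    show "cocycle_conjugate R (\<beta> (n k)) \<alpha>" by (rule cc)
    show "\<not> conjugate R (\<beta> (n k)) \<alpha>"
      using conjugate_bitstreams_agree[OF gen A.shift_generated_axioms] top by metis
    fix j assume "j \<noteq> k"
    then show "\<not> conjugate R (\<beta> (n j)) (\<beta> (n k))"
      using conjugate_bitstreams_agree[OF gen gen] differ by (metis linorder_neqE_nat)
  qed
qed

end
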